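(* Let $1 \leqslant p \leqslant 2$. Then the two-dimensional stationary Navier--Stokes equations $$-\Delta U + (U\cdot\nabla)U + \nabla P = F,\qquad \operatorname{div} U = 0 \qquad (x\in\mathbb{R}^2)\qquad (\mathrm{sNS})$$ are ill-posed from $\dot{B}_{p,1}^{\frac{2}{p}-3}(\mathbb{R}^2)$ to $\dot{B}_{p,1}^{\frac{2}{p}-1}(\mathbb{R}^2)$, in the sense that the solution map is discontinuous. More precisely, for any $1\leqslant p\leqslant 2$ there exist a constant $\delta_0=\delta_0(p)>0$, a positive integer $N_0=N_0(p)$, and a sequence $\{F_N\}_{N\in\mathbb{N}}\subset \dot{B}_{p,1}^{\frac{2}{p}-3}(\mathbb{R}^2)$ satisfying $$\lim_{N\to\infty}\|F_N\|_{\dot{B}_{p,1}^{\frac{2}{p}-3}}=0$$ such that if each $F_N$ with $N\geqslant N_0$ generates a solution $U_N\in\dot{B}_{p,1}^{\frac{2}{p}-1}(\mathbb{R}^2)$ of $(\mathrm{sNS})$ (with $F=F_N$), then $$\inf_{N\geqslant N_0}\|U_N\|_{\dot{B}_{p,1}^{\frac{2}{p}-1}}\geqslant\delta_0 .$$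
   Context: Besov spaces: let $\{\Phi_j\}_{j\in\mathbb{Z}}\subset\mathscr{S}(\mathbb{R}^2)$ satisfy $0\leqslant\widehat{\Phi_0}\leqslant1$, $\operatorname{supp}\widehat{\Phi_0}\subset\{2^{-1}\leqslant|\xi|\leqslant2\}$, $\widehat{\Phi_j}(\xi)=\widehat{\Phi_0}(2^{-j}\xi)$ and $\sum_{j\in\mathbb{Z}}\widehat{\Phi_j}(\xi)=1$ for $\xi\neq0$; put $\Delta_jF:=\mathscr{F}^{-1}[\widehat{\Phi_j}\widehat{F}]$. For $1\leqslant p,q\leqslant\infty$, $s\in\mathbb{R}$, $\dot{B}_{p,q}^s(\mathbb{R}^2)$ is the set of $F\in\mathscr{S}'(\mathbb{R}^2)/\mathscr{P}(\mathbb{R}^2)$ ($\mathscr{P}$ = polynomials) with $\|F\|_{\dot{B}_{p,q}^s}:=\|\{2^{sj}\|\Delta_jF\|_{L^p}\}_{j\in\mathbb{Z}}\|_{\ell^q}<\infty$. If $s<2/p$ or $(s,q)=(2/p,1)$, it is identified with the space of $F\in\mathscr{S}'(\mathbb{R}^2)$ such that $F=\sum_{j\in\mathbb{Z}}\Delta_jF$ in $\mathscr{S}'(\mathbb{R}^2)$ and $\|F\|_{\dot{B}_{p,q}^s}<\infty$. The same notation is used for vector fields. Solutions: let $\mathbb{P}:=I+\nabla\operatorname{div}(-\Delta)^{-1}$ be the Helmholtz projection onto divergence-free vector fields. For a Banach space $S\subset\mathscr{S}'(\mathbb{R}^2)$, $U\in S$ is called a solution of $(\mathrm{sNS})$ with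 external force $F$ if $$U=(-\Delta)^{-1}\mathbb{P}F-(-\Delta)^{-1}\mathbb{P}\operatorname{div}(U\otimes U)\quad\text{in } S.$$ Well-posedness: for Banach spaces $D,S\subset\mathscr{S}'(\mathbb{R}^2)$, write $B_D(\delta):=\{F\in D:\|F\|_D<\delta\}$ and $B_S(\varepsilon):=\{U\in S:\|U\|_S<\varepsilon\}$. The equation $(\mathrm{sNS})$ is well-posed from $D$ to $S$ if: (i) there is $\delta>0$ such that for any $F\in B_D(\delta)$, $(\mathrm{sNS})$ possesses a solution $U\in S$; (ii) there is $\varepsilon>0$ such that the solution of $(\mathrm{sNS})$ is unique in the class $B_S(\varepsilon)$; (iii) the solution map $B_D(\delta)\ni F\mapsto U\in B_S(\varepsilon)$, well-defined by (i) and (ii), is continuous. It is ill-posed from $D$ to $S$ if it is not well-posed from $D$ to $S$. *)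

theory Defs
  imports
    "HOL-Analysis.Analysis"
    "HOL-Library.Function_Algebras"
    "HOL-Probability.Essential_Supremum"
begin

section \<open>Schwartz functions and tempered distributions on the plane\<close>

definition partial :: "2 \<Rightarrow> (real^2 \<Rightarrow> complex) \<Rightarrow> real^2 \<Rightarrow> complex"
  where "partial i f x = frechet_derivative f (at x) (axis i 1)"

text \<open>A list of coordinate directions plays the role of a multi-index. All iterated partial
  derivatives being Frechet differentiable everywhere amounts to smoothness.\<close>

definition partials :: "2 list \<Rightarrow> (real^2 \<Rightarrow> complex) \<Rightarrow> real^2 \<Rightarrow> complex"
  where "partials \<alpha> f = foldr partial \<alpha> f"

definition schwartz :: "(real^2 \<Rightarrow> complex) set"
  where "schwartz = {f. \<forall>\<alpha>. (\<forall>x. partials \<alpha> f differentiable (at x)) \<and>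
           (\<forall>k::nat. bounded (range (\<lambda>x. (1 + norm x) ^ k *\<^sub>R partials \<alpha> f x)))}"

definition schwartz_seminorm :: "nat \<Rightarrow> (real^2 \<Rightarrow> complex) \<Rightarrow> real"
  where "schwartz_seminorm k f =
           (\<Sum>\<alpha> | length \<alpha> \<le> k. SUP x. (1 + norm x) ^ k * norm (partials \<alpha> f x))"

type_synonym functional = "(real^2 \<Rightarrow> complex) \<Rightarrow> complex"

text \<open>A tempered distribution is a functional on Schwartz functions; it is extended by 0 to all
  other functions, so that HOL equality is equality of distributions.\<close>

definition on_schwartz :: "functional \<Rightarrow> functional"
  where "on_schwartz T = (\<lambda>\<phi>. if \<phi> \<in> schwartz then T \<phi> else 0)"

definition tempered :: "functional set"
  where "tempered = {T.
           (\<forall>\<phi>. \<phi> \<notin> schwartz \<longrightarrow> T \<phi> = 0) \<and>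
           (\<forall>\<phi>\<in>schwartz. \<forall>\<psi>\<in>schwartz. T (\<lambda>x. \<phi> x + \<psi> x) = T \<phi> + T \<psi>) \<and>
           (\<forall>c. \<forall>\<phi>\<in>schwartz. T (\<lambda>x. c * \<phi> x) = c * T \<phi>) \<and>
           (\<exists>C k. \<forall>\<phi>\<in>schwartz. norm (T \<phi>) \<le> C * schwartz_seminorm k \<phi>)}"

definition represents :: "(real^2 \<Rightarrow> complex) \<Rightarrow> functional \<Rightarrow> bool"
  where "represents f T \<longleftrightarrow> f \<in> borel_measurable lborel \<and>
           (\<forall>\<phi>\<in>schwartz. integrable lborel (\<lambda>x. f x * \<phi> x)) \<and>
           T = on_schwartz (\<lambda>\<phi>. LINT x|lborel. f x * \<phi> x)"

definition fourier :: "(real^2 \<Rightarrow> complex) \<Rightarrow> real^2 \<Rightarrow> complex"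
  where "fourier f \<xi> = (LINT x|lborel. cis (- (x \<bullet> \<xi>)) * f x)"

definition inv_fourier :: "(real^2 \<Rightarrow> complex) \<Rightarrow> real^2 \<Rightarrow> complex"
  where "inv_fourier f x = (LINT \<xi>|lborel. cis (x \<bullet> \<xi>) * f \<xi>) / (2 * pi)\<^sup>2"

definition fourier_dist :: "functional \<Rightarrow> functional"
  where "fourier_dist T = on_schwartz (\<lambda>\<phi>. T (fourier \<phi>))"

definition inv_fourier_dist :: "functional \<Rightarrow> functional"
  where "inv_fourier_dist T = on_schwartz (\<lambda>\<phi>. T (inv_fourier \<phi>))"

definition mult_dist :: "(real^2 \<Rightarrow> complex) \<Rightarrow> functional \<Rightarrow> functional"
  where "mult_dist m T = on_schwartz (\<lambda>\<phi>. T (\<lambda>\<xi>. m \<xi> * \<phi> \<xi>))"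

definition partial_dist :: "2 \<Rightarrow> functional \<Rightarrow> functional"
  where "partial_dist i T = on_schwartz (\<lambda>\<phi>. - T (partial i \<phi>))"

definition grad_dist :: "functional \<Rightarrow> functional^2"
  where "grad_dist T = (\<chi> i. partial_dist i T)"

definition div_dist :: "functional^2 \<Rightarrow> functional"
  where "div_dist V = (\<Sum>i\<in>UNIV. partial_dist i (V $ i))"

definition div_matrix_dist :: "functional^2^2 \<Rightarrow> functional^2"
  where "div_matrix_dist W = (\<chi> i. div_dist (W $ i))"


section \<open>Homogeneous Besov spaces of vector fields\<close>

definition littlewood_paley :: "(int \<Rightarrow> real^2 \<Rightarrow> complex) \<Rightarrow> bool"
  where "littlewood_paley \<Phi> \<longleftrightarrow>
           (\<forall>j. \<Phi> j \<in> schwartz) \<and>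
           (\<forall>\<xi>. fourier (\<Phi> 0) \<xi> \<in> \<real> \<and> 0 \<le> Re (fourier (\<Phi> 0) \<xi>) \<and> Re (fourier (\<Phi> 0) \<xi>) \<le> 1) \<and>
           closure {\<xi>. fourier (\<Phi> 0) \<xi> \<noteq> 0} \<subseteq> {\<xi>. 1 / 2 \<le> norm \<xi> \<and> norm \<xi> \<le> 2} \<and>
           (\<forall>j \<xi>. fourier (\<Phi> j) \<xi> = fourier (\<Phi> 0) ((2 powr (- real_of_int j)) *\<^sub>R \<xi>)) \<and>
           (\<forall>\<xi>. \<xi> \<noteq> 0 \<longrightarrow> ((\<lambda>j. fourier (\<Phi> j) \<xi>) has_sum 1) UNIV)"

definition lp_block :: "(int \<Rightarrow> real^2 \<Rightarrow> complex) \<Rightarrow> int \<Rightarrow> functional \<Rightarrow> functional"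
  where "lp_block \<Phi> j T = inv_fourier_dist (mult_dist (fourier (\<Phi> j)) (fourier_dist T))"

text \<open>Only used for exponents \<open>r > 0\<close>.\<close>

definition ennreal_powr :: "ennreal \<Rightarrow> real \<Rightarrow> ennreal"
  where "ennreal_powr x r = (if x = \<infinity> then \<infinity> else ennreal (enn2real x powr r))"

text \<open>The norm of \<open>L\<^sup>p(M)\<close>, \<open>1 \<le> p \<le> \<infinity>\<close>, of a nonnegative function; over a counting measure it is
  the norm of the sequence space.\<close>

definition Lp_norm :: "'a measure \<Rightarrow> ennreal \<Rightarrow> ('a \<Rightarrow> ennreal) \<Rightarrow> ennreal"
  where "Lp_norm M p g =
           (if p = \<infinity> then esssup M g
            else ennreal_powr (\<integral>\<^sup>+ x. ennreal_powr (g x) (enn2real p) \<partial>M) (1 / enn2real p))"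

text \<open>The infimum ranges over the functions representing the distribution, which agree almost
  everywhere. It is \<open>\<infinity>\<close> if the distribution is not a function.\<close>

definition Lp_norm_dist :: "ennreal \<Rightarrow> functional^2 \<Rightarrow> ennreal"
  where "Lp_norm_dist p T =
           (INF f \<in> {f :: real^2 \<Rightarrow> complex^2. \<forall>i. represents (\<lambda>x. f x $ i) (T $ i)}.
              Lp_norm lborel p (\<lambda>x. ennreal (norm (f x))))"

definition besov_norm ::
    "(int \<Rightarrow> real^2 \<Rightarrow> complex) \<Rightarrow> ennreal \<Rightarrow> ennreal \<Rightarrow> real \<Rightarrow> functional^2 \<Rightarrow> ennreal"
  where "besov_norm \<Phi> p q s F =
           Lp_norm (count_space UNIV) q
             (\<lambda>j::int. ennreal (2 powr (s * real_of_int j)) *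
                       Lp_norm_dist p (\<chi> i. lp_block \<Phi> j (F $ i)))"

text \<open>The realisation as a space of tempered distributions, valid for \<open>s < 2/p\<close> and for
  \<open>(s, q) = (2/p, 1)\<close>; no quotient by polynomials is needed in this range. For finite norm
  the series, tested against a Schwartz function, converges absolutely, so unconditional
  convergence is no restriction.\<close>

definition besov ::
    "(int \<Rightarrow> real^2 \<Rightarrow> complex) \<Rightarrow> ennreal \<Rightarrow> ennreal \<Rightarrow> real \<Rightarrow> (functional^2) set"
  where "besov \<Phi> p q s = {F.
           (\<forall>i. F $ i \<in> tempered) \<and>
           (\<forall>i \<phi>. ((\<lambda>j. lp_block \<Phi> j (F $ i) \<phi>) has_sum (F $ i) \<phi>) UNIV) \<and>
           besov_norm \<Phi> p q s F < \<infinity>}"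


section \<open>The stationary Navier--Stokes equations\<close>

text \<open>\<open>(-\<Delta>)\<^sup>-\<^sup>1\<close> as the homogeneous Fourier multiplier with symbol \<open>1/|\<xi>|\<^sup>2\<close>, applied block by block:
  the symbol is singular at the origin, but each \<open>fourier (\<Phi> j)\<close> vanishes near the origin. The
  series converges absolutely in all uses below, and its sum does not depend on \<open>\<Phi>\<close>.\<close>

definition inv_neg_laplacian :: "(int \<Rightarrow> real^2 \<Rightarrow> complex) \<Rightarrow> functional \<Rightarrow> functional"
  where "inv_neg_laplacian \<Phi> T = (\<lambda>\<phi>. \<Sum>\<^sub>\<infinity>j\<in>UNIV.
           inv_fourier_dist
             (mult_dist (\<lambda>\<xi>. fourier (\<Phi> j) \<xi> / of_real ((norm \<xi>)\<^sup>2)) (fourier_dist T)) \<phi>)"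

definition helmholtz :: "(int \<Rightarrow> real^2 \<Rightarrow> complex) \<Rightarrow> functional^2 \<Rightarrow> functional^2"
  where "helmholtz \<Phi> F = F + grad_dist (div_dist (\<chi> i. inv_neg_laplacian \<Phi> (F $ i)))"

definition inv_neg_laplacian_helmholtz ::
    "(int \<Rightarrow> real^2 \<Rightarrow> complex) \<Rightarrow> functional^2 \<Rightarrow> functional^2"
  where "inv_neg_laplacian_helmholtz \<Phi> F = (\<chi> i. inv_neg_laplacian \<Phi> (helmholtz \<Phi> F $ i))"

text \<open>\<open>W = U \<otimes> U\<close>, the pointwise product. For \<open>p \<le> 2\<close> the fields in \<open>besov \<Phi> p 1 (2/p - 1)\<close> are
  square integrable, so \<open>W\<close> exists and is integrable; it is unique.\<close>

definition is_tensor_square :: "functional^2 \<Rightarrow> functional^2^2 \<Rightarrow> bool"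
  where "is_tensor_square U W \<longleftrightarrow>
           (\<exists>u :: real^2 \<Rightarrow> complex^2.
              (\<forall>i. represents (\<lambda>x. u x $ i) (U $ i)) \<and>
              (\<forall>i j. represents (\<lambda>x. u x $ i * u x $ j) (W $ i $ j)))"

definition is_solution ::
    "(int \<Rightarrow> real^2 \<Rightarrow> complex) \<Rightarrow> (functional^2) set \<Rightarrow> functional^2 \<Rightarrow> functional^2 \<Rightarrow> bool"
  where "is_solution \<Phi> S F U \<longleftrightarrow>
           U \<in> S \<and>
           (\<exists>W. is_tensor_square U W \<and>
                U = inv_neg_laplacian_helmholtz \<Phi> F -
                    inv_neg_laplacian_helmholtz \<Phi> (div_matrix_dist W))"

definition norm_ball :: "'a set \<Rightarrow> ('a \<Rightarrow> ennreal) \<Rightarrow> real \<Rightarrow> 'a set"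
  where "norm_ball X N r = {x \<in> X. N x < ennreal r}"

definition norm_continuous_on ::
    "('a :: minus) set \<Rightarrow> ('a \<Rightarrow> ennreal) \<Rightarrow> ('b :: minus \<Rightarrow> ennreal) \<Rightarrow> ('a \<Rightarrow> 'b) \<Rightarrow> bool"
  where "norm_continuous_on A N N' f \<longleftrightarrow>
           (\<forall>x\<in>A. \<forall>e>0. \<exists>d>0. \<forall>y\<in>A. N (y - x) < ennreal d \<longrightarrow> N' (f y - f x) < ennreal e)"

text \<open>The last conjunct is condition (iii): the solution map is a map into the ball of radius
  \<open>\<epsilon>\<close>. It is unique by the second conjunct.\<close>

definition well_posed ::
    "(int \<Rightarrow> real^2 \<Rightarrow> complex) \<Rightarrow> (functional^2) set \<Rightarrow> (functional^2 \<Rightarrow> ennreal) \<Rightarrow>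
     (functional^2) set \<Rightarrow> (functional^2 \<Rightarrow> ennreal) \<Rightarrow> bool"
  where "well_posed \<Phi> D normD S normS \<longleftrightarrow>
           (\<exists>\<delta>>0. \<exists>\<epsilon>>0.
              (\<forall>F \<in> norm_ball D normD \<delta>. \<exists>U. is_solution \<Phi> S F U) \<and>
              (\<forall>F \<in> norm_ball D normD \<delta>. \<forall>U \<in> norm_ball S normS \<epsilon>. \<forall>V \<in> norm_ball S normS \<epsilon>.
                 is_solution \<Phi> S F U \<longrightarrow> is_solution \<Phi> S F V \<longrightarrow> U = V) \<and>
              (\<exists>\<Psi>. (\<forall>F \<in> norm_ball D normD \<delta>.
                       \<Psi> F \<in> norm_ball S normS \<epsilon> \<and> is_solution \<Phi> S F (\<Psi> F)) \<and>
                   norm_continuous_on (norm_ball D normD \<delta>) normD normS \<Psi>))"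

definition ill_posed ::
    "(int \<Rightarrow> real^2 \<Rightarrow> complex) \<Rightarrow> (functional^2) set \<Rightarrow> (functional^2 \<Rightarrow> ennreal) \<Rightarrow>
     (functional^2) set \<Rightarrow> (functional^2 \<Rightarrow> ennreal) \<Rightarrow> bool"
  where "ill_posed \<Phi> D normD S normS \<longleftrightarrow> \<not> well_posed \<Phi> D normD S normS"

end

theory Submission
  imports Defs "HOL-Probability.Probability"
begin

text \<open>The force is a multiple \<open>\<epsilon>\<close> of a fixed field whose Fourier transform lives on an annulus, and
  \<open>\<epsilon> v\<close> is the corresponding Stokes flow. On the Fourier side a solution \<open>U\<close> equals \<open>\<epsilon>\<close> times the
  transform of \<open>v\<close> plus \<open>- \<i> |\<xi>|\<^sup>-\<^sup>2 P(\<xi>) W(\<xi>) \<xi>\<close>, where \<open>P(\<xi>)\<close> is the Leray projection and \<open>W\<close> is the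
  transform of the integrable function \<open>U \<otimes> U\<close>. Unless \<open>W(0)\<close>, the integral of \<open>U \<otimes> U\<close>, is a multiple of
  the identity matrix, this has size \<open>1/|\<xi>|\<close> near the origin, so all low-frequency Besov blocks have
  comparable size, against summability.

  To see that \<open>W(0)\<close> is not such a multiple, let \<open>U\<close> have small Besov norm \<open>n\<close> and put \<open>R = U - \<epsilon> v\<close>. The
  norm dominates both the \<open>L\<^sup>2\<close> norm of \<open>U\<close> and the integral of the transform of \<open>U\<close> against \<open>1/|\<xi>|\<close>, while
  the transform of \<open>R\<close> is at most a constant times \<open>\<parallel>U\<parallel>\<^sup>2/|\<xi>|\<close> in terms of the \<open>L\<^sup>2\<close> norm. Multiplying the
  two bounds gives \<open>\<parallel>R\<parallel>\<^sup>2 \<le> C (n + \<epsilon>) \<parallel>U\<parallel>\<^sup>2\<close>, hence \<open>\<parallel>R\<parallel>\<close> is small compared with \<open>\<epsilon>\<close>, and \<open>W(0)\<close>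
  inherits the anisotropy of \<open>\<epsilon>\<^sup>2\<close> times the integral of \<open>v \<otimes> v\<close>. Finally the solution map would send
  \<open>0\<close> to \<open>0\<close>, so it cannot be continuous there.\<close>

section \<open>Calculus of Schwartz functions\<close>

text \<open>The obstacle is logarithmic: in the plane 1/|\<xi>| just fails to be square integrable,
  both at the origin and at infinity. A pointwise bound of that size never puts \<open>R\<close>
  into L^2 by itself; one of the two factors has to be paired with the transform of \<open>R\<close>
  and paid for by summability over dyadic blocks.

  The exponent p enters the estimates for solutions only through a Bernstein inequality in dual
  form. The regularity 2/p - 1 is the one at which its loss cancels, so everything after it happens
  in L^2; p <= 2 is what makes the passage go from L^p to L^2.

  Solutions are given, never constructed, so the error can only be measured against the norm of
  \<open>U\<close> itself. It becomes an error relative to \<epsilon> because the square of that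
  norm is at most twice those of \<epsilon> v and \<open>R\<close>, and the latter is absorbed.

  The projected inverse Laplacian is singular at the origin. Hence symbols are compared only on test
  functions vanishing near 0, and the statements about functions are recovered by duality, using
  that an element of the space is the sum of its blocks.\<close>

definition smooth_within :: "(real^2 \<Rightarrow> complex) set \<Rightarrow> (real^2 \<Rightarrow> complex) set"
  where "smooth_within G = {f. \<forall>\<alpha>. (\<forall>x. partials \<alpha> f differentiable (at x)) \<and> partials \<alpha> f \<in> G}"

definition poly_bounded :: "(real^2 \<Rightarrow> complex) set"
  where "poly_bounded = {f. \<exists>k C. \<forall>x. norm (f x) \<le> C * (1 + norm x) ^ k}"

definition rapid :: "(real^2 \<Rightarrow> complex) set"
  where "rapid = {f. \<forall>k. \<exists>C. \<forall>x. (1 + norm x) ^ k * norm (f x) \<le> C}"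

text \<open>The space usually written O_M: with all derivatives of polynomial growth, its members
  act on Schwartz functions by multiplication without decaying themselves.\<close>

abbreviation "multiplier \<equiv> smooth_within poly_bounded"

lemma schwartz_eq: "schwartz = smooth_within rapid"
  unfolding schwartz_def smooth_within_def rapid_def bounded_iff by simp

lemma partials_Nil [simp]: "partials [] f = f"
  by (simp add: partials_def)

lemma partials_Cons: "partials (i # \<alpha>) f = partial i (partials \<alpha> f)"
  by (simp add: partials_def)

lemma partials_snoc: "partials (\<alpha> @ [i]) f = partials \<alpha> (partial i f)"
  by (simp add: partials_def)

lemma partial_eq: "(f has_derivative f') (at x) \<Longrightarrow> partial i f x = f' (axis i 1)"
  unfolding partial_def by (metis frechet_derivative_at)

text \<open>Partial derivatives of products and quotients never have to be written out: it is enough to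
  exhibit a set of functions that is closed under \<open>partial\<close>.\<close>

lemma smooth_within_coinduct:
  assumes "f \<in> Q" and "\<And>f i. f \<in> Q \<Longrightarrow> partial i f \<in> Q"
    and "\<And>f x. f \<in> Q \<Longrightarrow> f differentiable (at x)" and "\<And>f. f \<in> Q \<Longrightarrow> f \<in> G"
  shows "f \<in> smooth_within G"
proof -
  have "partials \<alpha> f \<in> Q" for \<alpha>
    by (induction \<alpha>) (auto simp: partials_Cons assms)
  then show ?thesis
    unfolding smooth_within_def using assms by auto
qed

lemma smooth_withinD:
  assumes "f \<in> smooth_within G"
  shows "f \<in> G" "f differentiable (at x)" "partial i f \<in> smooth_within G"
proof -
  have *: "partials \<alpha> f differentiable (at x)" "partials \<alpha> f \<in> G" for \<alpha> x
    using assms unfolding smooth_within_def by auto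
  show "f \<in> G" "f differentiable (at x)"
    using *[of "[]"] by auto
  show "partial i f \<in> smooth_within G"
    unfolding smooth_within_def using *[of "_ @ [i]"] by (simp add: partials_snoc)
qed

lemma smooth_within_mono: "G \<subseteq> H \<Longrightarrow> smooth_within G \<subseteq> smooth_within H"
  unfolding smooth_within_def by auto

lemma has_derivative_frechet: "f differentiable (at x) \<Longrightarrow> (f has_derivative frechet_derivative f (at x)) (at x)"
  by (simp add: frechet_derivative_works)

lemma partial_add:
  assumes "f differentiable (at x)" "g differentiable (at x)"
  shows "partial i (\<lambda>x. f x + g x) x = partial i f x + partial i g x"
  using partial_eq[OF has_derivative_add[OF assms[THEN has_derivative_frechet]]]
  by (simp add: partial_def)

lemma partial_mult:
  assumes "f differentiable (at x)" "g differentiable (at x)"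
  shows "partial i (\<lambda>x. f x * g x) x = partial i f x * g x + f x * partial i g x"
  using partial_eq[OF has_derivative_mult[OF assms[THEN has_derivative_frechet]]]
  by (simp add: partial_def)

lemma partial_const: "partial i (\<lambda>x. c) = (\<lambda>x. 0)"
  by (rule ext, subst partial_eq[OF has_derivative_const], simp)

lemma smooth_within_add:
  assumes "f \<in> smooth_within G" "g \<in> smooth_within G"
    and G: "\<And>f g. f \<in> G \<Longrightarrow> g \<in> G \<Longrightarrow> (\<lambda>x. f x + g x) \<in> G"
  shows "(\<lambda>x. f x + g x) \<in> smooth_within G"
proof (rule smooth_within_coinduct)
  let ?Q = "{h. \<exists>f\<in>smooth_within G. \<exists>g\<in>smooth_within G. h = (\<lambda>x. f x + g x)}"
  show "(\<lambda>x. f x + g x) \<in> ?Q" using assms by blast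
  fix h assume "h \<in> ?Q"
  then obtain f g where fg: "f \<in> smooth_within G" "g \<in> smooth_within G" "h = (\<lambda>x. f x + g x)" by blast
  note D = smooth_withinD[OF fg(1)] smooth_withinD[OF fg(2)]
  show "h \<in> G" "h differentiable (at x)" for x
    unfolding fg(3) by (rule G D differentiable_add)+
  have "partial i h = (\<lambda>x. partial i f x + partial i g x)" for i
    unfolding fg(3) by (intro ext partial_add D)
  with D show "partial i h \<in> ?Q" for i by blast
qed

text \<open>The Leibniz rule turns one product into two, so single products are not closed under
  \<open>partial\<close>; their finite sums are, which is what the coinduction needs.\<close>

inductive_set product_sums :: "(real^2 \<Rightarrow> complex) set \<Rightarrow> (real^2 \<Rightarrow> complex) set \<Rightarrow> (real^2 \<Rightarrow> complex) set"
  for A B where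
    product: "f \<in> A \<Longrightarrow> g \<in> B \<Longrightarrow> (\<lambda>x. f x * g x) \<in> product_sums A B"
  | add: "f \<in> product_sums A B \<Longrightarrow> g \<in> product_sums A B \<Longrightarrow> (\<lambda>x. f x + g x) \<in> product_sums A B"

text \<open>Three growth classes are kept apart so that one argument covers both multiplier times
  multiplier and multiplier times Schwartz.\<close>

lemma smooth_within_mult:
  assumes "f \<in> smooth_within A" "g \<in> smooth_within B"
    and G: "\<And>f g. f \<in> G \<Longrightarrow> g \<in> G \<Longrightarrow> (\<lambda>x. f x + g x) \<in> G"
    and ABG: "\<And>f g. f \<in> A \<Longrightarrow> g \<in> B \<Longrightarrow> (\<lambda>x. f x * g x) \<in> G"
  shows "(\<lambda>x. f x * g x) \<in> smooth_within G"
proof (rule smooth_within_coinduct[where Q="product_sums (smooth_within A) (smooth_within B)"])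
  let ?Q = "product_sums (smooth_within A) (smooth_within B)"
  show "(\<lambda>x. f x * g x) \<in> ?Q"
    using assms by (intro product_sums.intros)
  show diff: "h differentiable (at x)" if "h \<in> ?Q" for h x
    using that by induction (auto intro!: derivative_intros dest: smooth_withinD(2))
  show "partial i h \<in> ?Q" if "h \<in> ?Q" for h i
    using that
  proof induction
    case (product f g)
    have "partial i (\<lambda>x. f x * g x) = (\<lambda>x. partial i f x * g x + f x * partial i g x)"
      using product by (intro ext partial_mult) (auto dest: smooth_withinD(2))
    then show ?case
      using product by (auto intro!: product_sums.intros dest: smooth_withinD(3))
  next
    case (add f g)
    have "partial i (\<lambda>x. f x + g x) = (\<lambda>x. partial i f x + partial i g x)"
      using add by (intro ext partial_add diff)
    then show ?case
      using add by (auto intro!: product_sums.intros)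
  qed
  show "h \<in> G" if "h \<in> ?Q" for h
    using that by induction (auto intro!: G ABG dest: smooth_withinD(1))
qed

section \<open>Growth classes under sums and products\<close>

lemma poly_bounded_add:
  assumes "f \<in> poly_bounded" "g \<in> poly_bounded"
  shows "(\<lambda>x. f x + g x) \<in> poly_bounded"
proof -
  from assms obtain k C l D where 1: "\<And>x. norm (f x) \<le> C * (1 + norm x) ^ k" "\<And>x. norm (g x) \<le> D * (1 + norm x) ^ l"
    unfolding poly_bounded_def by auto
  have "norm (f x + g x) \<le> (\<bar>C\<bar> + \<bar>D\<bar>) * (1 + norm x) ^ (k + l)" for x
  proof -
    have "C * (1 + norm x) ^ k \<le> \<bar>C\<bar> * (1 + norm x) ^ (k + l)"
      by (intro mult_mono power_increasing) auto
    moreover have "D * (1 + norm x) ^ l \<le> \<bar>D\<bar> * (1 + norm x) ^ (k + l)"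
      by (intro mult_mono power_increasing) auto
    ultimately show ?thesis
      using 1[of x] norm_triangle_ineq[of "f x" "g x"] by (simp add: algebra_simps)
  qed
  then show ?thesis unfolding poly_bounded_def by blast
qed

lemma rapid_add: "f \<in> rapid \<Longrightarrow> g \<in> rapid \<Longrightarrow> (\<lambda>x. f x + g x) \<in> rapid"
proof -
  assume fg: "f \<in> rapid" "g \<in> rapid"
  { fix k
    from fg obtain C D where 1: "\<And>x. (1 + norm x) ^ k * norm (f x) \<le> C" "\<And>x. (1 + norm x) ^ k * norm (g x) \<le> D"
      unfolding rapid_def by blast
    have "(1 + norm x) ^ k * norm (f x + g x) \<le> C + D" for x
      using 1[of x] mult_left_mono[OF norm_triangle_ineq[of "f x" "g x"], of "(1 + norm x)^k"]
      by (simp add: algebra_simps)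
    then have "\<exists>C. \<forall>x. (1 + norm x) ^ k * norm (f x + g x) \<le> C" by blast }
  then show ?thesis unfolding rapid_def by blast
qed

lemma rapid_mult: "f \<in> poly_bounded \<Longrightarrow> g \<in> rapid \<Longrightarrow> (\<lambda>x. f x * g x) \<in> rapid"
proof -
  assume fg: "f \<in> poly_bounded" "g \<in> rapid"
  then obtain l D where f: "\<And>x. norm (f x) \<le> D * (1 + norm x) ^ l"
    unfolding poly_bounded_def by auto
  { fix k
    from fg obtain C where 1: "\<And>x. (1 + norm x) ^ (k+l) * norm (g x) \<le> C"
      unfolding rapid_def by blast
    have "(1 + norm x) ^ k * norm (f x * g x) \<le> \<bar>D\<bar> * C" for x
    proof -
      have "D * (1 + norm x) ^ l \<le> \<bar>D\<bar> * (1 + norm x) ^ l"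
        by (intro mult_right_mono) auto
      then have "norm (f x) \<le> \<bar>D\<bar> * (1 + norm x) ^ l"
        using f[of x] by linarith
      then have "(1 + norm x) ^ k * norm (f x * g x) \<le> (1 + norm x) ^ k * (\<bar>D\<bar> * (1 + norm x) ^ l * norm (g x))"
        by (simp add: norm_mult mult_left_mono mult_right_mono)
      also have "\<dots> = \<bar>D\<bar> * ((1 + norm x) ^ (k+l) * norm (g x))"
        by (simp add: power_add)
      also have "\<dots> \<le> \<bar>D\<bar> * C"
        using 1[of x] by (intro mult_left_mono) auto
      finally show ?thesis .
    qed
    then have "\<exists>C. \<forall>x. (1 + norm x) ^ k * norm (f x * g x) \<le> C" by blast }
  then show ?thesis unfolding rapid_def by blast
qed

lemma rapid_subset_poly_bounded: "rapid \<subseteq> poly_bounded"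
proof
  fix f assume "f \<in> rapid"
  then obtain C where "\<And>x. (1 + norm x) ^ 0 * norm (f x) \<le> C" unfolding rapid_def by blast
  then have "\<forall>x. norm (f x) \<le> C * (1 + norm x) ^ 0" by simp
  then show "f \<in> poly_bounded" unfolding poly_bounded_def by blast
qed

lemma poly_bounded_mult:
  assumes "f \<in> poly_bounded" "g \<in> poly_bounded"
  shows "(\<lambda>x. f x * g x) \<in> poly_bounded"
proof -
  from assms obtain k C l D where 1: "\<And>x. norm (f x) \<le> C * (1 + norm x) ^ k" "\<And>x. norm (g x) \<le> D * (1 + norm x) ^ l"
    unfolding poly_bounded_def by auto
  have "norm (f x * g x) \<le> (C * D) * (1 + norm x) ^ (k + l)" for x
    using mult_mono[OF 1(1)[of x] 1(2)[of x] order_trans[OF norm_ge_zero 1(1)[of x]] norm_ge_zero]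
    by (simp add: norm_mult power_add algebra_simps)
  then show ?thesis unfolding poly_bounded_def by blast
qed

lemma multiplier_mult: "f \<in> multiplier \<Longrightarrow> g \<in> multiplier \<Longrightarrow> (\<lambda>x. f x * g x) \<in> multiplier"
  by (rule smooth_within_mult[OF _ _ poly_bounded_add poly_bounded_mult])

lemma schwartz_multiplier: "f \<in> schwartz \<Longrightarrow> f \<in> multiplier"
  unfolding schwartz_eq using smooth_within_mono[OF rapid_subset_poly_bounded] by auto

lemma schwartz_add: "f \<in> schwartz \<Longrightarrow> g \<in> schwartz \<Longrightarrow> (\<lambda>x. f x + g x) \<in> schwartz"
  unfolding schwartz_eq by (intro smooth_within_add rapid_add)

lemma schwartz_mult: "f \<in> multiplier \<Longrightarrow> g \<in> schwartz \<Longrightarrow> (\<lambda>x. f x * g x) \<in> schwartz"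
  unfolding schwartz_eq by (rule smooth_within_mult[OF _ _ rapid_add rapid_mult])

lemma multiplier_add: "f \<in> multiplier \<Longrightarrow> g \<in> multiplier \<Longrightarrow> (\<lambda>x. f x + g x) \<in> multiplier"
  by (intro smooth_within_add poly_bounded_add)

lemma multiplier_const: "(\<lambda>x. c) \<in> multiplier"
proof (rule smooth_within_coinduct[where Q="range (\<lambda>c x. c)"])
  fix f :: "real^2 \<Rightarrow> complex" assume "f \<in> range (\<lambda>c x. c)"
  then obtain c where "f = (\<lambda>x. c)" by blast
  then have "\<forall>x. norm (f x) \<le> norm c * (1 + norm x) ^ 0" by simp
  then show "f \<in> poly_bounded" unfolding poly_bounded_def by blast
qed (auto simp: partial_const)

definition coord :: "2 \<Rightarrow> real^2 \<Rightarrow> complex" where "coord i x = complex_of_real (x $ i)"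

lemma has_derivative_coord: "(coord i has_derivative (\<lambda>h. complex_of_real (h $ i))) (at x)"
  unfolding coord_def
  by (intro bounded_linear_imp_has_derivative bounded_linear_compose[OF bounded_linear_of_real bounded_linear_vec_nth])

lemma partial_coord: "partial k (coord i) = (\<lambda>x. if k = i then 1 else 0)"
  by (rule ext, subst partial_eq[OF has_derivative_coord]) (auto simp: axis_def)

lemma differentiable_coord: "coord i differentiable (at x)"
  using has_derivative_coord differentiable_def by blast

lemma multiplier_coord: "coord i \<in> multiplier"
proof (rule smooth_within_coinduct[where Q="insert (coord i) (range (\<lambda>c x. c))"])
  fix f :: "real^2 \<Rightarrow> complex" assume "f \<in> insert (coord i) (range (\<lambda>c x. c))"
  moreover have "(\<lambda>x. c) \<in> poly_bounded" for c using multiplier_const smooth_withinD(1) by blast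
  moreover have "\<forall>x. norm (coord i x) \<le> 1 * (1 + norm x) ^ 1"
    by (auto simp: coord_def intro: order_trans[OF component_le_norm_cart])
  then have "coord i \<in> poly_bounded" unfolding poly_bounded_def by blast
  ultimately show "f \<in> poly_bounded" by auto
qed (auto simp: partial_const partial_coord differentiable_coord)

lemma schwartz_cmult: "f \<in> schwartz \<Longrightarrow> (\<lambda>x. c * f x) \<in> schwartz"
  by (rule schwartz_mult[OF multiplier_const])

lemma schwartz_diff: "f \<in> schwartz \<Longrightarrow> g \<in> schwartz \<Longrightarrow> (\<lambda>x. f x - g x) \<in> schwartz"
  using schwartz_add[of f "\<lambda>x. (-1) * g x"] schwartz_cmult[of g "-1"] by simp

lemma schwartz_coord: "f \<in> schwartz \<Longrightarrow> (\<lambda>x. coord i x * f x) \<in> schwartz"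
  by (rule schwartz_mult[OF multiplier_coord])

lemma schwartz_zero: "(\<lambda>x. 0) \<in> schwartz"
proof -
  have "partials \<alpha> (\<lambda>x. 0) = (\<lambda>x. 0)" for \<alpha>
    by (induction \<alpha>) (simp_all add: partials_Cons partial_const)
  then show ?thesis by (simp add: schwartz_def)
qed

lemma schwartz_sum: "(\<And>j. j \<in> J \<Longrightarrow> f j \<in> schwartz) \<Longrightarrow> (\<lambda>x. \<Sum>j\<in>J. f j x) \<in> schwartz"
  by (induction J rule: infinite_finite_induct) (auto intro: schwartz_zero schwartz_add)

lemma schwartz_partial: "f \<in> schwartz \<Longrightarrow> partial i f \<in> schwartz"
  unfolding schwartz_eq by (rule smooth_withinD)

lemma schwartz_differentiable: "f \<in> schwartz \<Longrightarrow> f differentiable (at x)"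
  unfolding schwartz_eq by (rule smooth_withinD)

lemma schwartz_continuous: "f \<in> schwartz \<Longrightarrow> continuous_on A f"
  by (meson continuous_at_imp_continuous_on differentiable_imp_continuous_within schwartz_differentiable)

lemma schwartz_measurable [measurable_dest]: "f \<in> schwartz \<Longrightarrow> f \<in> borel_measurable borel"
  by (intro borel_measurable_continuous_onI schwartz_continuous)

lemma schwartz_rapid:
  assumes "f \<in> schwartz" obtains C where "0 \<le> C" "\<And>x. (1 + norm x) ^ k * norm (f x) \<le> C"
proof -
  from assms obtain C where C: "\<And>x. (1 + norm x) ^ k * norm (f x) \<le> C"
    unfolding schwartz_eq using smooth_withinD(1) rapid_def by blast
  from C[of 0] have "0 \<le> C" by (simp add: order_trans[OF norm_ge_zero])
  with C that show ?thesis by blast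
qed

section \<open>Reflection, conjugation and division by the square of the norm\<close>

lemma scaled_has_derivative:
  fixes f :: "real^2 \<Rightarrow> complex"
  assumes "f differentiable (at (c *\<^sub>R x))"
  shows "((\<lambda>x. f (c *\<^sub>R x)) has_derivative (\<lambda>h. frechet_derivative f (at (c *\<^sub>R x)) (c *\<^sub>R h))) (at x)"
proof -
  have "((\<lambda>x. c *\<^sub>R x) has_derivative (\<lambda>h. c *\<^sub>R h)) (at x)"
    by (auto intro!: derivative_eq_intros)
  from has_derivative_compose[OF this has_derivative_frechet[OF assms]] show ?thesis .
qed

lemma partial_scale:
  fixes f :: "real^2 \<Rightarrow> complex"
  assumes "f differentiable (at (c *\<^sub>R x))"
  shows "partial i (\<lambda>x. f (c *\<^sub>R x)) x = of_real c * partial i f (c *\<^sub>R x)"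
proof -
  have "linear (frechet_derivative f (at (c *\<^sub>R x)))"
    using has_derivative_frechet[OF assms] has_derivative_bounded_linear bounded_linear.linear by blast
  then show ?thesis
    using partial_eq[OF scaled_has_derivative[OF assms], of i]
    by (simp add: partial_def linear_cmul flip: scaleR_conv_of_real)
qed

lemma schwartz_reflect:
  assumes "f \<in> schwartz" shows "(\<lambda>x. f (- x)) \<in> schwartz"
proof -
  let ?Q = "{h. \<exists>f\<in>schwartz. h = (\<lambda>x. f ((-1) *\<^sub>R x))}"
  have "(\<lambda>x. f ((-1) *\<^sub>R x)) \<in> smooth_within rapid"
  proof (rule smooth_within_coinduct[where Q="?Q"])
    fix h :: "real^2 \<Rightarrow> complex" and i assume "h \<in> ?Q"
    then obtain f where f: "f \<in> schwartz" "h = (\<lambda>x. f ((-1) *\<^sub>R x))" by blast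
    \<comment> \<open>The -1 of the chain rule is moved inside, so that the derivative is again a
      reflected Schwartz function.\<close>
    have "partial i h = (\<lambda>x. (\<lambda>x. (-1) * partial i f x) ((-1) *\<^sub>R x))"
      unfolding f(2) by (rule ext, subst partial_scale) (auto intro: schwartz_differentiable f)
    moreover have "(\<lambda>x. (-1) * partial i f x) \<in> schwartz"
      by (intro schwartz_cmult schwartz_partial f)
    ultimately show "partial i h \<in> ?Q" by (intro CollectI bexI)
  next
    fix h x assume "h \<in> ?Q"
    then show "h differentiable (at x)"
      using scaled_has_derivative[OF schwartz_differentiable, of _ "-1" x] unfolding differentiable_def by blast
  next
    fix h assume "h \<in> ?Q"
    then obtain f where f: "f \<in> schwartz" "h = (\<lambda>x. f ((-1) *\<^sub>R x))" by blast
    { fix k obtain C where C: "\<And>x. (1 + norm x) ^ k * norm (f x) \<le> C" using schwartz_rapid[OF f(1)] by metis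
      have "(1 + norm x) ^ k * norm (h x) \<le> C" for x
        using C[of "-x"] by (simp add: f(2)) 
      then have "\<exists>C. \<forall>x. (1 + norm x) ^ k * norm (h x) \<le> C" by blast }
    then show "h \<in> rapid" unfolding rapid_def by blast
  qed (use assms in blast)
  then show ?thesis by (simp add: schwartz_eq)
qed

lemma schwartz_cnj:
  assumes "f \<in> schwartz" shows "(\<lambda>x. cnj (f x)) \<in> schwartz"
proof -
  let ?Q = "{h. \<exists>f\<in>schwartz. h = (\<lambda>x. cnj (f x))}"
  have D: "((\<lambda>x. cnj (f x)) has_derivative (\<lambda>h. cnj (frechet_derivative f (at x) h))) (at x)" if "f \<in> schwartz" for f x
    by (intro bounded_linear.has_derivative[OF bounded_linear_cnj] has_derivative_frechet schwartz_differentiable that)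
  have "(\<lambda>x. cnj (f x)) \<in> smooth_within rapid"
  proof (rule smooth_within_coinduct[where Q="?Q"])
    fix h i assume "h \<in> ?Q"
    then obtain f where f: "f \<in> schwartz" "h = (\<lambda>x. cnj (f x))" by blast
    have "partial i h = (\<lambda>x. cnj (partial i f x))"
      unfolding f(2) by (rule ext, subst partial_eq[OF D[OF f(1)]]) (simp add: partial_def)
    then show "partial i h \<in> ?Q" using f schwartz_partial by blast
  next
    fix h x assume "h \<in> ?Q"
    then show "h differentiable (at x)"
      using D differentiable_def by blast
  next
    fix h assume "h \<in> ?Q"
    then obtain f where f: "f \<in> schwartz" "h = (\<lambda>x. cnj (f x))" by blast
    then show "h \<in> rapid" unfolding schwartz_eq using smooth_withinD(1)[of f rapid] by (auto simp: rapid_def)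
  qed (use assms in blast)
  then show ?thesis by (simp add: schwartz_eq)
qed

text \<open>Differentiability is local. This handles quotients on the ball where the numerator
  vanishes, in particular at the origin, where the quotient rule does not apply.\<close>

lemma partial_cong_ball:
  assumes "\<And>y. norm y < r \<Longrightarrow> f y = 0" and "norm x < r"
  shows "(f has_derivative (\<lambda>h. 0)) (at x)" and "partial i f x = 0"
proof -
  have "((\<lambda>x. 0) has_derivative (\<lambda>h. 0)) (at x)" by simp
  then show *: "(f has_derivative (\<lambda>h. 0)) (at x)"
    by (rule has_derivative_transform_within_open[of _ _ _ _ "ball 0 r"]) (use assms in auto)
  show "partial i f x = 0" using partial_eq[OF *] .
qed

text \<open>The quotients \<open>f / |x|\<^sup>2\<^sup>k\<close> with \<open>f\<close> vanishing near the origin are closed under \<open>partial\<close>.\<close>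

lemma schwartz_div_norm_sq:
  assumes f: "f \<in> schwartz" and r: "0 < r" and f0: "\<And>x. norm x < r \<Longrightarrow> f x = 0"
  shows "(\<lambda>x. f x / of_real ((norm x)\<^sup>2)) \<in> schwartz"
proof -
  define s where "s = (\<lambda>x::real^2. coord 1 x * coord 1 x + coord 2 x * coord 2 x)"
  have s: "s x = of_real ((norm x)\<^sup>2)" for x
    by (simp add: s_def coord_def power2_norm_eq_inner inner_vec_def sum_2)
  have sm: "s \<in> multiplier"
    unfolding s_def by (intro multiplier_add multiplier_mult multiplier_coord)
  define Q where "Q = {h. \<exists>f k. f \<in> schwartz \<and> (\<forall>x. norm x < r \<longrightarrow> f x = 0) \<and> h = (\<lambda>x. f x / s x ^ k)}"
  have D: "((\<lambda>x. f x / s x ^ k) has_derivative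
             (\<lambda>h. (frechet_derivative f (at x) h * s x ^ k - f x * (of_nat k * frechet_derivative s (at x) h * s x ^ (k - 1))) / (s x ^ k * s x ^ k))) (at x)"
    if "f \<in> schwartz" "x \<noteq> 0" for f k x
    by (intro has_derivative_divide' has_derivative_power has_derivative_frechet schwartz_differentiable
          smooth_withinD(2)[OF sm]) (use that s in auto)
  have "(\<lambda>x. f x / s x ^ 1) \<in> smooth_within rapid"
  proof (rule smooth_within_coinduct[where Q=Q])
    show "(\<lambda>x. f x / s x ^ 1) \<in> Q" unfolding Q_def using f f0 by blast
    fix h assume "h \<in> Q"
    then obtain f k where h: "f \<in> schwartz" "\<And>x. norm x < r \<Longrightarrow> f x = 0" "h = (\<lambda>x. f x / s x ^ k)"
      unfolding Q_def by blast
    have h0: "h x = 0" if "norm x < r" for x using h that by simp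
    show "h differentiable (at x)" for x
    proof (cases "norm x < r")
      case True then show ?thesis using partial_cong_ball(1)[of r h x] h0 differentiable_def by blast
    next
      case False then have "x \<noteq> 0" using r by auto
      with D[OF h(1) this, of k] show ?thesis unfolding h(3) differentiable_def by blast
    qed
    show "partial i h \<in> Q" for i
    proof -
      \<comment> \<open>Numerator of the derivative of \<open>f / s ^ k\<close> over the common
        denominator \<open>s ^ (k+1)\<close>; it vanishes on the same ball as \<open>f\<close>,
        which keeps the derivative in \<open>Q\<close>.\<close>
      define g where "g = (\<lambda>x. s x * partial i f x - partial i s x * of_nat k * f x)"
      have "g \<in> schwartz"
        unfolding g_def by (intro schwartz_diff schwartz_mult multiplier_mult multiplier_const schwartz_partial h sm smooth_withinD(3))
      moreover have g0: "g x = 0" if "norm x < r" for x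
        using h(2) partial_cong_ball(2)[of r f x] that by (auto simp: g_def)
      moreover have "partial i h x = g x / s x ^ (k+1)" for x
      proof (cases "norm x < r")
        case True then show ?thesis using partial_cong_ball(2)[of r h x] h0 g0 by auto
      next
        case False then have x: "x \<noteq> 0" using r by auto
        then have sx: "s x \<noteq> 0" by (simp add: s)
        have "partial i h x = (partial i f x * s x ^ k - f x * (of_nat k * partial i s x * s x ^ (k - 1))) / (s x ^ k * s x ^ k)"
          unfolding h(3) partial_eq[OF D[OF h(1) x]] by (simp add: partial_def)
        also have "\<dots> = g x / s x ^ (k+1)"
          using sx by (cases k) (auto simp: g_def field_simps)
        finally show ?thesis .
      qed
      ultimately show ?thesis unfolding Q_def by blast
    qed
    show "h \<in> rapid"
      unfolding rapid_def
    proof (intro CollectI allI)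
      fix n
      obtain C where C: "0 \<le> C" "\<And>x. (1 + norm x) ^ n * norm (f x) \<le> C" using schwartz_rapid[OF h(1)] by metis
      have "(1 + norm x) ^ n * norm (h x) \<le> C / (r\<^sup>2) ^ k" for x
      proof (cases "norm x < r")
        case True then show ?thesis using h0[of x] C by simp
      next
        case False
        then have "(r\<^sup>2) ^ k \<le> ((norm x)\<^sup>2) ^ k" using r by (intro power_mono) auto
        then have "C / ((norm x)\<^sup>2) ^ k \<le> C / (r\<^sup>2) ^ k" using C r False
            by (intro divide_left_mono mult_pos_pos zero_less_power) auto
        moreover have "(1 + norm x) ^ n * norm (h x) = ((1 + norm x) ^ n * norm (f x)) / ((norm x)\<^sup>2) ^ k"
          by (simp add: h(3) s norm_divide norm_power)
        moreover have "\<dots> \<le> C / ((norm x)\<^sup>2) ^ k" using C(2)[of x] by (intro divide_right_mono) auto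
        ultimately show ?thesis by linarith
      qed
      then show "\<exists>C. \<forall>x. (1 + norm x) ^ n * norm (h x) \<le> C" by blast
    qed
  qed
  then show ?thesis by (simp add: schwartz_eq s)
qed

section \<open>The Fourier transform of decaying functions\<close>

lemma product_sigma_finite_lborel: "product_sigma_finite (\<lambda>_. lborel :: real measure)"
  by standard (rule lborel.sigma_finite_countable)

lemma
  fixes f :: "'a::euclidean_space \<Rightarrow> real \<Rightarrow> 'b::{real_normed_field,banach,second_countable_topology}"
  assumes f: "\<And>b. b \<in> Basis \<Longrightarrow> integrable lborel (f b)"
  shows integrable_lborel_prod: "integrable lborel (\<lambda>x. \<Prod>b\<in>Basis. f b (x \<bullet> b))"
    and integral_lborel_prod: "(LINT x|lborel. (\<Prod>b\<in>Basis. f b (x \<bullet> b))) = (\<Prod>b\<in>Basis. (LINT x|lborel. f b x))"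
proof -
  interpret product_sigma_finite "\<lambda>_::'a. lborel :: real measure" by (rule product_sigma_finite_lborel)
  have [measurable]: "f b \<in> borel_measurable borel" if "b \<in> Basis" for b
    using f[OF that] by (simp add: integrable_iff_bounded)
  have eq: "(\<Prod>b\<in>Basis. f b ((\<Sum>b\<in>Basis. x b *\<^sub>R b) \<bullet> b)) = (\<Prod>b\<in>Basis. f b (x b))" for x
    by (intro prod.cong refl) (simp add: inner_sum_left inner_Basis if_distrib cong: if_cong)
  show "integrable lborel (\<lambda>x. \<Prod>b\<in>Basis. f b (x \<bullet> b))"
    by (subst lborel_eq, subst integrable_distr_eq) (auto simp: eq intro!: product_integrable_prod f)
  show "(LINT x|lborel. (\<Prod>b\<in>Basis. f b (x \<bullet> b))) = (\<Prod>b\<in>Basis. (LINT x|lborel. f b x))"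
    by (subst lborel_eq, subst integral_distr) (auto simp: eq intro!: product_integral_prod f)
qed

lemma prod_Basis_2: "(\<Prod>b\<in>(Basis::(real^2) set). g b) = g (axis 1 1) * g (axis 2 1)"
proof -
  have *: "(Basis::(real^2) set) = {axis 1 1, axis 2 1}"
    unfolding Basis_vec_def by (auto simp: UNIV_2)
  have "axis 1 (1::real) \<noteq> (axis 2 1 :: real^2)" by (simp add: axis_eq_axis)
  then show ?thesis unfolding * by simp
qed

lemma
  fixes f g :: "real \<Rightarrow> 'b::{real_normed_field,banach,second_countable_topology}"
  assumes f: "integrable lborel f" and g: "integrable lborel g"
  shows integrable_plane_prod: "integrable lborel (\<lambda>x::real^2. f (x $ 1) * g (x $ 2))"
    and integral_plane_prod: "(LINT x|lborel. f ((x::real^2) $ 1) * g (x $ 2)) = (LINT x|lborel. f x) * (LINT x|lborel. g x)"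
proof -
  define F where "F b = (if b = axis 1 1 then f else g)" for b :: "real^2"
  have ne: "axis 2 1 \<noteq> (axis 1 1 :: real^2)" by (simp add: axis_eq_axis)
  have F: "integrable lborel (F b)" for b by (simp add: F_def f g)
  show "integrable lborel (\<lambda>x::real^2. f (x $ 1) * g (x $ 2))"
    using integrable_lborel_prod[of F] F ne by (simp add: prod_Basis_2 F_def inner_axis)
  show "(LINT x|lborel. f ((x::real^2) $ 1) * g (x $ 2)) = (LINT x|lborel. f x) * (LINT x|lborel. g x)"
    using integral_lborel_prod[of F] F ne by (simp add: prod_Basis_2 F_def inner_axis)
qed

lemma norm_sq_2: "(norm (x::real^2))\<^sup>2 = (x $ 1)\<^sup>2 + (x $ 2)\<^sup>2"
  by (simp add: power2_norm_eq_inner inner_vec_def sum_2) (simp add: power2_eq_square)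

text \<open>The fourth power of 1 + |x| dominates (1 + x_1^2)(1 + x_2^2), so the weight lies below a
  product of two integrable functions of one variable.\<close>

lemma integrable_weight: "integrable lborel (\<lambda>x::real^2. inverse ((1 + norm x) ^ 4))"
proof -
  have 1: "integrable lborel (\<lambda>x::real. inverse (1 + x\<^sup>2))"
    using integrable_inverse_1_plus_square by (simp add: set_integrable_def)
  show ?thesis
  proof (rule Bochner_Integration.integrable_bound[OF integrable_plane_prod[OF 1 1]])
    show "AE x::real^2 in lborel. norm (inverse ((1 + norm x) ^ 4)) \<le> norm (inverse (1 + (x $ 1)\<^sup>2) * inverse (1 + (x $ 2)\<^sup>2))"
    proof (rule AE_I2)
      fix x :: "real^2"
      have *: "1 + (x $ i)\<^sup>2 \<le> (1 + norm x)\<^sup>2" for i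
      proof -
        have "(x $ i)\<^sup>2 \<le> (norm x)\<^sup>2" using component_le_norm_cart[of x i] by (simp add: abs_le_square_iff[symmetric])
        then show ?thesis unfolding power2_sum by (simp add: add_increasing2)
      qed
      have "(1 + (x $ 1)\<^sup>2) * (1 + (x $ 2)\<^sup>2) \<le> (1 + norm x)\<^sup>2 * (1 + norm x)\<^sup>2"
        by (intro mult_mono * ) auto
      also have "\<dots> = (1 + norm x) ^ 4" by (simp flip: power_add)
      finally have "inverse ((1 + norm x) ^ 4) \<le> inverse ((1 + (x $ 1)\<^sup>2) * (1 + (x $ 2)\<^sup>2))"
        by (intro le_imp_inverse_le) (auto intro!: mult_pos_pos add_pos_nonneg)
      then show "norm (inverse ((1 + norm x) ^ 4)) \<le> norm (inverse (1 + (x $ 1)\<^sup>2) * inverse (1 + (x $ 2)\<^sup>2))"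
        by (simp add: abs_mult flip: inverse_mult_distrib)
    qed
  qed measurable
qed

text \<open>Decay without smoothness. Closure under multiplication by coordinates lets the Fourier
  integral be differentiated any number of times; besides Schwartz functions the class admits a
  bounded measurable function times a Gaussian.\<close>

definition decaying :: "(real^2 \<Rightarrow> complex) set"
  where "decaying = {f \<in> borel_measurable borel. \<forall>k. integrable lborel (\<lambda>x. (1 + norm x) ^ k * norm (f x))}"

lemma decayingD [measurable_dest]: "f \<in> decaying \<Longrightarrow> f \<in> borel_measurable borel"
  by (simp add: decaying_def)

lemma decaying_integrable: "f \<in> decaying \<Longrightarrow> integrable lborel (\<lambda>x. (1 + norm x) ^ k * norm (f x))"
  by (simp add: decaying_def)

lemma decaying_integrable0: "f \<in> decaying \<Longrightarrow> integrable lborel f"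
  using decaying_integrable[of f 0] decayingD[of f] by (simp add: integrable_norm_iff)

lemma decaying_mult:
  assumes f: "f \<in> decaying" and [measurable]: "g \<in> borel_measurable borel"
    and g: "\<And>x. norm (g x) \<le> C * (1 + norm x) ^ l"
  shows "(\<lambda>x. g x * f x) \<in> decaying"
  unfolding decaying_def
proof (intro CollectI conjI allI)
  note [measurable] = decayingD[OF f]
  show "(\<lambda>x. g x * f x) \<in> borel_measurable borel" by measurable
  fix k
  show "integrable lborel (\<lambda>x. (1 + norm x) ^ k * norm (g x * f x))"
  proof (rule Bochner_Integration.integrable_bound[OF integrable_mult_right[OF decaying_integrable[OF f, of "k + l"], of C]])
    show "AE x in lborel. norm ((1 + norm x) ^ k * norm (g x * f x)) \<le> norm (C * ((1 + norm x) ^ (k + l) * norm (f x)))"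
    proof (rule AE_I2)
      fix x :: "real^2"
      have "(1 + norm x) ^ k * (norm (g x) * norm (f x)) \<le> (1 + norm x) ^ k * ((C * (1 + norm x) ^ l) * norm (f x))"
        by (intro mult_left_mono mult_right_mono g) auto
      then show "norm ((1 + norm x) ^ k * norm (g x * f x)) \<le> norm (C * ((1 + norm x) ^ (k + l) * norm (f x)))"
        by (simp add: norm_mult power_add algebra_simps)
    qed
  qed measurable
qed

lemma coord_measurable [measurable]: "coord i \<in> borel_measurable borel"
  unfolding coord_def by measurable

lemma norm_coord_le: "norm (coord i x) \<le> norm x"
  by (simp add: coord_def component_le_norm_cart)

lemma decaying_coord: "f \<in> decaying \<Longrightarrow> (\<lambda>x. coord i x * f x) \<in> decaying"
  by (rule decaying_mult[of _ _ 1 1]) (auto intro: order_trans[OF norm_coord_le])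

lemma decaying_cmult: "f \<in> decaying \<Longrightarrow> (\<lambda>x. c * f x) \<in> decaying"
  by (rule decaying_mult[of _ _ "norm c" 0]) auto

lemma schwartz_decaying: "f \<in> schwartz \<Longrightarrow> f \<in> decaying"
  unfolding decaying_def
proof (intro CollectI conjI allI)
  assume f: "f \<in> schwartz"
  then show [measurable]: "f \<in> borel_measurable borel" by measurable
  fix k
  obtain C where C: "0 \<le> C" "\<And>x. (1 + norm x) ^ (k+4) * norm (f x) \<le> C" using schwartz_rapid[OF f] by metis
  show "integrable lborel (\<lambda>x. (1 + norm x) ^ k * norm (f x))"
  proof (rule Bochner_Integration.integrable_bound[OF integrable_mult_right[OF integrable_weight, of C]])
    have "norm ((1 + norm x) ^ k * norm (f x)) \<le> norm (C * inverse ((1 + norm x) ^ 4))" for x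
    proof -
      have "(1 + norm x) ^ k * norm (f x) = ((1 + norm x) ^ (k+4) * norm (f x)) * inverse ((1 + norm x) ^ 4)"
        by (simp add: power_add add_nonneg_eq_0_iff)
      also have "\<dots> \<le> C * inverse ((1 + norm x) ^ 4)" by (intro mult_right_mono C) auto
      finally show ?thesis by (simp add: C)
    qed
    then show "AE x in lborel. norm ((1 + norm x) ^ k * norm (f x)) \<le> norm (C * inverse ((1 + norm x) ^ 4))" by simp
  qed measurable
qed

lemma schwartz_integrable: "f \<in> schwartz \<Longrightarrow> integrable lborel f"
  by (intro decaying_integrable0 schwartz_decaying)

section \<open>Differentiating the Fourier integral\<close>

lemma cis_measurable [measurable]: "cis \<in> borel_measurable borel"
  by (intro borel_measurable_continuous_onI) (auto simp: cis_conv_exp intro!: continuous_intros)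

lemma integrable_cis:
  fixes f :: "'a \<Rightarrow> complex"
  assumes "integrable M f" "g \<in> borel_measurable M"
  shows "integrable M (\<lambda>x. cis (g x) * f x)"
proof (rule Bochner_Integration.integrable_bound[OF assms(1)])
  have [measurable]: "(\<lambda>x. cis (g x)) \<in> borel_measurable M"
    using cis_measurable assms(2) by (rule measurable_compose_rev)
  note [measurable] = borel_measurable_integrable[OF assms(1)]
  show "(\<lambda>x. cis (g x) * f x) \<in> borel_measurable M" by measurable
qed (simp add: norm_mult)

lemma norm_fourier_le: "norm (fourier f \<xi>) \<le> (LINT x|lborel. norm (f x))"
  unfolding fourier_def
  by (rule order_trans[OF integral_norm_bound]) (simp add: norm_mult)

lemma integrable_fourier: "integrable lborel f \<Longrightarrow> integrable lborel (\<lambda>x. cis (- (x \<bullet> \<xi>)) * f x)"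
  by (rule integrable_cis) auto

lemma cis_linear_approx: "norm (cis t - 1 - \<i> * of_real t) \<le> t\<^sup>2"
proof -
  have "norm (cis t - 1 - \<i> * of_real t) \<le> t\<^sup>2 / 2"
    using iexp_approx1[of t 1] by (simp add: cis_conv_exp power2_eq_square algebra_simps)
  then show ?thesis using zero_le_power2[of t] by linarith
qed

text \<open>The exponential is expanded to first order under the integral: the remainder is at most
  the square of the inner product of x and h, and the second moment \<open>?M\<close> makes the
  total error quadratic in \<open>h\<close>.\<close>

lemma fourier_has_derivative:
  assumes f: "f \<in> decaying"
  shows "(fourier f has_derivative (\<lambda>h. \<Sum>i\<in>UNIV. of_real (h $ i) * fourier (\<lambda>x. - \<i> * (coord i x * f x)) \<xi>)) (at \<xi>)"
proof -
  note [measurable] = decayingD[OF f]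
  let ?L = "\<lambda>h::real^2. \<Sum>i\<in>UNIV. of_real (h $ i) * fourier (\<lambda>x. - \<i> * (coord i x * f x)) \<xi>"
  let ?M = "LINT x|lborel. (1 + norm x) ^ 2 * norm (f x)"
  have L: "?L h = (LINT x|lborel. cis (- (x \<bullet> \<xi>)) * (\<i> * of_real (- (x \<bullet> h)) * f x))" for h
  proof -
    have i: "integrable lborel (\<lambda>x. cis (- (x \<bullet> \<xi>)) * (- \<i> * (coord i x * f x)))" for i
      by (intro integrable_fourier decaying_integrable0 decaying_cmult decaying_coord f)
    have "?L h = (\<Sum>i\<in>UNIV. (LINT x|lborel. of_real (h $ i) * (cis (- (x \<bullet> \<xi>)) * (- \<i> * (coord i x * f x)))))"
      by (simp add: fourier_def)
    also have "\<dots> = (LINT x|lborel. (\<Sum>i\<in>UNIV. of_real (h $ i) * (cis (- (x \<bullet> \<xi>)) * (- \<i> * (coord i x * f x)))))"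
      by (rule Bochner_Integration.integral_sum[symmetric]) (intro integrable_mult_right i)
    also have "\<dots> = (LINT x|lborel. cis (- (x \<bullet> \<xi>)) * (\<i> * of_real (- (x \<bullet> h)) * f x))"
      by (intro Bochner_Integration.integral_cong refl) (simp add: sum_2 inner_vec_def coord_def algebra_simps)
    finally show ?thesis .
  qed
  have bl: "bounded_linear ?L"
    by (intro bounded_linear_sum bounded_linear_mult_const
        bounded_linear_compose[OF bounded_linear_of_real bounded_linear_vec_nth])
  have est: "norm (fourier f (\<xi> + h) - fourier f \<xi> - ?L h) \<le> (norm h)\<^sup>2 * ?M" for h
  proof -
    have ineq: "\<bar>x \<bullet> h\<bar> \<le> norm h * (1 + norm x)" for x
      using Cauchy_Schwarz_ineq2[of x h] norm_ge_zero[of h] unfolding distrib_left mult.commute[of "norm h" "norm x"]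
      by linarith
    have i3: "integrable lborel (\<lambda>x. cis (- (x \<bullet> \<xi>)) * (\<i> * of_real (- (x \<bullet> h)) * f x))"
    proof (intro integrable_fourier decaying_integrable0 decaying_mult[OF f, of _ "norm h" 1])
      show "norm (\<i> * of_real (- (x \<bullet> h))) \<le> norm h * (1 + norm x) ^ 1" for x
        using ineq[of x] by (simp add: norm_mult)
    qed measurable
    have ii: "integrable lborel (\<lambda>x. cis (- (x \<bullet> (\<xi> + h))) * f x - cis (- (x \<bullet> \<xi>)) * f x)"
      by (intro Bochner_Integration.integrable_diff integrable_fourier decaying_integrable0 f)
    have "fourier f (\<xi> + h) - fourier f \<xi> - ?L h =
        (LINT x|lborel. cis (- (x \<bullet> (\<xi> + h))) * f x - cis (- (x \<bullet> \<xi>)) * f x - cis (- (x \<bullet> \<xi>)) * (\<i> * of_real (- (x \<bullet> h)) * f x))"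
      unfolding L unfolding fourier_def
      by (simp only: Bochner_Integration.integral_diff[OF ii i3]
          Bochner_Integration.integral_diff[OF integrable_fourier integrable_fourier] decaying_integrable0 f)
    also have "norm \<dots> \<le> (LINT x|lborel. norm h ^ 2 * ((1 + norm x) ^ 2 * norm (f x)))"
    proof (rule Bochner_Integration.integral_norm_bound_integral)
      fix x :: "real^2"
      have ce: "cis (- (x \<bullet> (\<xi> + h))) = cis (- (x \<bullet> \<xi>)) * cis (- (x \<bullet> h))"
        by (simp add: cis_mult inner_add_right)
      have "cis (- (x \<bullet> (\<xi> + h))) * f x - cis (- (x \<bullet> \<xi>)) * f x - cis (- (x \<bullet> \<xi>)) * (\<i> * of_real (- (x \<bullet> h)) * f x)
          = cis (- (x \<bullet> \<xi>)) * (cis (- (x \<bullet> h)) - 1 - \<i> * of_real (- (x \<bullet> h))) * f x"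
        unfolding ce by (simp add: algebra_simps)
      also have "norm \<dots> \<le> (- (x \<bullet> h))\<^sup>2 * norm (f x)"
        unfolding norm_mult norm_cis mult_1 by (intro mult_right_mono cis_linear_approx norm_ge_zero)
      also have "\<dots> \<le> (norm h ^ 2 * (1 + norm x) ^ 2) * norm (f x)"
      proof (intro mult_right_mono)
        have "\<bar>x \<bullet> h\<bar>\<^sup>2 \<le> (norm h * (1 + norm x))\<^sup>2" by (intro power_mono ineq) auto
        then show "(- (x \<bullet> h))\<^sup>2 \<le> norm h ^ 2 * (1 + norm x) ^ 2" by (simp add: power_mult_distrib)
      qed auto
      finally show "norm (cis (- (x \<bullet> (\<xi> + h))) * f x - cis (- (x \<bullet> \<xi>)) * f x - cis (- (x \<bullet> \<xi>)) * (\<i> * of_real (- (x \<bullet> h)) * f x))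
        \<le> norm h ^ 2 * ((1 + norm x) ^ 2 * norm (f x))" by (simp add: mult.assoc)
    qed (use ii i3 in \<open>auto intro!: decaying_integrable f\<close>)
    also have "\<dots> = (norm h)\<^sup>2 * ?M" by simp
    finally show ?thesis .
  qed
  show ?thesis
    unfolding has_derivative_at
  proof (intro conjI bl)
    have "((\<lambda>h::real^2. norm h * ?M) \<longlongrightarrow> norm (0::real^2) * ?M) (at 0)"
      by (intro tendsto_mult tendsto_norm tendsto_const tendsto_ident_at)
    then have lim: "((\<lambda>h::real^2. norm h * ?M) \<longlongrightarrow> 0) (at 0)" by simp
    show "(\<lambda>h. norm (fourier f (\<xi> + h) - fourier f \<xi> - ?L h) / norm h) \<midarrow>0\<rightarrow> 0"
    proof (rule Lim_null_comparison[OF _ lim], rule eventually_at_filter[THEN iffD2, OF always_eventually], intro allI impI)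
      fix h :: "real^2" assume "h \<noteq> 0"
      then show "norm (norm (fourier f (\<xi> + h) - fourier f \<xi> - ?L h) / norm h) \<le> norm h * ?M"
        using est[of h] by (simp add: divide_simps power2_eq_square algebra_simps)
    qed
  qed
qed

lemma partial_fourier:
  assumes "f \<in> decaying"
  shows "partial i (fourier f) = fourier (\<lambda>x. - \<i> * (coord i x * f x))"
  by (rule ext, subst partial_eq[OF fourier_has_derivative[OF assms]])
     (simp add: axis_def if_distrib if_distribR cong: if_cong)

lemma fourier_multiplier:
  assumes "f \<in> decaying" shows "fourier f \<in> multiplier"
proof (rule smooth_within_coinduct[where Q="fourier ` decaying"])
  show "partial i h \<in> fourier ` decaying" if "h \<in> fourier ` decaying" for h i
  proof -
    from that obtain f where f: "f \<in> decaying" "h = fourier f" by blast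
    show ?thesis
      unfolding f(2) partial_fourier[OF f(1)] by (intro imageI decaying_cmult decaying_coord f)
  qed
  show "h differentiable (at x)" if "h \<in> fourier ` decaying" for h x
    using that fourier_has_derivative differentiable_def by blast
  show "h \<in> poly_bounded" if "h \<in> fourier ` decaying" for h
  proof -
    from that obtain f where "h = fourier f" by blast
    then have "\<forall>x. norm (h x) \<le> (LINT x|lborel. norm (f x)) * (1 + norm x) ^ 0"
      using norm_fourier_le by simp
    then show ?thesis unfolding poly_bounded_def by blast
  qed
qed (use assms in blast)

section \<open>Affine substitution and the transform of a derivative\<close>

lemma
  fixes g :: "real^2 \<Rightarrow> 'b::{banach,second_countable_topology}"
  assumes "c \<noteq> 0"
  shows integrable_plane_affine: "integrable lborel g \<Longrightarrow> integrable lborel (\<lambda>x. g (a + c *\<^sub>R x))"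
    and integral_plane_affine: "(LINT x|lborel. g x) = c\<^sup>2 *\<^sub>R (LINT x|lborel. g (a + c *\<^sub>R x))"
proof -
  have I: "integrable lborel (\<lambda>x. h (a + c *\<^sub>R x))" if h: "integrable lborel h" and c: "c \<noteq> 0"
    for h :: "real^2 \<Rightarrow> 'b" and a c
  proof -
    note [measurable] = borel_measurable_integrable[OF h]
    have "integrable (density (distr lborel borel (\<lambda>x. a + c *\<^sub>R x)) (\<lambda>_. \<bar>c\<bar> ^ DIM(real^2))) h"
      using h lborel_affine[OF c, of a] by simp
    then have "integrable lborel (\<lambda>x. c\<^sup>2 *\<^sub>R h (a + c *\<^sub>R x))"
      by (subst (asm) integrable_density) (auto simp: integrable_distr_eq)
    then have "integrable lborel (\<lambda>x. (1 / c\<^sup>2) *\<^sub>R (c\<^sup>2 *\<^sub>R h (a + c *\<^sub>R x)))"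
      by (rule integrable_scaleR_right)
    with c show ?thesis by simp
  qed
  then show "integrable lborel g \<Longrightarrow> integrable lborel (\<lambda>x. g (a + c *\<^sub>R x))" using assms by blast
  show "(LINT x|lborel. g x) = c\<^sup>2 *\<^sub>R (LINT x|lborel. g (a + c *\<^sub>R x))"
  proof (cases "integrable lborel g")
    case True
    note [measurable] = borel_measurable_integrable[OF True]
    have "(LINT x|lborel. g x) = integral\<^sup>L (density (distr lborel borel (\<lambda>x. a + c *\<^sub>R x)) (\<lambda>_. \<bar>c\<bar> ^ DIM(real^2))) g"
      using lborel_affine[OF assms, of a] by simp
    also have "\<dots> = c\<^sup>2 *\<^sub>R (LINT x|lborel. g (a + c *\<^sub>R x))"
      by (subst integral_density) (auto simp: integral_distr)
    finally show ?thesis .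
  next
    \<comment> \<open>Both integrals then have the default value 0: integrability after the
      substitution would carry back through the inverse affine map.\<close>
    case False
    have "\<not> integrable lborel (\<lambda>x. g (a + c *\<^sub>R x))"
    proof
      assume "integrable lborel (\<lambda>x. g (a + c *\<^sub>R x))"
      from I[OF this, of "1/c" "- (1/c) *\<^sub>R a"] show False using False assms by (simp add: scaleR_diff_right)
    qed
    with False show ?thesis by (simp add: not_integrable_integral_eq)
  qed
qed

lemma integral_plane_reflect:
  fixes g :: "real^2 \<Rightarrow> 'b::{banach,second_countable_topology}"
  shows "(LINT x|lborel. g (- x)) = (LINT x|lborel. g x)"
  using integral_plane_affine[of "-1" g 0] by simp

lemma directional_quotient_limit:
  fixes g :: "real \<Rightarrow> complex"
  assumes "(g has_vector_derivative D) (at 0)"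
  shows "(\<lambda>n. (g (1 / real (Suc n)) - g 0) / of_real (1 / real (Suc n))) \<longlonglongrightarrow> D"
proof -
  have "((\<lambda>h. (g h - g 0) /\<^sub>R h) \<longlongrightarrow> D) (at 0)"
  proof -
    have "(\<lambda>h. norm (g (0 + h) - g 0 - h *\<^sub>R D) / norm h) \<midarrow>0\<rightarrow> 0"
      using assms unfolding has_vector_derivative_def has_derivative_at by blast
    moreover have "norm (g (0 + h) - g 0 - h *\<^sub>R D) / norm h = norm ((g h - g 0) /\<^sub>R h - D)" if "h \<noteq> 0" for h
    proof -
      have "(g h - g 0) /\<^sub>R h - D = (g (0 + h) - g 0 - h *\<^sub>R D) /\<^sub>R h"
        using that by (simp add: algebra_simps)
      then show ?thesis by (simp add: divide_inverse mult.commute)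
    qed
    ultimately have "(\<lambda>h. norm ((g h - g 0) /\<^sub>R h - D)) \<midarrow>0\<rightarrow> 0"
      by (elim Lim_transform_eventually) (auto simp: eventually_at_filter)
    then show ?thesis by (simp add: tendsto_norm_zero_iff Lim_null[of _ D])
  qed
  moreover have "filterlim (\<lambda>n. 1 / real (Suc n)) (at 0) sequentially"
    unfolding filterlim_at using LIMSEQ_inverse_real_of_nat by (auto simp: inverse_eq_divide)
  ultimately have "(\<lambda>n. (g (1 / real (Suc n)) - g 0) /\<^sub>R (1 / real (Suc n))) \<longlonglongrightarrow> D"
    by (rule filterlim_compose)
  then show ?thesis by (simp add: scaleR_conv_of_real divide_inverse mult.commute)
qed

lemma partial_has_vector_derivative:
  assumes "f differentiable (at (x + s *\<^sub>R axis i 1))"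
  shows "((\<lambda>s. f (x + s *\<^sub>R axis i 1)) has_vector_derivative partial i f (x + s *\<^sub>R axis i 1)) (at s)"
proof -
  let ?D = "frechet_derivative f (at (x + s *\<^sub>R axis i 1))"
  have "((\<lambda>s. x + s *\<^sub>R axis i 1) has_derivative (\<lambda>h. h *\<^sub>R axis i 1)) (at s)"
    by (auto intro!: derivative_eq_intros)
  from has_derivative_compose[OF this has_derivative_frechet[OF assms]]
  have "((\<lambda>s. f (x + s *\<^sub>R axis i 1)) has_derivative (\<lambda>h. ?D (h *\<^sub>R axis i 1))) (at s)" .
  moreover have "linear ?D"
    using has_derivative_frechet[OF assms] has_derivative_bounded_linear bounded_linear.linear by blast
  ultimately show ?thesis
    unfolding has_vector_derivative_def partial_def by (simp add: linear_cmul)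
qed

text \<open>Difference quotients take the place of integration by parts. Their transforms converge
  to that of the derivative by dominated convergence, while translation invariance evaluates each as
  a scalar quotient of \<open>cis\<close> times the transform of \<open>f\<close>.\<close>

lemma fourier_partial:
  assumes f: "f \<in> schwartz"
  shows "fourier (partial i f) \<xi> = \<i> * coord i \<xi> * fourier f \<xi>"
proof -
  note [measurable] = schwartz_measurable[OF f]
  define e :: "real^2" where "e = axis i 1"
  have D: "((\<lambda>s. f (x + s *\<^sub>R e)) has_vector_derivative partial i f (x + s *\<^sub>R e)) (at s)" for x s
    unfolding e_def by (intro partial_has_vector_derivative schwartz_differentiable f)
  define t where "t n = 1 / real (Suc n)" for n
  have t: "t n > 0" "t n \<le> 1" for n by (auto simp: t_def)
  obtain C where C: "0 \<le> C" "\<And>x. (1 + norm x) ^ 4 * norm (partial i f x) \<le> C"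
    using schwartz_rapid[OF schwartz_partial[OF f]] by metis
  define q where "q n x = cis (- (x \<bullet> \<xi>)) * ((f (x + t n *\<^sub>R e) - f x) / of_real (t n))" for n x
  \<comment> \<open>Mean value bound: a shift by at most 1 changes 1 + |x| by at most the factor 2,
    and 16 is its fourth power.\<close>
  have dom: "norm (f (x + t n *\<^sub>R e) - f x) \<le> 16 * C * inverse ((1 + norm x) ^ 4) * t n" for n x
  proof -
    have "norm (f (x + t n *\<^sub>R e) - f (x + 0 *\<^sub>R e)) \<le> (16 * C * inverse ((1 + norm x) ^ 4)) * norm (t n - 0)"
    proof (rule differentiable_bound[of "{0..t n}" "\<lambda>s. f (x + s *\<^sub>R e)" "\<lambda>s h. h *\<^sub>R partial i f (x + s *\<^sub>R e)"])
      fix s assume s: "s \<in> {0..t n}"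
      show "((\<lambda>s. f (x + s *\<^sub>R e)) has_derivative (\<lambda>h. h *\<^sub>R partial i f (x + s *\<^sub>R e))) (at s within {0..t n})"
        using D[of x s]
        unfolding has_vector_derivative_def by (rule has_derivative_at_withinI)
      show "onorm (\<lambda>h. h *\<^sub>R partial i f (x + s *\<^sub>R e)) \<le> 16 * C * inverse ((1 + norm x) ^ 4)"
      proof (rule onorm_le)
        fix h :: real
        have "norm x \<le> norm (x + s *\<^sub>R e) + norm (s *\<^sub>R e)" using norm_triangle_sub[of x "- (s *\<^sub>R e)"] by (simp add: norm_minus_commute)
        then have "1 + norm x \<le> 2 * (1 + norm (x + s *\<^sub>R e))" using s t[of n] norm_ge_zero[of "x + s *\<^sub>R e"]
          by (simp add: e_def del: norm_ge_zero)
        then have "(1 + norm x) ^ 4 \<le> (2 * (1 + norm (x + s *\<^sub>R e))) ^ 4" by (intro power_mono) auto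
        then have "(1 + norm x) ^ 4 * norm (partial i f (x + s *\<^sub>R e)) \<le> (2 * (1 + norm (x + s *\<^sub>R e))) ^ 4 * norm (partial i f (x + s *\<^sub>R e))"
          by (rule mult_right_mono) simp
        also have "\<dots> = 16 * ((1 + norm (x + s *\<^sub>R e)) ^ 4 * norm (partial i f (x + s *\<^sub>R e)))"
          unfolding power_mult_distrib by simp
        also have "\<dots> \<le> 16 * C" using C(2)[of "x + s *\<^sub>R e"] by simp
        finally have "norm (partial i f (x + s *\<^sub>R e)) \<le> 16 * C * inverse ((1 + norm x) ^ 4)"
          using zero_less_power[of "1 + norm x" 4] add_pos_nonneg[of 1 "norm x"]
          by (simp add: pos_le_divide_eq mult.commute flip: divide_inverse)
        then show "norm (h *\<^sub>R partial i f (x + s *\<^sub>R e)) \<le> 16 * C * inverse ((1 + norm x) ^ 4) * norm h"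
          by (simp add: mult_left_mono mult.commute[of _ "\<bar>h\<bar>"])
      qed
    qed (use t[of n] in auto)
    then show ?thesis using t[of n] by simp
  qed
  have lim1: "(\<lambda>n. LINT x|lborel. q n x) \<longlonglongrightarrow> (LINT x|lborel. cis (- (x \<bullet> \<xi>)) * partial i f x)"
  proof (rule integral_dominated_convergence[where w="\<lambda>x. 16 * C * inverse ((1 + norm x) ^ 4)"])
    have [measurable]: "partial i f \<in> borel_measurable borel"
      using schwartz_measurable[OF schwartz_partial[OF f]] .
    show "(\<lambda>x. cis (- (x \<bullet> \<xi>)) * partial i f x) \<in> borel_measurable lborel" by measurable
    show "q n \<in> borel_measurable lborel" for n unfolding q_def by measurable
    show "integrable lborel (\<lambda>x::real^2. 16 * C * inverse ((1 + norm x) ^ 4))"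
      by (intro integrable_mult_right integrable_weight)
    show "AE x in lborel. (\<lambda>n. q n x) \<longlonglongrightarrow> cis (- (x \<bullet> \<xi>)) * partial i f x"
    proof (rule AE_I2)
      fix x
      have "((\<lambda>s. f (x + s *\<^sub>R e)) has_vector_derivative partial i f x) (at 0)"
        using D[of x 0] by simp
      from tendsto_mult[OF tendsto_const directional_quotient_limit[OF this], of "cis (- (x \<bullet> \<xi>))"]
      show "(\<lambda>n. q n x) \<longlonglongrightarrow> cis (- (x \<bullet> \<xi>)) * partial i f x" by (simp add: q_def t_def)
    qed
    show "AE x in lborel. norm (q n x) \<le> 16 * C * inverse ((1 + norm x) ^ 4)" for n
      using dom[of _ n] t[of n] by (auto simp: q_def norm_mult norm_divide divide_le_eq)
  qed
  have "(LINT x|lborel. q n x) = (cis (t n * \<xi> $ i) - 1) / of_real (t n) * fourier f \<xi>" for n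
  proof -
    have I: "integrable lborel (\<lambda>x. cis (- (x \<bullet> \<xi>)) * f x)" by (intro integrable_fourier schwartz_integrable f)
    have s: "integrable lborel (\<lambda>x. cis (- ((x + t n *\<^sub>R e) \<bullet> \<xi>)) * f (x + t n *\<^sub>R e))"
      "(LINT x|lborel. cis (- ((x + t n *\<^sub>R e) \<bullet> \<xi>)) * f (x + t n *\<^sub>R e)) = fourier f \<xi>"
      using integrable_plane_affine[of 1 "\<lambda>x. cis (- (x \<bullet> \<xi>)) * f x" "t n *\<^sub>R e"]
        integral_plane_affine[of 1 "\<lambda>x. cis (- (x \<bullet> \<xi>)) * f x" "t n *\<^sub>R e"] I by (auto simp: fourier_def add.commute)
    have q: "q n x = (cis (t n * \<xi> $ i) * (cis (- ((x + t n *\<^sub>R e) \<bullet> \<xi>)) * f (x + t n *\<^sub>R e)) - cis (- (x \<bullet> \<xi>)) * f x) / of_real (t n)" for x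
    proof -
      have "cis (- (x \<bullet> \<xi>)) = cis (t n * \<xi> $ i) * cis (- ((x + t n *\<^sub>R e) \<bullet> \<xi>))"
        by (simp add: cis_mult inner_add_left e_def inner_axis')
      then show ?thesis unfolding q_def by (simp add: field_simps)
    qed
    have "(LINT x|lborel. q n x) = (cis (t n * \<xi> $ i) * fourier f \<xi> - fourier f \<xi>) / of_real (t n)"
      unfolding q using I s by (simp add: fourier_def)
    then show ?thesis by (simp add: field_simps)
  qed
  moreover have "(\<lambda>n. (cis (t n * \<xi> $ i) - 1) / of_real (t n) * fourier f \<xi>) \<longlonglongrightarrow> (\<i> * coord i \<xi>) * fourier f \<xi>"
  proof (intro tendsto_mult tendsto_const)
    have "((\<lambda>s. cis (s * \<xi> $ i)) has_vector_derivative \<i> * coord i \<xi>) (at 0)"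
    proof -
      have "((\<lambda>s. s * \<xi> $ i) has_vector_derivative \<xi> $ i) (at 0)"
        by (auto intro!: derivative_eq_intros simp: has_vector_derivative_def)
      from vector_diff_chain_at[OF this has_vector_derivative_iexp]
      show ?thesis by (simp add: o_def cis_conv_exp coord_def scaleR_conv_of_real mult.commute)
    qed
    from directional_quotient_limit[OF this]
    show "(\<lambda>n. (cis (t n * \<xi> $ i) - 1) / of_real (t n)) \<longlonglongrightarrow> \<i> * coord i \<xi>" by (simp add: t_def)
  qed
  ultimately have "(\<lambda>n. LINT x|lborel. q n x) \<longlonglongrightarrow> (\<i> * coord i \<xi>) * fourier f \<xi>" by simp
  from LIMSEQ_unique[OF lim1 this] show ?thesis by (simp add: fourier_def mult.assoc)
qed

text \<open>Each factor 1 + |\<xi>| is exchanged for first derivatives of \<open>f\<close>, hence an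
  induction on the power with \<open>f\<close> arbitrary. Derivatives of the transform are again
  transforms of Schwartz functions.\<close>

lemma fourier_schwartz:
  assumes f: "f \<in> schwartz" shows "fourier f \<in> schwartz"
proof -
  have R: "\<exists>C. \<forall>\<xi>. (1 + norm \<xi>) ^ k * norm (fourier f \<xi>) \<le> C" if "f \<in> schwartz" for k f
    using that
  proof (induction k arbitrary: f)
    case 0 then show ?case using norm_fourier_le by auto
  next
    case (Suc k)
    from Suc.IH[OF Suc.prems] Suc.IH[OF schwartz_partial[OF Suc.prems, of 1]] Suc.IH[OF schwartz_partial[OF Suc.prems, of 2]]
    obtain A B C where ABC: "\<And>\<xi>. (1 + norm \<xi>) ^ k * norm (fourier f \<xi>) \<le> A"
      "\<And>\<xi>. (1 + norm \<xi>) ^ k * norm (fourier (partial 1 f) \<xi>) \<le> B"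
      "\<And>\<xi>. (1 + norm \<xi>) ^ k * norm (fourier (partial 2 f) \<xi>) \<le> C" by blast
    have "(1 + norm \<xi>) ^ Suc k * norm (fourier f \<xi>) \<le> A + B + C" for \<xi>
    proof -
      have "norm \<xi> \<le> \<bar>\<xi> $ 1\<bar> + \<bar>\<xi> $ 2\<bar>" using norm_le_l1_cart[of \<xi>] by (simp add: sum_2)
      then have "(1 + norm \<xi>) * norm (fourier f \<xi>) \<le> (1 + \<bar>\<xi> $ 1\<bar> + \<bar>\<xi> $ 2\<bar>) * norm (fourier f \<xi>)"
        by (intro mult_right_mono) auto
      also have "\<dots> = norm (fourier f \<xi>) + norm (fourier (partial 1 f) \<xi>) + norm (fourier (partial 2 f) \<xi>)"
        by (simp add: fourier_partial[OF Suc.prems] norm_mult coord_def algebra_simps)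
      finally have "(1 + norm \<xi>) ^ k * ((1 + norm \<xi>) * norm (fourier f \<xi>)) \<le> (1 + norm \<xi>) ^ k * (norm (fourier f \<xi>) + norm (fourier (partial 1 f) \<xi>) + norm (fourier (partial 2 f) \<xi>))"
        by (intro mult_left_mono) auto
      also have "\<dots> \<le> A + B + C" using ABC[of \<xi>] by (simp add: algebra_simps)
      finally show ?thesis by (simp add: algebra_simps)
    qed
    then show ?case by blast
  qed
  have "fourier f \<in> smooth_within rapid"
  proof (rule smooth_within_coinduct[where Q="fourier ` schwartz"])
    show "partial i h \<in> fourier ` schwartz" if "h \<in> fourier ` schwartz" for h i
    proof -
      from that obtain f where f: "f \<in> schwartz" "h = fourier f" by blast
      show ?thesis
        unfolding f(2) partial_fourier[OF schwartz_decaying[OF f(1)]] by (intro imageI schwartz_cmult schwartz_coord f)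
    qed
    show "h differentiable (at x)" if "h \<in> fourier ` schwartz" for h x
      using that fourier_has_derivative schwartz_decaying differentiable_def by blast
    show "h \<in> rapid" if "h \<in> fourier ` schwartz" for h
      using that R unfolding rapid_def by blast
  qed (use f in blast)
  then show ?thesis by (simp add: schwartz_eq)
qed

section \<open>Inverse transform and transposition\<close>

lemma inv_fourier_eq: "inv_fourier f x = fourier f (- x) / (2 * pi)\<^sup>2"
  by (simp add: inv_fourier_def fourier_def inner_commute)

lemma inv_fourier_schwartz: "f \<in> schwartz \<Longrightarrow> inv_fourier f \<in> schwartz"
  using schwartz_cmult[OF schwartz_reflect[OF fourier_schwartz], of f "1 / (2 * pi)\<^sup>2"]
  by (simp add: inv_fourier_eq[abs_def] mult.commute)

text \<open>Fubini for a bounded kernel. One exponential as kernel gives transposition of the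
  Fourier transform, a product of two gives the Gaussian means.\<close>

lemma
  fixes a b :: "real^2 \<Rightarrow> complex"
  assumes a: "integrable lborel a" and b: "integrable lborel b"
    and K [measurable]: "(\<lambda>(x, y). K x y) \<in> borel_measurable (borel \<Otimes>\<^sub>M borel)" and K1: "\<And>x y. norm (K x y) \<le> 1"
  shows integral_kernel_swap: "(LINT x|lborel. a x * (LINT y|lborel. K x y * b y)) = (LINT y|lborel. b y * (LINT x|lborel. K x y * a x))"
proof -
  note [measurable] = borel_measurable_integrable[OF a] borel_measurable_integrable[OF b]
  have Kb: "integrable lborel (\<lambda>y. K x y * b y)" for x
    by (rule Bochner_Integration.integrable_bound[OF b]) (auto simp: norm_mult mult_left_le_one_le K1)
  have i: "integrable lborel (\<lambda>y. a x * (K x y * b y))" for x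
    by (intro integrable_mult_right Kb)
  have "integrable (lborel \<Otimes>\<^sub>M lborel) (\<lambda>(x, y). a x * (K x y * b y))"
  proof (rule lborel_pair.Fubini_integrable)
    show "(\<lambda>(x, y). a x * (K x y * b y)) \<in> borel_measurable (lborel \<Otimes>\<^sub>M lborel)" by measurable
    show "AE x in lborel. integrable lborel (\<lambda>y. case (x, y) of (x, y) \<Rightarrow> a x * (K x y * b y))"
      using i by simp
    show "integrable lborel (\<lambda>x. LINT y|lborel. norm (case (x, y) of (x, y) \<Rightarrow> a x * (K x y * b y)))"
    proof (rule Bochner_Integration.integrable_bound[OF integrable_mult_left[OF integrable_norm[OF a], of "LINT y|lborel. norm (b y)"]])
      have "norm (LINT y|lborel. norm (a x * (K x y * b y))) \<le> norm (a x) * (LINT y|lborel. norm (b y))" for x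
      proof -
        have "norm (LINT y|lborel. norm (a x * (K x y * b y))) = (LINT y|lborel. norm (a x * (K x y * b y)))"
          by (simp add: integral_nonneg)
        also have "\<dots> \<le> (LINT y|lborel. norm (a x) * norm (b y))"
          using i Kb b by (intro integral_mono integrable_norm integrable_mult_right)
            (auto simp: norm_mult mult_left_mono mult_left_le_one_le K1)
        finally show ?thesis by simp
      qed
      then show "AE x in lborel. norm (LINT y|lborel. norm (case (x, y) of (x, y) \<Rightarrow> a x * (K x y * b y))) \<le> norm (norm (a x) * (LINT y|lborel. norm (b y)))"
        by (auto simp: integral_nonneg abs_mult)
    qed measurable
  qed
  from lborel_pair.Fubini_integral[OF this]
  have "(LINT y|lborel. LINT x|lborel. a x * (K x y * b y)) = (LINT x|lborel. LINT y|lborel. a x * (K x y * b y))" .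
  moreover have "(LINT x|lborel. a x * (K x y * b y)) = b y * (LINT x|lborel. K x y * a x)" for y
    by (simp add: ac_simps flip: integral_mult_right_zero)
  moreover have "(LINT y|lborel. a x * (K x y * b y)) = a x * (LINT y|lborel. K x y * b y)" for x
    by simp
  ultimately show ?thesis by simp
qed

lemma fourier_transpose:
  assumes "integrable lborel a" "integrable lborel b"
  shows "(LINT x|lborel. fourier a x * b x) = (LINT x|lborel. a x * fourier b x)"
proof -
  show ?thesis
    using integral_kernel_swap[OF assms, of "\<lambda>x y. cis (- (x \<bullet> y))"]
    by (simp add: fourier_def inner_commute mult.commute)
qed

section \<open>Gaussian means and Fourier inversion\<close>

definition gauss :: "real^2 \<Rightarrow> real" where "gauss x = exp (- ((norm x)\<^sup>2) / 2)"

lemma gauss_measurable [measurable]: "gauss \<in> borel_measurable borel"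
  unfolding gauss_def by measurable

lemma gauss_pos: "0 < gauss x" and gauss_le_1: "gauss x \<le> 1"
  by (auto simp: gauss_def)

lemma integrable_gauss_line: "integrable lborel (\<lambda>x::real. of_real (exp (- (x\<^sup>2) / 2)) :: complex)"
proof -
  have "integrable lborel (\<lambda>x. sqrt (2 * pi) * std_normal_density x)"
    using integrable_normal_density[of 1 0] by simp
  then have "integrable lborel (\<lambda>x::real. exp (- (x\<^sup>2) / 2))"
    by (simp add: std_normal_density_def)
  then show ?thesis by (rule integrable_of_real)
qed

text \<open>This is the characteristic function of the standard normal distribution with the
  normalisation of the density undone.\<close>

lemma gauss_line_fourier:
  "(LINT x|lborel. cis (- (x * t)) * of_real (exp (- (x\<^sup>2) / 2))) = of_real (sqrt (2 * pi) * exp (- (t\<^sup>2) / 2))"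
proof -
  have "of_real (exp (- (t\<^sup>2) / 2)) = char std_normal_distribution (- t)"
    by (simp add: char_std_normal_distribution)
  also have "\<dots> = (LINT x|lborel. std_normal_density x *\<^sub>R iexp (- t * x))"
    unfolding char_def by (subst integral_density) auto
  also have "\<dots> = (LINT x|lborel. of_real (1 / sqrt (2 * pi)) * (cis (- (x * t)) * of_real (exp (- (x\<^sup>2) / 2))))"
    by (intro Bochner_Integration.integral_cong refl)
       (simp add: std_normal_density_def cis_conv_exp scaleR_conv_of_real mult.commute mult.left_commute)
  also have "\<dots> = of_real (1 / sqrt (2 * pi)) * (LINT x|lborel. cis (- (x * t)) * of_real (exp (- (x\<^sup>2) / 2)))"
    by simp
  finally show ?thesis by (simp add: field_simps)
qed

lemma integrable_gauss: "integrable lborel (\<lambda>x. of_real (gauss x) :: complex)"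
  and fourier_gauss: "fourier (\<lambda>x. of_real (gauss x)) \<xi> = of_real (2 * pi * gauss \<xi>)"
proof -
  have g: "gauss x = exp (- ((x $ 1)\<^sup>2) / 2) * exp (- ((x $ 2)\<^sup>2) / 2)" for x
    by (simp add: gauss_def norm_sq_2 exp_add[symmetric] add_divide_distrib)
  show "integrable lborel (\<lambda>x. of_real (gauss x) :: complex)"
    using integrable_plane_prod[OF integrable_gauss_line integrable_gauss_line] by (simp add: g)
  have i: "integrable lborel (\<lambda>x::real. cis (- (x * t)) * of_real (exp (- (x\<^sup>2) / 2)))" for t
    by (rule integrable_cis[OF integrable_gauss_line]) measurable
  have "fourier (\<lambda>x. of_real (gauss x)) \<xi> =
      (LINT x::real^2|lborel. (cis (- (x $ 1 * \<xi> $ 1)) * of_real (exp (- ((x $ 1)\<^sup>2) / 2))) * (cis (- (x $ 2 * \<xi> $ 2)) * of_real (exp (- ((x $ 2)\<^sup>2) / 2))))"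
    unfolding fourier_def
  proof (intro Bochner_Integration.integral_cong refl)
    fix x :: "real^2"
    have "cis (- (x \<bullet> \<xi>)) = cis (- (x $ 1 * \<xi> $ 1)) * cis (- (x $ 2 * \<xi> $ 2))"
      by (simp add: cis_mult inner_vec_def sum_2)
    then show "cis (- (x \<bullet> \<xi>)) * complex_of_real (gauss x) = (cis (- (x $ 1 * \<xi> $ 1)) * of_real (exp (- ((x $ 1)\<^sup>2) / 2))) * (cis (- (x $ 2 * \<xi> $ 2)) * of_real (exp (- ((x $ 2)\<^sup>2) / 2)))"
      by (simp add: g)
  qed
  also have "\<dots> = of_real (sqrt (2 * pi) * exp (- ((\<xi> $ 1)\<^sup>2) / 2)) * of_real (sqrt (2 * pi) * exp (- ((\<xi> $ 2)\<^sup>2) / 2))"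
    unfolding integral_plane_prod[OF i i] gauss_line_fourier ..
  also have "\<dots> = of_real ((sqrt (2 * pi) * sqrt (2 * pi)) * gauss \<xi>)"
    unfolding g of_real_mult[symmetric] by (simp only: ac_simps)
  also have "sqrt (2 * pi) * sqrt (2 * pi) = 2 * pi" by simp
  finally show "fourier (\<lambda>x. of_real (gauss x)) \<xi> = of_real (2 * pi * gauss \<xi>)" .
qed

lemma integral_gauss: "(LINT x|lborel. of_real (gauss x)) = complex_of_real (2 * pi)"
  using fourier_gauss[of 0] by (simp add: fourier_def gauss_def)

lemma gauss_minus [simp]: "gauss (- x) = gauss x"
  by (simp add: gauss_def)

lemma fourier_gauss_scaled:
  assumes "\<epsilon> \<noteq> 0"
  shows "fourier (\<lambda>x. of_real (gauss (\<epsilon> *\<^sub>R x))) \<xi> = of_real (2 * pi / \<epsilon>\<^sup>2 * gauss ((1 / \<epsilon>) *\<^sub>R \<xi>))"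
proof -
  have "fourier (\<lambda>x. of_real (gauss x)) ((1 / \<epsilon>) *\<^sub>R \<xi>) = \<epsilon>\<^sup>2 *\<^sub>R fourier (\<lambda>x. of_real (gauss (\<epsilon> *\<^sub>R x))) \<xi>"
    unfolding fourier_def
    by (subst integral_plane_affine[of \<epsilon> _ 0]) (use assms in auto)
  then show ?thesis
    using assms unfolding fourier_gauss by (simp add: scaleR_conv_of_real field_simps)
qed

section \<open>Gaussian means and the inversion theorem\<close>

definition gauss_mean :: "real \<Rightarrow> (real^2 \<Rightarrow> complex) \<Rightarrow> real^2 \<Rightarrow> complex"
  where "gauss_mean \<epsilon> g x = (LINT z|lborel. g (x + \<epsilon> *\<^sub>R z) * of_real (gauss z)) / (2 * pi)"

text \<open>Inversion with a Gaussian convergence factor: after Fubini the inner integral is the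
  transform of a dilated Gaussian, centred at \<open>x\<close>, and the substitution y = x +
  \<epsilon> z produces the mean.\<close>

lemma gauss_mean_fourier:
  assumes g: "integrable lborel g" and e: "\<epsilon> \<noteq> 0"
  shows "fourier (\<lambda>\<xi>. of_real (gauss (\<epsilon> *\<^sub>R \<xi>)) * fourier g (- \<xi>)) x = (2 * pi)\<^sup>2 * gauss_mean \<epsilon> g x"
proof -
  note [measurable] = borel_measurable_integrable[OF g]
  have ig: "integrable lborel (\<lambda>\<xi>. of_real (gauss (\<epsilon> *\<^sub>R \<xi>)) :: complex)"
    using integrable_plane_affine[OF e integrable_gauss, of 0] by simp
  have "fourier (\<lambda>\<xi>. of_real (gauss (\<epsilon> *\<^sub>R \<xi>)) * fourier g (- \<xi>)) x
     = (LINT \<xi>|lborel. of_real (gauss (\<epsilon> *\<^sub>R \<xi>)) * (LINT y|lborel. (cis (- (x \<bullet> \<xi>)) * cis (y \<bullet> \<xi>)) * g y))"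
    unfolding fourier_def
  proof (intro Bochner_Integration.integral_cong refl)
    fix \<xi>
    have "(LINT y|lborel. (cis (- (x \<bullet> \<xi>)) * cis (y \<bullet> \<xi>)) * g y) = cis (- (x \<bullet> \<xi>)) * (LINT y|lborel. cis (y \<bullet> \<xi>) * g y)"
      by (simp add: mult.assoc)
    then show "cis (- (\<xi> \<bullet> x)) * (of_real (gauss (\<epsilon> *\<^sub>R \<xi>)) * (LINT xa|lborel. cis (- (xa \<bullet> - \<xi>)) * g xa))
      = of_real (gauss (\<epsilon> *\<^sub>R \<xi>)) * (LINT y|lborel. (cis (- (x \<bullet> \<xi>)) * cis (y \<bullet> \<xi>)) * g y)"
      by (simp add: inner_commute mult.left_commute)
  qed
  also have "\<dots> = (LINT y|lborel. g y * (LINT \<xi>|lborel. (cis (- (x \<bullet> \<xi>)) * cis (y \<bullet> \<xi>)) * of_real (gauss (\<epsilon> *\<^sub>R \<xi>))))"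
    by (intro integral_kernel_swap ig g) (auto simp: norm_mult)
  also have "\<dots> = (LINT y|lborel. g y * fourier (\<lambda>\<xi>. of_real (gauss (\<epsilon> *\<^sub>R \<xi>))) (x - y))"
    by (simp add: fourier_def cis_mult inner_diff_right inner_commute)
  also have "\<dots> = (LINT y|lborel. g y * of_real (2 * pi / \<epsilon>\<^sup>2 * gauss ((1 / \<epsilon>) *\<^sub>R (x - y))))"
    by (simp only: fourier_gauss_scaled[OF e])
  also have "\<dots> = \<epsilon>\<^sup>2 *\<^sub>R (LINT z|lborel. g (x + \<epsilon> *\<^sub>R z) * of_real (2 * pi / \<epsilon>\<^sup>2 * gauss z))"
    by (subst integral_plane_affine[OF e, of _ x]) (use e in simp)
  also have "\<dots> = \<epsilon>\<^sup>2 *\<^sub>R (of_real (2 * pi / \<epsilon>\<^sup>2) * (LINT z|lborel. g (x + \<epsilon> *\<^sub>R z) * of_real (gauss z)))"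
    by (simp add: ac_simps flip: integral_mult_right_zero)
  also have "\<dots> = (2 * pi)\<^sup>2 * gauss_mean \<epsilon> g x"
    using e by (simp add: gauss_mean_def scaleR_conv_of_real field_simps power2_eq_square)
  finally show ?thesis .
qed

lemma gauss_mean_approx:
  assumes b: "\<And>x. norm (g x) \<le> B" and [measurable]: "g \<in> borel_measurable borel" and c: "isCont g x"
    and e: "\<epsilon> \<longlonglongrightarrow> 0"
  shows "(\<lambda>n. gauss_mean (\<epsilon> n) g x) \<longlonglongrightarrow> g x"
proof -
  have "(\<lambda>n. LINT z|lborel. g (x + \<epsilon> n *\<^sub>R z) * of_real (gauss z)) \<longlonglongrightarrow> (LINT z|lborel. g x * of_real (gauss z))"
  proof (rule integral_dominated_convergence[where w="\<lambda>z. B * gauss z"])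
    have "integrable lborel gauss" using integrable_norm[OF integrable_gauss] gauss_pos by (simp add: less_imp_le)
    then show "integrable lborel (\<lambda>z. B * gauss z)" by simp
    show "AE z in lborel. (\<lambda>n. g (x + \<epsilon> n *\<^sub>R z) * of_real (gauss z)) \<longlonglongrightarrow> g x * of_real (gauss z)"
    proof (rule AE_I2, intro tendsto_mult tendsto_const)
      fix z
      have "(\<lambda>n. x + \<epsilon> n *\<^sub>R z) \<longlonglongrightarrow> x + 0 *\<^sub>R z" by (intro tendsto_intros e)
      then show "(\<lambda>n. g (x + \<epsilon> n *\<^sub>R z)) \<longlonglongrightarrow> g x"
        using c isCont_tendsto_compose[of x g] by simp
    qed
    show "AE z in lborel. norm (g (x + \<epsilon> n *\<^sub>R z) * of_real (gauss z)) \<le> B * gauss z" for n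
      using b gauss_pos by (intro AE_I2) (auto simp: norm_mult less_imp_le intro!: mult_right_mono)
  qed measurable
  moreover have "(LINT z|lborel. g x * of_real (gauss z)) = g x * of_real (2 * pi)"
    by (simp only: integral_mult_right_zero integral_gauss)
  ultimately have "(\<lambda>n. (LINT z|lborel. g (x + \<epsilon> n *\<^sub>R z) * of_real (gauss z)) / (2 * pi)) \<longlonglongrightarrow> (g x * (2 * pi)) / (2 * pi)"
    by (intro tendsto_divide tendsto_const) auto
  then show ?thesis by (simp add: gauss_mean_def)
qed

text \<open>For use where integrability of the limit is itself to be proved: a uniform bound on
  truncations passes to it.\<close>

lemma Fatou_bound:
  fixes f :: "nat \<Rightarrow> 'a \<Rightarrow> real"
  assumes f: "\<And>n. integrable M (f n)" and f0: "\<And>n x. 0 \<le> f n x" and fB: "\<And>n. integral\<^sup>L M (f n) \<le> B"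
    and lim: "AE x in M. (\<lambda>n. f n x) \<longlonglongrightarrow> u x" and u [measurable]: "u \<in> borel_measurable M"
  shows "integrable M u" and "integral\<^sup>L M u \<le> B"
proof -
  have [measurable]: "f n \<in> borel_measurable M" for n using f by auto
  have B: "0 \<le> B" by (rule order_trans[OF Bochner_Integration.integral_nonneg[OF f0] fB])
  have u0: "AE x in M. 0 \<le> u x"
    using lim by eventually_elim (auto intro: LIMSEQ_le_const simp: f0)
  have "(\<integral>\<^sup>+x. ennreal (u x) \<partial>M) = (\<integral>\<^sup>+x. liminf (\<lambda>n. ennreal (f n x)) \<partial>M)"
  proof (rule nn_integral_cong_AE)
    show "AE x in M. ennreal (u x) = liminf (\<lambda>n. ennreal (f n x))"
      using lim by eventually_elim (intro lim_imp_Liminf[symmetric] tendsto_ennrealI, auto)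
  qed
  also have "\<dots> \<le> liminf (\<lambda>n. \<integral>\<^sup>+x. ennreal (f n x) \<partial>M)"
    by (rule nn_integral_liminf) measurable
  also have "\<dots> \<le> liminf (\<lambda>n::nat. ennreal B)"
    using f f0 fB by (intro Liminf_mono always_eventually allI) (auto simp: nn_integral_eq_integral intro!: ennreal_leI)
  also have "\<dots> = ennreal B" by (simp add: Liminf_const)
  finally have *: "(\<integral>\<^sup>+x. ennreal (u x) \<partial>M) \<le> ennreal B" .
  show "integrable M u"
    using u0 * by (intro integrableI_nonneg) (auto simp: le_less_trans)
  then show "integral\<^sup>L M u \<le> B"
    using * u0 B by (simp add: nn_integral_eq_integral)
qed

text \<open>The convergence factor is removed along \<epsilon> = 1/(n+1). One side tends to the
  double transform by dominated convergence; the other is a Gaussian mean and tends to the value of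
  \<open>f\<close>.\<close>

lemma fourier_inversion:
  fixes f :: "real^2 \<Rightarrow> complex"
  assumes f: "f \<in> schwartz"
  shows "fourier (\<lambda>\<xi>. fourier f (- \<xi>)) x = (2 * pi)\<^sup>2 * f x"
proof -
  note [measurable] = schwartz_measurable[OF f]
  define \<epsilon> where "\<epsilon> n = 1 / real (Suc n)" for n
  have e: "\<epsilon> n \<noteq> 0" for n by (simp add: \<epsilon>_def)
  have e0: "\<epsilon> \<longlonglongrightarrow> 0"
    unfolding \<epsilon>_def using LIMSEQ_inverse_real_of_nat by (simp add: inverse_eq_divide)
  let ?h = "\<lambda>\<xi>. fourier f (- \<xi>)"
  have h: "?h \<in> schwartz" by (intro schwartz_reflect fourier_schwartz f)
  note [measurable] = schwartz_measurable[OF h]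
  have "(\<lambda>n. fourier (\<lambda>\<xi>. of_real (gauss (\<epsilon> n *\<^sub>R \<xi>)) * ?h \<xi>) x) \<longlonglongrightarrow> fourier ?h x"
    unfolding fourier_def[of _ x]
  proof (rule integral_dominated_convergence[where w="\<lambda>\<xi>. norm (?h \<xi>)"])
    show "integrable lborel (\<lambda>\<xi>. norm (?h \<xi>))" by (intro integrable_norm schwartz_integrable h)
    show "AE \<xi> in lborel. (\<lambda>n. cis (- (\<xi> \<bullet> x)) * (of_real (gauss (\<epsilon> n *\<^sub>R \<xi>)) * ?h \<xi>)) \<longlonglongrightarrow> cis (- (\<xi> \<bullet> x)) * ?h \<xi>"
    proof (rule AE_I2)
      fix \<xi> :: "real^2"
      have "(\<lambda>n. gauss (\<epsilon> n *\<^sub>R \<xi>)) \<longlonglongrightarrow> gauss (0 *\<^sub>R \<xi>)"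
        unfolding gauss_def by (intro tendsto_intros e0) auto
      then have "(\<lambda>n. cis (- (\<xi> \<bullet> x)) * (of_real (gauss (\<epsilon> n *\<^sub>R \<xi>)) * ?h \<xi>)) \<longlonglongrightarrow> cis (- (\<xi> \<bullet> x)) * (of_real (gauss (0 *\<^sub>R \<xi>)) * ?h \<xi>)"
        by (intro tendsto_intros)
      then show "(\<lambda>n. cis (- (\<xi> \<bullet> x)) * (of_real (gauss (\<epsilon> n *\<^sub>R \<xi>)) * ?h \<xi>)) \<longlonglongrightarrow> cis (- (\<xi> \<bullet> x)) * ?h \<xi>"
        by (simp add: gauss_def)
    qed
    show "AE \<xi> in lborel. norm (cis (- (\<xi> \<bullet> x)) * (of_real (gauss (\<epsilon> n *\<^sub>R \<xi>)) * ?h \<xi>)) \<le> norm (?h \<xi>)" for n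
      using gauss_pos gauss_le_1 by (intro AE_I2) (auto simp: norm_mult less_imp_le intro!: mult_left_le_one_le)
  qed measurable
  then have 1: "(\<lambda>n. (2 * pi)\<^sup>2 * gauss_mean (\<epsilon> n) f x) \<longlonglongrightarrow> fourier ?h x"
    by (simp add: gauss_mean_fourier[OF schwartz_integrable[OF f] e])
  obtain C where "\<And>x. (1 + norm x) ^ 0 * norm (f x) \<le> C" using schwartz_rapid[OF f, of 0] by metis
  then have "(\<lambda>n. gauss_mean (\<epsilon> n) f x) \<longlonglongrightarrow> f x"
    using schwartz_continuous[OF f, of UNIV] by (intro gauss_mean_approx[of f C] e0) (auto simp: continuous_on_eq_continuous_at)
  then have "(\<lambda>n. (2 * pi)\<^sup>2 * gauss_mean (\<epsilon> n) f x) \<longlonglongrightarrow> (2 * pi)\<^sup>2 * f x"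
    by (intro tendsto_intros)
  from LIMSEQ_unique[OF 1 this] show ?thesis .
qed

section \<open>The inverse pair and Plancherel\<close>

lemma fourier_inv_fourier:
  assumes "f \<in> schwartz" shows "fourier (inv_fourier f) = f"
proof
  fix x
  have "fourier (inv_fourier f) x = (1 / (2 * pi)\<^sup>2) * fourier (\<lambda>\<xi>. fourier f (- \<xi>)) x"
    unfolding fourier_def[of _ x] inv_fourier_eq[abs_def] by simp
  then show "fourier (inv_fourier f) x = f x" by (simp add: fourier_inversion[OF assms])
qed

lemma fourier_reflect: "fourier (\<lambda>x. f (- x)) \<xi> = fourier f (- \<xi>)"
  unfolding fourier_def by (subst integral_plane_reflect[symmetric]) simp

lemma inv_fourier_fourier:
  assumes "f \<in> schwartz" shows "inv_fourier (fourier f) = f"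
proof
  fix x
  have "inv_fourier (fourier f) x = fourier (\<lambda>\<xi>. fourier f (- \<xi>)) x / (2 * pi)\<^sup>2"
    by (simp add: inv_fourier_eq fourier_reflect)
  then show "inv_fourier (fourier f) x = f x" by (simp add: fourier_inversion[OF assms])
qed

lemma schwartz_integrable_mult:
  assumes "f \<in> schwartz" "g \<in> schwartz" shows "integrable lborel (\<lambda>x. f x * g x)"
  by (intro schwartz_integrable schwartz_mult schwartz_multiplier assms)

lemma schwartz_integrable_sq:
  assumes "f \<in> schwartz" shows "integrable lborel (\<lambda>x. (norm (f x))\<^sup>2)"
  using integrable_norm[OF schwartz_integrable_mult[OF assms assms]] by (simp add: norm_mult power2_eq_square)

lemma fourier_cnj: "cnj (fourier f \<xi>) = fourier (\<lambda>x. cnj (f x)) (- \<xi>)"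
  unfolding fourier_def by (simp add: cis_cnj flip: Bochner_Integration.integral_cnj)

text \<open>Transposition is applied to \<open>f\<close> and the conjugate of its transform; the
  latter turns into a double transform, to which inversion applies.\<close>

lemma plancherel:
  assumes f: "f \<in> schwartz"
  shows "(LINT x|lborel. (norm (fourier f x))\<^sup>2) = (2 * pi)\<^sup>2 * (LINT x|lborel. (norm (f x))\<^sup>2)"
proof -
  have c: "(\<lambda>x. cnj (f x)) \<in> schwartz" by (rule schwartz_cnj[OF f])
  have g: "(\<lambda>\<xi>. fourier (\<lambda>x. cnj (f x)) (- \<xi>)) \<in> schwartz" by (intro schwartz_reflect fourier_schwartz c)
  have "complex_of_real (LINT x|lborel. (norm (fourier f x))\<^sup>2) = (LINT x|lborel. fourier f x * cnj (fourier f x))"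
    by (simp only: complex_norm_square flip: integral_complex_of_real)
  also have "\<dots> = (LINT x|lborel. f x * fourier (\<lambda>\<xi>. fourier (\<lambda>x. cnj (f x)) (- \<xi>)) x)"
    unfolding fourier_cnj by (intro fourier_transpose schwartz_integrable f g)
  also have "\<dots> = (LINT x|lborel. (2 * pi)\<^sup>2 * (f x * cnj (f x)))"
    unfolding fourier_inversion[OF c] by (simp add: ac_simps)
  also have "\<dots> = complex_of_real ((2 * pi)\<^sup>2 * (LINT x|lborel. (norm (f x))\<^sup>2))"
    by (simp only: complex_norm_square of_real_mult integral_mult_right_zero flip: integral_complex_of_real)
  finally show ?thesis unfolding of_real_eq_iff .
qed

section \<open>Gaussians as Schwartz functions and limits of multipliers\<close>

lemma power_times_gauss_bounded:
  assumes "c \<noteq> 0"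
  shows "\<exists>C. \<forall>x. (1 + norm x) ^ k * gauss (c *\<^sub>R x) \<le> C"
proof -
  let ?m = "real (Suc k)"
  have "(1 + norm x) ^ k * gauss (c *\<^sub>R x) \<le> ?m ^ Suc k * exp (1 + 1 / (2 * c\<^sup>2))" for x
  proof -
    let ?r = "norm x"
    \<comment> \<open>Dividing by \<open>?m = k + 1\<close> before using t <= exp t makes the power
      \<open>Suc k\<close> collapse to exp (1 + |x|), a linear exponent that the Gaussian
      absorbs.\<close>
    have "1 + ?r \<le> ?m * exp ((1 + ?r) / ?m)"
    proof -
      have "(1 + ?r) / ?m \<le> exp ((1 + ?r) / ?m)" using exp_ge_add_one_self[of "(1 + ?r) / ?m"] by linarith
      then show ?thesis by (simp add: pos_divide_le_eq mult.commute)
    qed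
    then have "(1 + ?r) ^ Suc k \<le> (?m * exp ((1 + ?r) / ?m)) ^ Suc k" by (intro power_mono) auto
    also have "\<dots> = ?m ^ Suc k * exp (1 + ?r)"
      unfolding power_mult_distrib by (subst exp_of_nat_mult[symmetric]) simp
    finally have 1: "(1 + ?r) ^ Suc k \<le> ?m ^ Suc k * exp (1 + ?r)" .
    have "0 \<le> (\<bar>c\<bar> * ?r - 1 / \<bar>c\<bar>)\<^sup>2" by simp
    then have "2 * ?r \<le> c\<^sup>2 * ?r\<^sup>2 + 1 / c\<^sup>2"
      using assms by (simp add: power2_diff power_mult_distrib power_divide)
    then have 2: "exp (1 + ?r) * exp (- (c\<^sup>2 * ?r\<^sup>2) / 2) \<le> exp (1 + 1 / (2 * c\<^sup>2))"
      by (subst exp_add[symmetric], subst exp_le_cancel_iff) (simp add: field_simps)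
    have "(1 + ?r) ^ k * gauss (c *\<^sub>R x) \<le> (1 + ?r) ^ Suc k * gauss (c *\<^sub>R x)"
      using gauss_pos[of "c *\<^sub>R x"] by (intro mult_right_mono power_increasing) auto
    also have "\<dots> \<le> ?m ^ Suc k * exp (1 + ?r) * gauss (c *\<^sub>R x)"
      using gauss_pos[of "c *\<^sub>R x"] by (intro mult_right_mono 1) auto
    also have "\<dots> = ?m ^ Suc k * (exp (1 + ?r) * exp (- (c\<^sup>2 * ?r\<^sup>2) / 2))"
      by (simp add: gauss_def power_mult_distrib)
    also have "\<dots> \<le> ?m ^ Suc k * exp (1 + 1 / (2 * c\<^sup>2))" by (intro mult_left_mono 2) auto
    finally show ?thesis .
  qed
  then show ?thesis by blast
qed

lemma gauss_decaying:
  assumes "c \<noteq> 0" shows "(\<lambda>x. of_real (gauss (c *\<^sub>R x))) \<in> decaying"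
  unfolding decaying_def
proof (intro CollectI conjI allI)
  show "(\<lambda>x. complex_of_real (gauss (c *\<^sub>R x))) \<in> borel_measurable borel" by measurable
  fix k
  obtain C where C: "\<And>x. (1 + norm x) ^ (k+4) * gauss (c *\<^sub>R x) \<le> C" using power_times_gauss_bounded[OF assms] by metis
  show "integrable lborel (\<lambda>x. (1 + norm x) ^ k * norm (complex_of_real (gauss (c *\<^sub>R x))))"
  proof (rule Bochner_Integration.integrable_bound[OF integrable_mult_right[OF integrable_weight, of C]])
    have "norm ((1 + norm x) ^ k * norm (complex_of_real (gauss (c *\<^sub>R x)))) \<le> norm (C * inverse ((1 + norm x) ^ 4))" for x
    proof -
      have "(1 + norm x) ^ k * gauss (c *\<^sub>R x) = ((1 + norm x) ^ (k+4) * gauss (c *\<^sub>R x)) * inverse ((1 + norm x) ^ 4)"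
        by (simp add: power_add add_nonneg_eq_0_iff)
      also have "\<dots> \<le> C * inverse ((1 + norm x) ^ 4)" by (intro mult_right_mono C) auto
      also have "\<dots> \<le> norm (C * inverse ((1 + norm x) ^ 4))" by simp
      finally show ?thesis using gauss_pos[of "c *\<^sub>R x"] by (simp add: abs_mult)
    qed
    then show "AE x in lborel. norm ((1 + norm x) ^ k * norm (complex_of_real (gauss (c *\<^sub>R x)))) \<le> norm (C * inverse ((1 + norm x) ^ 4))" by simp
  qed measurable
qed

lemma gauss_schwartz:
  assumes c: "c \<noteq> 0" shows "(\<lambda>x. of_real (gauss (c *\<^sub>R x))) \<in> schwartz"
proof -
  let ?g = "\<lambda>x::real^2. complex_of_real (gauss (c *\<^sub>R x))"
  have D: "(?g has_derivative (\<lambda>h. - (of_real (c\<^sup>2 * (x \<bullet> h)) * ?g x))) (at x)" for x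
  proof -
    have "((\<lambda>x::real^2. - ((norm (c *\<^sub>R x))\<^sup>2) / 2) has_derivative (\<lambda>h. - (c\<^sup>2 * (x \<bullet> h)))) (at x)"
      unfolding power2_norm_eq_inner
      by (auto intro!: derivative_eq_intros simp: power2_eq_square inner_commute)
    from has_derivative_of_real[OF has_derivative_exp[OF this]]
    show ?thesis unfolding gauss_def by (simp add: mult.commute)
  qed
  have P: "partial i ?g x = - (of_real (c\<^sup>2) * coord i x * ?g x)" for i x
    by (subst partial_eq[OF D]) (simp add: coord_def inner_axis)
  have g: "?g \<in> rapid"
    using power_times_gauss_bounded[OF c] gauss_pos unfolding rapid_def by (simp add: less_imp_le)
  \<comment> \<open>Differentiation only changes the multiplier in front of the Gaussian; the
    leading 1 exhibits the Gaussian as a member of that family.\<close>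
  have "(\<lambda>x. 1 * ?g x) \<in> smooth_within rapid"
  proof (rule smooth_within_coinduct[where Q="{h. \<exists>m\<in>multiplier. h = (\<lambda>x. m x * ?g x)}"])
    show "(\<lambda>x. 1 * ?g x) \<in> {h. \<exists>m\<in>multiplier. h = (\<lambda>x. m x * ?g x)}"
      by (intro CollectI bexI[of _ "\<lambda>x. 1"] refl multiplier_const)
    fix h assume "h \<in> {h. \<exists>m\<in>multiplier. h = (\<lambda>x. m x * ?g x)}"
    then obtain m where m: "m \<in> multiplier" "h = (\<lambda>x. m x * ?g x)" by blast
    note M = smooth_withinD[OF m(1)]
    have gd: "?g differentiable (at x)" for x using D differentiable_def by blast
    show "h differentiable (at x)" for x unfolding m(2) by (intro differentiable_mult M gd)
    show "h \<in> rapid" unfolding m(2) by (intro rapid_mult M g)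
    show "partial i h \<in> {h. \<exists>m\<in>multiplier. h = (\<lambda>x. m x * ?g x)}" for i
    proof (intro CollectI bexI ext)
      show "partial i h x = (partial i m x + (- of_real (c\<^sup>2)) * (coord i x * m x)) * ?g x" for x
        unfolding m(2) by (subst partial_mult[OF M(2) gd]) (simp add: P algebra_simps)
      show "(\<lambda>x. partial i m x + (- of_real (c\<^sup>2)) * (coord i x * m x)) \<in> multiplier"
        by (intro multiplier_add multiplier_mult multiplier_const multiplier_coord M m)
    qed
  qed
  then show ?thesis by (simp add: schwartz_eq)
qed

lemma gauss_mean_bound:
  assumes [measurable]: "g \<in> borel_measurable borel" and "\<And>x. norm (g x) \<le> 1"
  shows "norm (gauss_mean \<epsilon> g x) \<le> 1"
proof -
  have ig: "integrable lborel gauss" using integrable_norm[OF integrable_gauss] gauss_pos by (simp add: less_imp_le)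
  have "norm (LINT z|lborel. g (x + \<epsilon> *\<^sub>R z) * of_real (gauss z)) \<le> (LINT z|lborel. gauss z)"
  proof (rule Bochner_Integration.integral_norm_bound_integral[OF _ ig])
    show b: "norm (g (x + \<epsilon> *\<^sub>R z) * of_real (gauss z)) \<le> gauss z" for z
      using assms(2)[of "x + \<epsilon> *\<^sub>R z"] gauss_pos[of z] by (simp add: norm_mult mult_left_le_one_le)
    show "integrable lborel (\<lambda>z. g (x + \<epsilon> *\<^sub>R z) * of_real (gauss z))"
      using b gauss_pos by (intro Bochner_Integration.integrable_bound[OF ig]) (auto simp: less_imp_le)
  qed
  also have "(LINT z|lborel. gauss z) = 2 * pi"
    using integral_gauss unfolding integral_complex_of_real of_real_eq_iff .
  finally show ?thesis by (simp add: gauss_mean_def norm_divide)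
qed

text \<open>Continuous functions of compact support are limits of their Gaussian means, which are smooth as
  Fourier transforms of decaying functions.\<close>

lemma bounded_limit_induct:
  assumes psi [measurable]: "\<psi> \<in> borel_measurable borel" and psi1: "\<And>x. norm (\<psi> x) \<le> 1"
    and base: "\<And>\<phi>. \<phi> \<in> multiplier \<Longrightarrow> (\<And>x. norm (\<phi> x) \<le> 1) \<Longrightarrow> P \<phi>"
    and step: "\<And>\<phi> \<psi>. (\<And>n. \<phi> n \<in> borel_measurable borel) \<Longrightarrow> (\<And>n x. norm (\<phi> n x) \<le> 1) \<Longrightarrow> (\<And>n. P (\<phi> n)) \<Longrightarrow>
        \<psi> \<in> borel_measurable borel \<Longrightarrow> (\<And>x. norm (\<psi> x) \<le> 1) \<Longrightarrow> AE x in lborel. (\<lambda>n. \<phi> n x) \<longlonglongrightarrow> \<psi> x \<Longrightarrow> P \<psi>"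
  shows "P \<psi>"
proof -
  have compact: "P g" if g: "continuous_on UNIV g" "\<And>x. norm (g x) \<le> 1" "\<And>x. R \<le> norm x \<Longrightarrow> g x = 0" for g and R :: real
  proof -
    have [measurable]: "g \<in> borel_measurable borel" using g(1) by (rule borel_measurable_continuous_onI)
    have ig: "integrable lborel g"
    proof (rule Bochner_Integration.integrable_bound)
      show "integrable lborel (indicator (cball 0 R) :: real^2 \<Rightarrow> real)"
        using emeasure_lborel_cball_finite[of 0 R] by (simp add: integrable_indicator_iff)
      show "AE x in lborel. norm (g x) \<le> norm (indicator (cball 0 R) x :: real)"
        using g(2,3) by (intro AE_I2) (auto simp: indicator_def not_le less_imp_le)
    qed measurable
    define \<epsilon> where "\<epsilon> n = 1 / real (Suc n)" for n
    have e: "\<epsilon> n \<noteq> 0" for n by (simp add: \<epsilon>_def)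
    have e0: "\<epsilon> \<longlonglongrightarrow> 0"
      unfolding \<epsilon>_def using LIMSEQ_inverse_real_of_nat by (simp add: inverse_eq_divide)
    have M: "gauss_mean (\<epsilon> n) g \<in> multiplier" for n
    proof -
      have [measurable]: "(\<lambda>\<xi>. fourier g (- \<xi>)) \<in> borel_measurable borel"
        unfolding fourier_def by measurable
      have "(\<lambda>\<xi>. fourier g (- \<xi>) * of_real (gauss (\<epsilon> n *\<^sub>R \<xi>))) \<in> decaying"
        by (rule decaying_mult[OF gauss_decaying[OF e], where C="LINT x|lborel. norm (g x)" and l=0]) (simp, simp add: norm_fourier_le)
      from fourier_multiplier[OF this]
      have "(\<lambda>x. (1 / (2 * pi)\<^sup>2) * fourier (\<lambda>\<xi>. fourier g (- \<xi>) * of_real (gauss (\<epsilon> n *\<^sub>R \<xi>))) x) \<in> multiplier"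
        by (rule multiplier_mult[OF multiplier_const])
      moreover have "(1 / (2 * pi)\<^sup>2) * fourier (\<lambda>\<xi>. fourier g (- \<xi>) * of_real (gauss (\<epsilon> n *\<^sub>R \<xi>))) x = gauss_mean (\<epsilon> n) g x" for x
        using gauss_mean_fourier[OF ig e, of n x] by (simp add: mult.commute)
      ultimately show ?thesis by simp
    qed
    have M': "gauss_mean (\<epsilon> n) g \<in> borel_measurable borel" for n
      using smooth_withinD(2)[OF M] by (intro borel_measurable_continuous_onI)
        (meson continuous_at_imp_continuous_on differentiable_imp_continuous_within)
    show "P g"
    proof (rule step[of "\<lambda>n. gauss_mean (\<epsilon> n) g"])
      show "AE x in lborel. (\<lambda>n. gauss_mean (\<epsilon> n) g x) \<longlonglongrightarrow> g x"
        using g(1) by (intro AE_I2 gauss_mean_approx[of g 1] e0 g(2)) (auto simp: continuous_on_eq_continuous_at)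
    qed (use g(2) M M' gauss_mean_bound base in auto)
  qed
  \<comment> \<open>This notion of measurability hands over continuous functions that converge
    outside a negligible set.\<close>
  have "\<psi> measurable_on UNIV"
    by (rule lebesgue_measurable_imp_measurable_on) (auto intro: measurable_completion)
  then obtain N g where N: "negligible N" and g: "\<And>n. continuous_on UNIV (g n)"
    and lim: "\<And>x. x \<notin> N \<Longrightarrow> (\<lambda>n. g n x) \<longlonglongrightarrow> \<psi> x"
    unfolding measurable_on_def by auto
  \<comment> \<open>The cutoff in |x| gives compact support and the division projects onto the unit
    disc. Neither moves the limit: the cutoff tends to 1, and \<psi> is bounded by 1.\<close>
  define h where "h n x = of_real (max 0 (min 1 (real n - norm x))) * (g n x / of_real (max 1 (norm (g n x))))" for n and x :: "real^2"
  have hc: "continuous_on UNIV (h n)" for n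
    unfolding h_def by (intro continuous_intros g) auto
  have h1: "norm (h n x) \<le> 1" for n x
  proof -
    have "norm (g n x / of_real (max 1 (norm (g n x)))) \<le> 1"
      by (simp add: norm_divide divide_le_eq)
    moreover have "norm (complex_of_real (max 0 (min 1 (real n - norm x)))) \<le> 1" by simp
    ultimately show ?thesis unfolding h_def norm_mult by (intro mult_le_one) auto
  qed
  have Ph: "P (h n)" for n
    by (rule compact[OF hc h1, where R="real n"]) (simp add: h_def)
  show "P \<psi>"
  proof (rule step[of h])
    obtain N' where "N' \<in> null_sets lborel" "N \<subseteq> N'"
      using N unfolding negligible_iff_null_sets null_sets_completion_iff2 by blast
    have "(\<lambda>n. h n x) \<longlonglongrightarrow> \<psi> x" if "x \<notin> N" for x
    proof -
      have "(\<lambda>n. max 0 (min 1 (real n - norm x))) \<longlonglongrightarrow> 1"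
      proof (rule tendsto_eventually)
        obtain m where "norm x + 1 \<le> real m" using real_arch_simple by blast
        then show "\<forall>\<^sub>F n in sequentially. max 0 (min 1 (real n - norm x)) = 1"
          by (intro eventually_sequentiallyI[of m]) auto
      qed
      then have "(\<lambda>n. h n x) \<longlonglongrightarrow> of_real 1 * (\<psi> x / of_real (max 1 (norm (\<psi> x))))"
        unfolding h_def by (intro tendsto_intros lim that) auto
      then show ?thesis using psi1[of x] by (simp add: max_absorb1)
    qed
    then show "AE x in lborel. (\<lambda>n. h n x) \<longlonglongrightarrow> \<psi> x"
      using \<open>N' \<in> null_sets lborel\<close> \<open>N \<subseteq> N'\<close> by (intro AE_I'[of N']) auto
  qed (use psi1 h1 Ph hc in \<open>auto intro: borel_measurable_continuous_onI\<close>)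
qed

section \<open>Duality and Bernstein inequalities\<close>

lemma cnj_measurable [measurable]: "cnj \<in> borel_measurable borel"
  by (intro borel_measurable_continuous_onI continuous_intros)

text \<open>The extremal test function is the conjugate sign of \<open>v\<close>, which is only
  measurable; the bound reaches it from smooth multipliers along bounded limits, dominated by
  |v|.\<close>

lemma L1_duality:
  assumes v: "integrable lborel v"
    and C: "\<And>\<phi>. \<phi> \<in> multiplier \<Longrightarrow> (\<And>x. norm (\<phi> x) \<le> 1) \<Longrightarrow> norm (LINT x|lborel. v x * \<phi> x) \<le> C"
  shows "(LINT x|lborel. norm (v x)) \<le> C"
proof -
  note [measurable] = borel_measurable_integrable[OF v]
  let ?P = "\<lambda>\<phi>. norm (LINT x|lborel. v x * \<phi> x) \<le> C"
  have "?P (\<lambda>x. cnj (sgn (v x)))"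
  proof (rule bounded_limit_induct[where P="?P"])
    have "v \<in> borel_measurable borel" by measurable
    then show "(\<lambda>x. cnj (sgn (v x))) \<in> borel_measurable borel"
      unfolding sgn_div_norm by measurable
    show "norm (cnj (sgn (v x))) \<le> 1" for x by (simp add: norm_sgn)
    show "?P \<phi>" if "\<phi> \<in> multiplier" "\<And>x. norm (\<phi> x) \<le> 1" for \<phi> using C that by blast
    fix \<phi> \<psi>
    assume [measurable]: "\<And>n. \<phi> n \<in> borel_measurable borel" and 1: "\<And>n x. norm (\<phi> n x) \<le> 1"
      and P: "\<And>n. ?P (\<phi> n)" and [measurable]: "\<psi> \<in> borel_measurable borel"
      and lim: "AE x in lborel. (\<lambda>n. \<phi> n x) \<longlonglongrightarrow> \<psi> x"
    have "(\<lambda>n. LINT x|lborel. v x * \<phi> n x) \<longlonglongrightarrow> (LINT x|lborel. v x * \<psi> x)"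
    proof (rule integral_dominated_convergence[where w="\<lambda>x. norm (v x)"])
      show "AE x in lborel. (\<lambda>n. v x * \<phi> n x) \<longlonglongrightarrow> v x * \<psi> x"
        using lim by eventually_elim (intro tendsto_intros)
      show "AE x in lborel. norm (v x * \<phi> n x) \<le> norm (v x)" for n
        using 1 by (intro AE_I2) (simp add: norm_mult mult_left_le)
    qed (use v in auto)
    from tendsto_norm[OF this] show "?P \<psi>" by (rule LIMSEQ_le_const2) (use P in blast)
  qed
  moreover have "v x * cnj (sgn (v x)) = of_real (norm (v x))" for x
  proof (cases "v x = 0")
    case False
    have "v x * cnj (v x) = of_real (norm (v x)) * of_real (norm (v x))"
      by (simp add: complex_norm_square[symmetric] power2_eq_square)
    then show ?thesis using False by (simp add: sgn_div_norm scaleR_conv_of_real field_simps)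
  qed simp
  ultimately show ?thesis by simp
qed

text \<open>Testing with the conjugate of \<open>u\<close> would give X <= B sqrt X, but this
  function is neither Schwartz nor known to be square integrable. It is therefore cut off at height
  n + 1 and damped by a Gaussian, and Fatou's lemma removes both.\<close>

lemma L2_duality:
  assumes [measurable]: "u \<in> borel_measurable borel" and B0: "0 \<le> B"
    and i: "\<And>\<phi>. \<phi> \<in> schwartz \<Longrightarrow> integrable lborel (\<lambda>x. u x * \<phi> x)"
    and B: "\<And>\<phi>. \<phi> \<in> schwartz \<Longrightarrow> norm (LINT x|lborel. u x * \<phi> x) \<le> B * sqrt (LINT x|lborel. (norm (\<phi> x))\<^sup>2)"
  shows "integrable lborel (\<lambda>x. (norm (u x))\<^sup>2)" and "(LINT x|lborel. (norm (u x))\<^sup>2) \<le> B\<^sup>2"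
proof -
  define c where "c n = 1 / real (Suc n)" for n
  have c: "c n \<noteq> 0" for n by (simp add: c_def)
  have c0: "c \<longlonglongrightarrow> 0"
    unfolding c_def using LIMSEQ_inverse_real_of_nat by (simp add: inverse_eq_divide)
  define f where "f n x = (if norm (u x) \<le> real (Suc n) then (norm (u x))\<^sup>2 * gauss (c n *\<^sub>R x) else 0)" for n x
  have "integrable lborel (f n) \<and> integral\<^sup>L lborel (f n) \<le> B\<^sup>2" for n
  proof -
    define \<gamma> where "\<gamma> x = complex_of_real (gauss (c n *\<^sub>R x))" for x
    have \<gamma>: "\<gamma> \<in> schwartz" unfolding \<gamma>_def by (rule gauss_schwartz[OF c])
    note [measurable] = schwartz_measurable[OF \<gamma>]
    let ?K = "real (Suc n)"
    \<comment> \<open>The Gaussian sits inside the inequality, so that a multiplier times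
      \<open>\<gamma>\<close> is an admissible test function and both sides have dominating
      functions.\<close>
    let ?P = "\<lambda>\<phi>. norm (LINT x|lborel. (u x * \<gamma> x) * \<phi> x) \<le> B * sqrt (LINT x|lborel. (norm (\<gamma> x * \<phi> x))\<^sup>2)"
    \<comment> \<open>Division by \<open>?K\<close> brings the truncated conjugate into the unit
      disc, as \<open>bounded_limit_induct\<close> requires; it cancels when \<open>?X\<close> is
      isolated.\<close>
    define \<psi> where "\<psi> x = (if norm (u x) \<le> ?K then cnj (u x) / ?K else 0)" for x
    have [measurable]: "\<psi> \<in> borel_measurable borel" unfolding \<psi>_def by measurable
    have \<psi>1: "norm (\<psi> x) \<le> 1" for x by (simp add: \<psi>_def norm_divide del: of_nat_Suc)
    have P\<psi>: "?P \<psi>"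
    proof (rule bounded_limit_induct[where P="?P"])
      show "?P \<phi>" if "\<phi> \<in> multiplier" "\<And>x. norm (\<phi> x) \<le> 1" for \<phi>
        using B[OF schwartz_mult[OF that(1) \<gamma>]] by (simp add: ac_simps)
      fix \<phi> \<psi>
      assume [measurable]: "\<And>n. \<phi> n \<in> borel_measurable borel" and 1: "\<And>n x. norm (\<phi> n x) \<le> 1"
        and P: "\<And>n. ?P (\<phi> n)" and [measurable]: "\<psi> \<in> borel_measurable borel"
        and lim: "AE x in lborel. (\<lambda>n. \<phi> n x) \<longlonglongrightarrow> \<psi> x"
      have "(\<lambda>n. LINT x|lborel. (u x * \<gamma> x) * \<phi> n x) \<longlonglongrightarrow> (LINT x|lborel. (u x * \<gamma> x) * \<psi> x)"
      proof (rule integral_dominated_convergence[where w="\<lambda>x. norm (u x * \<gamma> x)"])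
        show "AE x in lborel. (\<lambda>n. u x * \<gamma> x * \<phi> n x) \<longlonglongrightarrow> u x * \<gamma> x * \<psi> x"
          using lim by eventually_elim (intro tendsto_intros)
        show "AE x in lborel. norm (u x * \<gamma> x * \<phi> n x) \<le> norm (u x * \<gamma> x)" for n
          using 1 by (intro AE_I2) (simp add: norm_mult mult_left_le)
      qed (use i[OF \<gamma>] in auto)
      then have l1: "(\<lambda>n. norm (LINT x|lborel. (u x * \<gamma> x) * \<phi> n x)) \<longlonglongrightarrow> norm (LINT x|lborel. (u x * \<gamma> x) * \<psi> x)"
        by (rule tendsto_norm)
      have "(\<lambda>n. LINT x|lborel. (norm (\<gamma> x * \<phi> n x))\<^sup>2) \<longlonglongrightarrow> (LINT x|lborel. (norm (\<gamma> x * \<psi> x))\<^sup>2)"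
      proof (rule integral_dominated_convergence[where w="\<lambda>x. (norm (\<gamma> x))\<^sup>2"])
        show "AE x in lborel. (\<lambda>n. (norm (\<gamma> x * \<phi> n x))\<^sup>2) \<longlonglongrightarrow> (norm (\<gamma> x * \<psi> x))\<^sup>2"
          using lim by eventually_elim (intro tendsto_intros)
        show "AE x in lborel. norm ((norm (\<gamma> x * \<phi> n x))\<^sup>2) \<le> (norm (\<gamma> x))\<^sup>2" for n
          using 1 by (intro AE_I2) (simp add: norm_mult mult_left_le power_mono)
      qed (use schwartz_integrable_sq[OF \<gamma>] in auto)
      then have l2: "(\<lambda>n. B * sqrt (LINT x|lborel. (norm (\<gamma> x * \<phi> n x))\<^sup>2)) \<longlonglongrightarrow> B * sqrt (LINT x|lborel. (norm (\<gamma> x * \<psi> x))\<^sup>2)"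
        by (intro tendsto_intros)
      show "?P \<psi>" by (rule LIMSEQ_le[OF l1 l2]) (use P in blast)
    qed (use \<psi>1 in auto)
    have fi: "integrable lborel (f n)"
    proof (rule Bochner_Integration.integrable_bound[OF integrable_mult_right[OF integrable_norm[OF i[OF \<gamma>]], of ?K]])
      show "AE x in lborel. norm (f n x) \<le> norm (?K * norm (u x * \<gamma> x))"
      proof (rule AE_I2)
        fix x
        have "norm (u x) * (norm (u x) * gauss (c n *\<^sub>R x)) \<le> ?K * (norm (u x) * gauss (c n *\<^sub>R x))"
          if "norm (u x) \<le> ?K"
          using that gauss_pos[of "c n *\<^sub>R x"] by (intro mult_right_mono) auto
        then show "norm (f n x) \<le> norm (?K * norm (u x * \<gamma> x))"
          using gauss_pos[of "c n *\<^sub>R x"]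
          by (auto simp: f_def \<gamma>_def norm_mult power2_eq_square abs_mult mult.assoc simp del: of_nat_Suc)
      qed
      show "f n \<in> borel_measurable lborel" unfolding f_def by measurable
    qed
    let ?X = "integral\<^sup>L lborel (f n)"
    have f0: "0 \<le> f n x" for x using gauss_pos by (simp add: f_def less_imp_le)
    have X0: "0 \<le> ?X" by (rule Bochner_Integration.integral_nonneg[OF f0])
    have "(u x * \<gamma> x) * \<psi> x = of_real (f n x / ?K)" for x
    proof (cases "norm (u x) \<le> ?K")
      case True
      then have "(u x * \<gamma> x) * \<psi> x = (u x * cnj (u x)) * \<gamma> x / ?K"
        by (simp add: \<psi>_def del: of_nat_Suc)
      then show ?thesis
        using True by (simp add: f_def \<gamma>_def flip: complex_norm_square del: of_nat_Suc)
    qed (simp add: \<psi>_def f_def)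
    then have e1: "norm (LINT x|lborel. (u x * \<gamma> x) * \<psi> x) = ?X / ?K"
      using X0 by (simp del: of_real_divide)
    have "(LINT x|lborel. (norm (\<gamma> x * \<psi> x))\<^sup>2) \<le> (LINT x|lborel. f n x / ?K\<^sup>2)"
    proof (rule integral_mono)
      have \<gamma>sq: "(gauss (c n *\<^sub>R x))\<^sup>2 \<le> gauss (c n *\<^sub>R x)" for x
        using gauss_pos[of "c n *\<^sub>R x"] gauss_le_1[of "c n *\<^sub>R x"] by (simp add: power2_eq_square mult_left_le)
      show le: "(norm (\<gamma> x * \<psi> x))\<^sup>2 \<le> f n x / ?K\<^sup>2" for x
      proof (cases "norm (u x) \<le> ?K")
        case True
        have "(norm (\<gamma> x * \<psi> x))\<^sup>2 = (norm (u x))\<^sup>2 * (gauss (c n *\<^sub>R x))\<^sup>2 / ?K\<^sup>2"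
          using True by (simp add: \<psi>_def \<gamma>_def norm_mult norm_divide power_mult_distrib power_divide del: of_nat_Suc)
        also have "\<dots> \<le> (norm (u x))\<^sup>2 * gauss (c n *\<^sub>R x) / ?K\<^sup>2"
          by (intro divide_right_mono mult_left_mono \<gamma>sq) auto
        finally show ?thesis using True by (simp add: f_def)
      qed (simp add: \<psi>_def f_def)
      show "integrable lborel (\<lambda>x. (norm (\<gamma> x * \<psi> x))\<^sup>2)"
        by (rule Bochner_Integration.integrable_bound[OF integrable_divide[OF fi, of "?K\<^sup>2"]])
           (use le f0 in \<open>auto intro: order_trans\<close>)
    qed (use fi in auto)
    then have "(LINT x|lborel. (norm (\<gamma> x * \<psi> x))\<^sup>2) \<le> ?X / ?K\<^sup>2" by simp
    then have "?X / ?K \<le> B * sqrt (?X / ?K\<^sup>2)"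
      using P\<psi> B0 unfolding e1 by (elim order_trans) (intro mult_left_mono real_sqrt_le_mono)
    then have "?X \<le> B * sqrt ?X"
      by (simp add: real_sqrt_divide divide_le_cancel split: if_splits)
    then have "sqrt ?X * sqrt ?X \<le> B * sqrt ?X" using X0 by simp
    then have "sqrt ?X \<le> B"
    proof (cases "?X = 0")
      case False
      then have "0 < sqrt ?X" using X0 by simp
      with \<open>sqrt ?X * sqrt ?X \<le> B * sqrt ?X\<close> show ?thesis by (rule mult_right_le_imp_le)
    qed (use B0 in simp)
    then have "(sqrt ?X)\<^sup>2 \<le> B\<^sup>2" using X0 by (intro power_mono) auto
    then show ?thesis using fi X0 by simp
  qed note F = this
  have lim: "(\<lambda>n. f n x) \<longlonglongrightarrow> (norm (u x))\<^sup>2" for x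
  proof -
    have "(\<lambda>n. gauss (c n *\<^sub>R x)) \<longlonglongrightarrow> gauss (0 *\<^sub>R x)"
      unfolding gauss_def by (intro tendsto_intros c0) auto
    then have 1: "(\<lambda>n. (norm (u x))\<^sup>2 * gauss (c n *\<^sub>R x)) \<longlonglongrightarrow> (norm (u x))\<^sup>2 * gauss (0 *\<^sub>R x)"
      by (intro tendsto_intros)
    obtain m where "norm (u x) \<le> real m" using real_arch_simple by blast
    then have "\<forall>\<^sub>F n in sequentially. (norm (u x))\<^sup>2 * gauss (c n *\<^sub>R x) = f n x"
      by (intro eventually_sequentiallyI[of m]) (auto simp: f_def)
    from Lim_transform_eventually[OF 1 this] show ?thesis by (simp add: gauss_def)
  qed
  have f0: "0 \<le> f n x" for n x using gauss_pos by (simp add: f_def less_imp_le)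
  show "integrable lborel (\<lambda>x. (norm (u x))\<^sup>2)" "(LINT x|lborel. (norm (u x))\<^sup>2) \<le> B\<^sup>2"
    using Fatou_bound[of lborel f "B\<^sup>2" "\<lambda>x. (norm (u x))\<^sup>2"] F f0 lim by auto
qed

text \<open>Where \<open>n \<le> l\<close> use \<open>n\<^sup>2 \<le> l\<^sup>2\<^sup>-\<^sup>p n\<^sup>p\<close> and AM-GM with weight \<open>c\<close>, elsewhere \<open>n \<le> l\<^sup>1\<^sup>-\<^sup>p n\<^sup>p\<close> and the bound
  on \<open>h\<close>; the values of \<open>l\<close> and \<open>c\<close> balance the three terms.\<close>

lemma Bernstein_test:
  fixes f h :: "real^2 \<Rightarrow> complex"
  assumes p: "1 \<le> p" "p \<le> 2" and pos: "0 < a" "0 < s" "0 < N"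
    and fh: "integrable lborel (\<lambda>x. f x * h x)"
    and fn: "\<And>x. norm (f x) \<le> n x" and ni: "integrable lborel (\<lambda>x. n x powr p)" and nN: "(LINT x|lborel. n x powr p) \<le> N powr p"
    and h1: "\<And>x. norm (h x) \<le> s * a" and hi: "integrable lborel (\<lambda>x. (norm (h x))\<^sup>2)"
    and h2: "(LINT x|lborel. (norm (h x))\<^sup>2) \<le> s\<^sup>2"
  shows "norm (LINT x|lborel. f x * h x) \<le> 2 * s * a powr (2 / p - 1) * N"
proof -
  \<comment> \<open>The exponent of Bernstein's loss from L^p to L^2 at frequency scale
    \<open>a\<close> in dimension two.\<close>
  define e where "e = 2 / p - 1"
  define l where "l = a powr (2 / p) * N"
  define c where "c = s / (a powr e * N)"
  have l: "0 < l" and c: "0 < c" using pos by (auto simp: l_def c_def)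
  have p2: "e = (2 - p) / p" using p by (simp add: e_def field_simps)
  have pt: "norm (f x * h x) \<le> (c / 2 * l powr (2 - p) + l powr (1 - p) * (s * a)) * n x powr p + 1 / (2 * c) * (norm (h x))\<^sup>2" for x
  proof -
    have n0: "0 \<le> n x" using fn[of x] norm_ge_zero order_trans by blast
    have "norm (f x * h x) \<le> n x * norm (h x)"
      unfolding norm_mult by (intro mult_right_mono fn) auto
    also have "\<dots> \<le> (c / 2 * l powr (2 - p) + l powr (1 - p) * (s * a)) * n x powr p + 1 / (2 * c) * (norm (h x))\<^sup>2"
    proof (cases "n x \<le> l")
      case True
      have "(n x)\<^sup>2 \<le> l powr (2 - p) * n x powr p"
      proof (cases "n x = 0")
        case False
        then have "(n x)\<^sup>2 = n x powr (2 - p) * n x powr p"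
          using n0 by (simp flip: powr_add)
        also have "\<dots> \<le> l powr (2 - p) * n x powr p"
          using True n0 p by (intro mult_right_mono powr_mono2) auto
        finally show ?thesis .
      qed simp
      then have 1: "c / 2 * (n x)\<^sup>2 \<le> c / 2 * (l powr (2 - p) * n x powr p)"
        using c by (intro mult_left_mono) auto
      have "0 \<le> (c * n x - norm (h x))\<^sup>2 / (2 * c)" using c by simp
      also have "\<dots> = c / 2 * (n x)\<^sup>2 + 1 / (2 * c) * (norm (h x))\<^sup>2 - n x * norm (h x)"
        using c by (simp add: power2_eq_square field_simps)
      finally have 2: "n x * norm (h x) \<le> c / 2 * (n x)\<^sup>2 + 1 / (2 * c) * (norm (h x))\<^sup>2" by simp
      have 3: "0 \<le> l powr (1 - p) * (s * a) * n x powr p" using pos by simp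
      show ?thesis using 1 2 3 by (simp add: algebra_simps)
    next
      case False
      then have n: "0 < n x" using l by linarith
      have "n x = n x powr (1 - p) * n x powr p" using n by (simp flip: powr_add)
      also have "\<dots> \<le> l powr (1 - p) * n x powr p"
        using False l p by (intro mult_right_mono powr_mono2') auto
      finally have "n x * norm (h x) \<le> (l powr (1 - p) * n x powr p) * (s * a)"
        using n by (intro mult_mono h1) auto
      moreover have "0 \<le> c / 2 * l powr (2 - p) * n x powr p + 1 / (2 * c) * (norm (h x))\<^sup>2" using c by simp
      ultimately show ?thesis by (simp add: algebra_simps)
    qed
    finally show ?thesis .
  qed
  let ?k = "c / 2 * l powr (2 - p) + l powr (1 - p) * (s * a)"
  have k0: "0 \<le> ?k" using c l pos by simp
  have "norm (LINT x|lborel. f x * h x) \<le> (LINT x|lborel. ?k * n x powr p + 1 / (2 * c) * (norm (h x))\<^sup>2)"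
    by (rule Bochner_Integration.integral_norm_bound_integral[OF fh _ pt])
       (intro Bochner_Integration.integrable_add integrable_mult_right ni hi)
  also have "\<dots> = ?k * (LINT x|lborel. n x powr p) + 1 / (2 * c) * (LINT x|lborel. (norm (h x))\<^sup>2)"
    by (subst Bochner_Integration.integral_add[OF integrable_mult_right[OF ni] integrable_mult_right[OF hi]]) simp
  also have "\<dots> \<le> ?k * N powr p + 1 / (2 * c) * s\<^sup>2"
    using c by (intro add_mono mult_left_mono nN h2 k0) auto
  also have "\<dots> = 2 * s * a powr e * N"
  proof -
    have A: "l powr (2 - p) * N powr p = (a powr e)\<^sup>2 * N\<^sup>2"
    proof -
      have "l powr (2 - p) * N powr p = a powr (2 / p * (2 - p)) * (N powr (2 - p) * N powr p)"
        using pos by (simp add: l_def powr_mult powr_powr)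
      also have "N powr (2 - p) * N powr p = N\<^sup>2"
        using pos by (simp add: powr_numeral flip: powr_add)
      also have "a powr (2 / p * (2 - p)) = (a powr e)\<^sup>2"
      proof -
        have "2 / p * (2 - p) = e + e" using p by (simp add: e_def field_simps)
        then show ?thesis by (simp only: powr_add power2_eq_square)
      qed
      finally show ?thesis .
    qed
    have B: "l powr (1 - p) * a * N powr p = a powr e * N"
    proof -
      have "l powr (1 - p) * a * N powr p = (a powr (2 / p * (1 - p)) * a powr 1) * (N powr (1 - p) * N powr p)"
        using pos by (simp add: l_def powr_mult powr_powr)
      also have "N powr (1 - p) * N powr p = N"
        using pos by (simp flip: powr_add)
      also have "a powr (2 / p * (1 - p)) * a powr 1 = a powr e"
        unfolding powr_add[symmetric] using p by (simp add: e_def field_simps)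
      finally show ?thesis .
    qed
    have "?k * N powr p + 1 / (2 * c) * s\<^sup>2 = c / 2 * (l powr (2 - p) * N powr p) + s * (l powr (1 - p) * a * N powr p) + s\<^sup>2 / (2 * c)"
      by (simp add: algebra_simps)
    also have "\<dots> = 2 * s * a powr e * N"
      unfolding A B using pos by (simp add: c_def field_simps power2_eq_square)
    finally show ?thesis .
  qed
  finally show ?thesis by (simp add: e_def)
qed

section \<open>Littlewood-Paley blocks and Besov norms\<close>

lemma ennreal_powr_1: "ennreal_powr x 1 = x"
  by (cases x) (auto simp: ennreal_powr_def)

lemma Lp_norm_1: "Lp_norm M 1 g = (\<integral>\<^sup>+x. g x \<partial>M)"
  by (simp add: Lp_norm_def ennreal_powr_1)

lemma Lp_norm_less:
  fixes n :: "'a \<Rightarrow> real"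
  assumes p: "1 \<le> p" and n0: "\<And>x. 0 \<le> n x" and [measurable]: "n \<in> borel_measurable M"
    and N: "Lp_norm M (ennreal p) (\<lambda>x. ennreal (n x)) < ennreal N"
  shows "integrable M (\<lambda>x. n x powr p)" "(LINT x|M. n x powr p) \<le> N powr p"
proof -
  let ?I = "\<integral>\<^sup>+x. ennreal (n x powr p) \<partial>M"
  have "ennreal_powr (ennreal (n x)) p = ennreal (n x powr p)" for x
    using n0[of x] by (simp add: ennreal_powr_def)
  then have L: "Lp_norm M (ennreal p) (\<lambda>x. ennreal (n x)) = ennreal_powr ?I (1 / p)"
    using p by (simp add: Lp_norm_def)
  have fin: "?I < \<infinity>"
    using N unfolding L ennreal_powr_def by (auto simp: less_top[symmetric] split: if_splits)
  show i: "integrable M (\<lambda>x. n x powr p)"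
    using fin by (intro integrableI_nonneg) auto
  let ?J = "LINT x|M. n x powr p"
  have J: "?I = ennreal ?J" using i by (intro nn_integral_eq_integral) auto
  have J0: "0 \<le> ?J" by simp
  have "ennreal (?J powr (1 / p)) < ennreal N"
    using N unfolding L J ennreal_powr_def using J0 by simp
  then have "?J powr (1 / p) \<le> N" by (simp add: ennreal_less_iff)
  then have "(?J powr (1 / p)) powr p \<le> N powr p" using p by (intro powr_mono2) auto
  then show "?J \<le> N powr p" using p J0 by (simp add: powr_powr)
qed

text \<open>Bernstein's inequality in dual form: \<open>h\<close> carries the localisation, with L^2
  norm \<open>s\<close> and sup norm \<open>s * a\<close> as for frequencies of size
  \<open>a\<close>. The slack \<open>t\<close> selects a representative near the infimum and keeps
  the constants positive; afterwards it tends to 0.\<close>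

lemma Lp_norm_dist_test:
  assumes p: "1 \<le> p" "p \<le> 2" and a: "0 < a" and s: "0 \<le> s"
    and fin: "Lp_norm_dist (ennreal p) T < \<infinity>"
    and h: "h \<in> schwartz" and h1: "\<And>x. norm (h x) \<le> s * a" and h2: "(LINT x|lborel. (norm (h x))\<^sup>2) \<le> s\<^sup>2"
  shows "norm ((T $ i) h) \<le> 2 * s * a powr (2 / p - 1) * enn2real (Lp_norm_dist (ennreal p) T)"
proof -
  let ?B = "enn2real (Lp_norm_dist (ennreal p) T)"
  have *: "norm ((T $ i) h) \<le> 2 * (s + t) * a powr (2 / p - 1) * (?B + t)" if t: "0 < t" for t
  proof -
    have "Lp_norm_dist (ennreal p) T = ennreal ?B" using fin by simp
    also have "\<dots> < ennreal (?B + t)" using t by (simp add: ennreal_less_iff)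
    finally obtain f :: "real^2 \<Rightarrow> complex^2" where f: "\<And>i. represents (\<lambda>x. f x $ i) (T $ i)"
      and N: "Lp_norm lborel (ennreal p) (\<lambda>x. ennreal (norm (f x))) < ennreal (?B + t)"
      unfolding Lp_norm_dist_def INF_less_iff by blast
    have [measurable]: "(\<lambda>x. f x $ i) \<in> borel_measurable borel" for i
      using f[of i] unfolding represents_def by simp
    have [measurable]: "(\<lambda>x. norm (f x)) \<in> borel_measurable borel"
      unfolding norm_vec_def L2_set_def by measurable
    note N' = Lp_norm_less[OF p(1) norm_ge_zero _ N]
    have "norm (LINT x|lborel. f x $ i * h x) \<le> 2 * (s + t) * a powr (2 / p - 1) * (?B + t)"
    proof (rule Bernstein_test[OF p a])
      show "0 < s + t" using s t by simp
      show "0 < ?B + t" using t by (simp add: add_nonneg_pos)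
      show "integrable lborel (\<lambda>x. f x $ i * h x)"
        using f[of i] h unfolding represents_def by blast
      show "norm (f x $ i) \<le> norm (f x)" for x by (rule Finite_Cartesian_Product.norm_nth_le)
      show "integrable lborel (\<lambda>x. norm (f x) powr p)" "(LINT x|lborel. norm (f x) powr p) \<le> (?B + t) powr p"
        using N' by auto
      show "norm (h x) \<le> (s + t) * a" for x
        using h1[of x] a t by (simp add: algebra_simps) (smt (verit) mult_pos_pos)
      show "integrable lborel (\<lambda>x. (norm (h x))\<^sup>2)" by (rule schwartz_integrable_sq[OF h])
      have "s\<^sup>2 \<le> (s + t)\<^sup>2" using s t by (intro power_mono) auto
      then show "(LINT x|lborel. (norm (h x))\<^sup>2) \<le> (s + t)\<^sup>2" using h2 by linarith
    qed
    then show ?thesis using f[of i] h unfolding represents_def on_schwartz_def by simp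
  qed
  have "(\<lambda>n. 2 * (s + 1 / real (Suc n)) * a powr (2 / p - 1) * (?B + 1 / real (Suc n))) \<longlonglongrightarrow> 2 * (s + 0) * a powr (2 / p - 1) * (?B + 0)"
    using LIMSEQ_inverse_real_of_nat by (intro tendsto_intros) (simp_all add: inverse_eq_divide)
  then have "norm ((T $ i) h) \<le> 2 * (s + 0) * a powr (2 / p - 1) * (?B + 0)"
    by (rule LIMSEQ_le_const) (intro exI allI impI *, simp)
  then show ?thesis by simp
qed

lemma measure_square:
  assumes r: "0 < r" shows "measure lborel (cbox (\<chi> i. - r) (\<chi> i. r) :: (real^2) set) = (2 * r)\<^sup>2"
proof -
  have "\<forall>b\<in>Basis. ((\<chi> i. - r) :: real^2) \<bullet> b \<le> (\<chi> i. r) \<bullet> b"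
    using r by (auto simp: Basis_vec_def inner_axis)
  then show ?thesis
    by (simp add: measure_lborel_cbox_eq prod_Basis_2 inner_axis inner_diff_left power2_eq_square)
qed

lemma mem_squareI: "norm (x :: real^2) \<le> r \<Longrightarrow> x \<in> cbox (\<chi> i. - r) (\<chi> i. r)"
proof -
  assume "norm x \<le> r"
  then have "\<bar>x $ i\<bar> \<le> r" for i using component_le_norm_cart[of x i] by linarith
  then show ?thesis by (simp add: mem_box_cart abs_le_iff minus_le_iff)
qed

text \<open>Cauchy-Schwarz on a square of area (2 r)^2 around the support. The weight
  \<open>c = 2 * r / t\<close> is optimal in the elementary inequality, and \<open>t > s\<close>
  keeps it finite when \<open>s = 0\<close>.\<close>

lemma integral_localized_le:
  assumes g: "integrable lborel (\<lambda>x::real^2. (norm (g x))\<^sup>2)" "integrable lborel g" and r: "0 < r" and s: "0 \<le> s"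
    and g0: "\<And>x. r < norm x \<Longrightarrow> g x = 0" and gs: "(LINT x|lborel. (norm (g x))\<^sup>2) \<le> s\<^sup>2"
  shows "(LINT x|lborel. norm (g x :: complex)) \<le> 2 * r * s"
proof -
  let ?Q = "cbox (\<chi> i. - r) (\<chi> i. r) :: (real^2) set"
  note vol = measure_square[OF r]
  have iQ: "integrable lborel (indicator ?Q :: real^2 \<Rightarrow> real)"
    using emeasure_lborel_cbox_finite by (simp add: integrable_indicator_iff)
  have *: "(LINT x|lborel. norm (g x)) \<le> 2 * r * t" if t: "s < t" for t
  proof -
    define c where "c = 2 * r / t"
    have c: "0 < c" "0 < t" using r t s by (auto simp: c_def)
    have "(LINT x|lborel. norm (g x)) \<le> (LINT x|lborel. c / 2 * (norm (g x))\<^sup>2 + 1 / (2 * c) * indicator ?Q x)"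
    proof (rule integral_mono)
      fix x
      show "norm (g x) \<le> c / 2 * (norm (g x))\<^sup>2 + 1 / (2 * c) * indicator ?Q x"
      proof (cases "g x = 0")
        case False
        then have "norm x \<le> r" using g0 not_less by blast
        then have "x \<in> ?Q" by (rule mem_squareI)
        have "0 \<le> (c * norm (g x) - 1)\<^sup>2 / (2 * c)" using c by simp
        also have "\<dots> = c / 2 * (norm (g x))\<^sup>2 + 1 / (2 * c) - norm (g x)"
          using c by (simp add: power2_eq_square field_simps)
        finally show ?thesis using \<open>x \<in> ?Q\<close> by simp
      qed (use c in \<open>simp add: indicator_def\<close>)
    qed (use g iQ in auto)
    also have "\<dots> = c / 2 * (LINT x|lborel. (norm (g x))\<^sup>2) + 1 / (2 * c) * measure lborel ?Q"
      using g iQ by simp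
    also have "\<dots> \<le> c / 2 * t\<^sup>2 + 1 / (2 * c) * (2 * r)\<^sup>2"
    proof -
      have "s\<^sup>2 \<le> t\<^sup>2" using s t by (intro power_mono) auto
      then have "(LINT x|lborel. (norm (g x))\<^sup>2) \<le> t\<^sup>2" using gs by linarith
      then show ?thesis unfolding vol using c by (intro add_right_mono mult_left_mono) auto
    qed
    also have "\<dots> = 2 * r * t" using c r by (simp add: c_def field_simps power2_eq_square)
    finally show ?thesis .
  qed
  show ?thesis
  proof (rule field_le_epsilon)
    fix e :: real assume "0 < e"
    moreover have "2 * r * (s + e / (2 * r)) = 2 * r * s + e" using r by (simp add: field_simps)
    ultimately show "(LINT x|lborel. norm (g x)) \<le> 2 * r * s + e"
      using *[of "s + e / (2 * r)"] r by simp
  qed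
qed

section \<open>The dyadic partition of unity\<close>

locale littlewood_paley_family =
  fixes \<Phi> :: "int \<Rightarrow> real^2 \<Rightarrow> complex"
  assumes LP: "littlewood_paley \<Phi>"
begin

abbreviation m :: "int \<Rightarrow> real^2 \<Rightarrow> complex" where "m j \<equiv> fourier (\<Phi> j)"

definition \<mu> :: "int \<Rightarrow> real^2 \<Rightarrow> real" where "\<mu> j \<xi> = Re (m j \<xi>)"

lemma m_schwartz: "m j \<in> schwartz"
proof -
  have "\<Phi> j \<in> schwartz" using LP unfolding littlewood_paley_def by blast
  then show ?thesis by (rule fourier_schwartz)
qed

lemma m_scale: "m j \<xi> = m 0 ((2 powr (- real_of_int j)) *\<^sub>R \<xi>)"
  using LP unfolding littlewood_paley_def by blast

lemma m_0: "m 0 \<xi> \<in> \<real>" "0 \<le> Re (m 0 \<xi>)" "Re (m 0 \<xi>) \<le> 1"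
  using LP unfolding littlewood_paley_def by blast+

lemma m_eq: "m j \<xi> = of_real (\<mu> j \<xi>)"
  using m_0(1)[of "(2 powr (- real_of_int j)) *\<^sub>R \<xi>"] unfolding \<mu>_def m_scale[of j] by simp

lemma \<mu>_bounds: "0 \<le> \<mu> j \<xi>" "\<mu> j \<xi> \<le> 1"
  unfolding \<mu>_def m_scale[of j] using m_0 by auto

lemma m_support:
  assumes "m j \<xi> \<noteq> 0"
  shows "2 powr (real_of_int j - 1) \<le> norm \<xi>" "norm \<xi> \<le> 2 powr (real_of_int j + 1)"
proof -
  let ?\<eta> = "(2 powr (- real_of_int j)) *\<^sub>R \<xi>"
  have "?\<eta> \<in> closure {\<xi>. m 0 \<xi> \<noteq> 0}"
    by (rule subsetD[OF closure_subset]) (use assms m_scale[of j \<xi>] in simp)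
  also have "\<dots> \<subseteq> {\<xi>. 1 / 2 \<le> norm \<xi> \<and> norm \<xi> \<le> 2}"
    using LP unfolding littlewood_paley_def by (elim conjE)
  finally have "1 / 2 \<le> 2 powr (- real_of_int j) * norm \<xi>" "2 powr (- real_of_int j) * norm \<xi> \<le> 2"
    by auto
  moreover have "0 < 2 powr real_of_int j" by simp
  ultimately have "2 powr real_of_int j / 2 \<le> norm \<xi>" "norm \<xi> \<le> 2 powr real_of_int j * 2"
    unfolding powr_minus by (simp_all add: field_simps)
  then show "2 powr (real_of_int j - 1) \<le> norm \<xi>" "norm \<xi> \<le> 2 powr (real_of_int j + 1)"
    unfolding powr_diff powr_add by simp_all
qed

lemma m_sum:
  assumes "\<xi> \<noteq> 0" shows "((\<lambda>j. m j \<xi>) has_sum 1) UNIV"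
  using LP assms unfolding littlewood_paley_def by blast

lemma \<mu>_sum:
  assumes "\<xi> \<noteq> 0" shows "((\<lambda>j. \<mu> j \<xi>) has_sum 1) UNIV"
  using has_sum_Re[OF m_sum[OF assms]] by (simp add: \<mu>_def)

text \<open>Only closed annuli are compared, and annuli two indices apart still share a circle,
  which is why the bound is 2.\<close>

lemma m_disjoint:
  assumes "m j \<xi> \<noteq> 0" "m k \<xi> \<noteq> 0" shows "\<bar>j - k\<bar> \<le> 2"
proof -
  have "2 powr (real_of_int j - 1) \<le> 2 powr (real_of_int k + 1)" "2 powr (real_of_int k - 1) \<le> 2 powr (real_of_int j + 1)"
    using m_support[OF assms(1)] m_support[OF assms(2)] by linarith+
  then show ?thesis by simp
qed

text \<open>Finite partial sums of the partition of unity, taking the place of sharp frequency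
  cutoffs because they stay Schwartz.\<close>

definition window :: "int set \<Rightarrow> real^2 \<Rightarrow> complex" where "window J \<xi> = (\<Sum>j\<in>J. m j \<xi>)"

lemma window_schwartz: "window J \<in> schwartz"
  unfolding window_def by (intro schwartz_sum m_schwartz)

lemma window_eq: "window J \<xi> = of_real (\<Sum>j\<in>J. \<mu> j \<xi>)"
  by (simp add: window_def m_eq)

lemma m_at_0: "m j 0 = 0"
  using m_support(1)[of j 0] by (cases "m j 0 = 0") auto

lemma window_bounds:
  assumes "finite J" shows "0 \<le> (\<Sum>j\<in>J. \<mu> j \<xi>)" "(\<Sum>j\<in>J. \<mu> j \<xi>) \<le> 1"
proof -
  show "0 \<le> (\<Sum>j\<in>J. \<mu> j \<xi>)" by (intro sum_nonneg \<mu>_bounds)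
  show "(\<Sum>j\<in>J. \<mu> j \<xi>) \<le> 1"
  proof (cases "\<xi> = 0")
    case True then show ?thesis by (simp add: \<mu>_def m_at_0)
  next
    case False
    have "(\<Sum>j\<in>J. \<mu> j \<xi>) \<le> infsum (\<lambda>j. \<mu> j \<xi>) UNIV"
      using \<mu>_sum[OF False] assms \<mu>_bounds by (intro finite_sum_le_infsum) (auto simp: summable_on_def)
    then show ?thesis using \<mu>_sum[OF False] by (simp add: infsumI)
  qed
qed

lemma norm_window: "finite J \<Longrightarrow> norm (window J \<xi>) \<le> 1"
  using window_bounds[of J \<xi>] unfolding window_eq norm_of_real by simp

lemma window_eq_1:
  assumes "finite J" "\<xi> \<noteq> 0" "\<And>k. k \<notin> J \<Longrightarrow> m k \<xi> = 0"
  shows "window J \<xi> = 1"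
proof -
  have "((\<lambda>j. m j \<xi>) has_sum (\<Sum>j\<in>J. m j \<xi>)) UNIV"
    using assms by (intro has_sum_finite_neutralI) auto
  then show ?thesis using m_sum[OF assms(2)] has_sum_unique unfolding window_def by blast
qed

text \<open>The enlarged block, equal to 1 wherever \<open>m j\<close> is nonzero: inserting it
  localises a test function to an annulus without changing the pairing with block j. Two neighbours
  on each side match \<open>m_disjoint\<close>.\<close>

abbreviation fat :: "int \<Rightarrow> real^2 \<Rightarrow> complex" where "fat j \<equiv> window {j-2..j+2}"

lemma fat_m: "m j \<xi> * fat j \<xi> = m j \<xi>"
proof (cases "m j \<xi> = 0")
  case False
  have "fat j \<xi> = 1"
  proof (rule window_eq_1)
    show "\<xi> \<noteq> 0" using False m_at_0 by auto
    show "m k \<xi> = 0" if "k \<notin> {j-2..j+2}" for k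
          proof (rule ccontr)
      assume "m k \<xi> \<noteq> 0"
      from m_disjoint[OF False this] that show False by auto
    qed
  qed simp
  then show ?thesis by simp
qed simp

lemma fat_support:
  assumes "fat j \<xi> \<noteq> 0"
  shows "2 powr (real_of_int j - 3) \<le> norm \<xi>" "norm \<xi> \<le> 2 powr (real_of_int j + 3)"
proof -
  from assms obtain k where k: "k \<in> {j-2..j+2}" "m k \<xi> \<noteq> 0"
    unfolding window_def by (meson sum.neutral)
  have "2 powr (real_of_int j - 3) \<le> 2 powr (real_of_int k - 1)" "2 powr (real_of_int k + 1) \<le> 2 powr (real_of_int j + 3)"
    using k(1) by auto
  with m_support[OF k(2)] show "2 powr (real_of_int j - 3) \<le> norm \<xi>" "norm \<xi> \<le> 2 powr (real_of_int j + 3)"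
    by linarith+
qed

text \<open>Once test functions are written as transforms \<open>fourier \<theta>\<close>, a Fourier
  multiplier simply acts on \<theta> by multiplication.\<close>

lemma lp_block_fourier:
  assumes "\<theta> \<in> schwartz"
  shows "lp_block \<Phi> j T (fourier \<theta>) = T (fourier (\<lambda>\<xi>. m j \<xi> * \<theta> \<xi>))"
proof -
  have "(\<lambda>\<xi>. m j \<xi> * \<theta> \<xi>) \<in> schwartz"
    by (intro schwartz_mult schwartz_multiplier m_schwartz assms)
  then show ?thesis
    using assms by (simp add: lp_block_def inv_fourier_dist_def mult_dist_def fourier_dist_def on_schwartz_def
        fourier_schwartz inv_fourier_fourier)
qed

section \<open>Testing Besov functions block by block\<close>

lemma besov_norm_eq:
  "besov_norm \<Phi> q 1 s F = (\<integral>\<^sup>+j. ennreal (2 powr (s * real_of_int j)) * Lp_norm_dist q (\<chi> i. lp_block \<Phi> j (F $ i)) \<partial>count_space UNIV)"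
  by (simp add: besov_norm_def Lp_norm_1)

lemma besov_test_block:
  assumes p: "1 \<le> p" "p \<le> 2" and fin: "Lp_norm_dist (ennreal p) (\<chi> i. lp_block \<Phi> j (F $ i)) < \<infinity>"
    and \<theta>: "\<theta> \<in> schwartz" and s: "0 \<le> s" and \<theta>s: "(LINT \<xi>|lborel. (norm (fat j \<xi> * \<theta> \<xi>))\<^sup>2) \<le> s\<^sup>2"
  shows "norm ((F $ i) (fourier (\<lambda>\<xi>. m j \<xi> * \<theta> \<xi>))) \<le>
    64 * pi * s * (2 powr ((2 / p - 1) * real_of_int j) * enn2real (Lp_norm_dist (ennreal p) (\<chi> i. lp_block \<Phi> j (F $ i))))"
proof -
  let ?B = "enn2real (Lp_norm_dist (ennreal p) (\<chi> i. lp_block \<Phi> j (F $ i)))"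
  let ?g = "\<lambda>\<xi>. fat j \<xi> * \<theta> \<xi>"
  let ?h = "fourier ?g"
  have g: "?g \<in> schwartz" by (intro schwartz_mult schwartz_multiplier window_schwartz \<theta>)
  have h: "?h \<in> schwartz" by (rule fourier_schwartz[OF g])
  have "(F $ i) (fourier (\<lambda>\<xi>. m j \<xi> * \<theta> \<xi>)) = (F $ i) (fourier (\<lambda>\<xi>. m j \<xi> * ?g \<xi>))"
    by (simp add: fat_m flip: mult.assoc)
  also have "\<dots> = ((\<chi> i. lp_block \<Phi> j (F $ i)) $ i) ?h"
    by (simp add: lp_block_fourier[OF g])
  \<comment> \<open>Plancherel bounds the L^2 norm of \<open>?h\<close> by 2 pi s. Its sup norm is
    at most the L^1 norm of \<open>?g\<close>, hence 16 s 2^j by localisation to radius 2^(j+3),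
    enlarged by 2 pi to fit the same scale. Since 16 is raised to a power at most 1, the final
    constant is 2 * 2 pi * 16.\<close>
  also have "norm \<dots> \<le> 2 * (2 * pi * s) * (16 * 2 powr real_of_int j) powr (2 / p - 1) * ?B"
  proof (rule Lp_norm_dist_test[OF p _ _ fin h])
    show "(LINT x|lborel. (norm (?h x))\<^sup>2) \<le> (2 * pi * s)\<^sup>2"
      unfolding plancherel[OF g] power_mult_distrib[of "2 * pi"] by (intro mult_left_mono \<theta>s) auto
    have "(LINT \<xi>|lborel. norm (?g \<xi>)) \<le> 2 * 2 powr (real_of_int j + 3) * s"
    proof (rule integral_localized_le[OF schwartz_integrable_sq[OF g] schwartz_integrable[OF g] _ s _ \<theta>s])
      show "?g \<xi> = 0" if "2 powr (real_of_int j + 3) < norm \<xi>" for \<xi>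
        using fat_support(2)[of j \<xi>] that by auto
    qed auto
    also have "\<dots> = 1 * s * (16 * 2 powr real_of_int j)" by (simp add: powr_add)
    also have "\<dots> \<le> (2 * pi) * s * (16 * 2 powr real_of_int j)"
      using s pi_gt3 by (intro mult_right_mono) auto
    finally show "norm (?h x) \<le> 2 * pi * s * (16 * 2 powr real_of_int j)" for x
      using norm_fourier_le[of ?g x] by linarith
  qed (use s in auto)
  also have "\<dots> \<le> 64 * pi * s * (2 powr ((2 / p - 1) * real_of_int j) * ?B)"
  proof -
    have e: "0 \<le> 2 / p - 1" "2 / p - 1 \<le> 1" using p by (auto simp: field_simps)
    have "(16 * 2 powr real_of_int j) powr (2 / p - 1) = 16 powr (2 / p - 1) * 2 powr ((2 / p - 1) * real_of_int j)"
      by (simp add: powr_mult powr_powr mult.commute)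
    also have "\<dots> \<le> 16 powr 1 * 2 powr ((2 / p - 1) * real_of_int j)"
      using e by (intro mult_right_mono powr_mono) auto
    finally have "4 * pi * s * ?B * (16 * 2 powr real_of_int j) powr (2 / p - 1) \<le> 4 * pi * s * ?B * (16 * 2 powr ((2 / p - 1) * real_of_int j))"
      using s by (intro mult_left_mono) auto
    then show ?thesis by (simp add: algebra_simps)
  qed
  finally show ?thesis .
qed

text \<open>The norm of a solution is exploited through \<open>\<beta>\<close>: one summable
  sequence, with the norm as its sum, that bounds the blocks of both components in L^2 duality. Its
  weight 2^((2/p - 1) j) is exactly Bernstein's loss, so p is gone from the estimate.\<close>

lemma besov_test:
  assumes p: "1 \<le> p" "p \<le> 2" and F: "F \<in> besov \<Phi> (ennreal p) 1 (2 / p - 1)"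
  obtains \<beta> :: "int \<Rightarrow> real" where "\<And>j. 0 \<le> \<beta> j"
    and "(\<beta> has_sum enn2real (besov_norm \<Phi> (ennreal p) 1 (2 / p - 1) F)) UNIV"
    and "\<And>i j \<theta> s. \<theta> \<in> schwartz \<Longrightarrow> 0 \<le> s \<Longrightarrow> (LINT \<xi>|lborel. (norm (fat j \<xi> * \<theta> \<xi>))\<^sup>2) \<le> s\<^sup>2 \<Longrightarrow>
        norm ((F $ i) (fourier (\<lambda>\<xi>. m j \<xi> * \<theta> \<xi>))) \<le> 64 * pi * s * \<beta> j"
proof -
  let ?L = "\<lambda>j. Lp_norm_dist (ennreal p) (\<chi> i. lp_block \<Phi> j (F $ i))"
  let ?w = "\<lambda>j. 2 powr ((2 / p - 1) * real_of_int j)"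
  define \<beta> where "\<beta> j = ?w j * enn2real (?L j)" for j
  let ?n = "besov_norm \<Phi> (ennreal p) 1 (2 / p - 1) F"
  have fin: "?n < \<infinity>" using F unfolding besov_def by blast
  have "ennreal (?w j) * ?L j \<noteq> \<infinity>" for j
  proof
    assume "ennreal (?w j) * ?L j = \<infinity>"
    moreover have "ennreal (?w j) * ?L j \<le> ?n"
      unfolding besov_norm_eq by (rule nn_integral_ge_point) auto
    ultimately show False using fin by (simp add: top_unique)
  qed
  then have Lf: "?L j < \<infinity>" for j
    by (auto simp: ennreal_mult_eq_top_iff less_top[symmetric])
  have \<beta>0: "0 \<le> \<beta> j" for j by (simp add: \<beta>_def)
  have "ennreal (?w j) * ?L j = ennreal (\<beta> j)" for j
    using Lf[of j] by (simp add: \<beta>_def ennreal_mult)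
  then have n: "?n = (\<integral>\<^sup>+j. ennreal (\<beta> j) \<partial>count_space UNIV)"
    unfolding besov_norm_eq by simp
  have "integrable (count_space UNIV) \<beta>"
    using fin \<beta>0 unfolding n by (intro integrableI_nonneg) auto
  then have "Infinite_Set_Sum.abs_summable_on \<beta> UNIV"
    by (simp add: abs_summable_on_def)
  then have "\<beta> summable_on UNIV" "infsum \<beta> UNIV = (LINT j|count_space UNIV. \<beta> j)"
    using abs_summable_equivalent[of \<beta> UNIV] infsetsum_infsum[of \<beta> UNIV] \<beta>0 by (auto simp: infsetsum_def)
  then have "(\<beta> has_sum (LINT j|count_space UNIV. \<beta> j)) UNIV"
    using has_sum_infsum by force
  moreover have "(LINT j|count_space UNIV. \<beta> j) = enn2real ?n"
    unfolding n using \<beta>0 by (intro integral_eq_nn_integral) auto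
  ultimately have "(\<beta> has_sum enn2real ?n) UNIV" by simp
  with \<beta>0 show ?thesis
    by (rule that) (unfold \<beta>_def, rule besov_test_block[OF p Lf])
qed

end

section \<open>Symbols of tempered distributions away from the origin\<close>

lemma fourier_add:
  assumes "integrable lborel f" "integrable lborel g"
  shows "fourier (\<lambda>x. f x + g x) \<xi> = fourier f \<xi> + fourier g \<xi>"
  unfolding fourier_def distrib_left
  by (intro Bochner_Integration.integral_add integrable_fourier assms)

lemma fourier_cmult: "fourier (\<lambda>x. c * f x) \<xi> = c * fourier f \<xi>"
  unfolding fourier_def by (simp add: mult.left_commute)

lemma fourier_zero: "fourier (\<lambda>x. 0) = (\<lambda>x. 0)"
  by (simp add: fourier_def fun_eq_iff)

lemma fourier_measurable [measurable]: "integrable lborel f \<Longrightarrow> fourier f \<in> borel_measurable borel"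
proof -
  assume "integrable lborel f"
  note [measurable] = borel_measurable_integrable[OF this]
  show ?thesis unfolding fourier_def[abs_def] by measurable
qed

text \<open>One \<open>r\<close> governs both radii. Against such functions every sum over blocks is
  finite and division by |\<xi>|^2 is harmless.\<close>

definition annular :: "(real^2 \<Rightarrow> complex) \<Rightarrow> bool"
  where "annular \<theta> \<longleftrightarrow> \<theta> \<in> schwartz \<and> (\<exists>r>0. \<forall>\<xi>. norm \<xi> < r \<or> 1 / r < norm \<xi> \<longrightarrow> \<theta> \<xi> = 0)"

lemma annular_schwartz: "annular \<theta> \<Longrightarrow> \<theta> \<in> schwartz"
  by (simp add: annular_def)

lemma annular_mult: "g \<in> multiplier \<Longrightarrow> annular \<theta> \<Longrightarrow> annular (\<lambda>\<xi>. g \<xi> * \<theta> \<xi>)"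
  unfolding annular_def by (auto intro: schwartz_mult)

lemma annular_at_0: "annular \<theta> \<Longrightarrow> \<theta> 0 = 0"
  unfolding annular_def by auto

lemma annular_div: "annular \<theta> \<Longrightarrow> annular (\<lambda>\<xi>. \<theta> \<xi> / of_real ((norm \<xi>)\<^sup>2))"
proof -
  assume "annular \<theta>"
  then obtain r where r: "\<theta> \<in> schwartz" "0 < r" "\<And>\<xi>. norm \<xi> < r \<or> 1 / r < norm \<xi> \<Longrightarrow> \<theta> \<xi> = 0"
    unfolding annular_def by blast
  have "(\<lambda>\<xi>. \<theta> \<xi> / of_real ((norm \<xi>)\<^sup>2)) \<in> schwartz"
    using r by (intro schwartz_div_norm_sq[of _ r]) auto
  with r show ?thesis unfolding annular_def by (intro conjI exI[of _ r]) auto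
qed

lemma annular_sum:
  assumes "finite J" "\<And>j. j \<in> J \<Longrightarrow> annular (\<theta> j)" shows "annular (\<lambda>\<xi>. \<Sum>j\<in>J. \<theta> j \<xi>)"
  using assms
proof (induction J)
  case empty
  have "annular (\<lambda>\<xi>. 0)" unfolding annular_def using schwartz_zero by (auto intro: exI[of _ 1])
  then show ?case by simp
next
  case (insert i J)
  have "annular (\<theta> i)" "annular (\<lambda>\<xi>. \<Sum>j\<in>J. \<theta> j \<xi>)" using insert by auto
  then obtain r t where r: "0 < r" "\<And>\<xi>. norm \<xi> < r \<or> 1 / r < norm \<xi> \<Longrightarrow> \<theta> i \<xi> = 0"
    and t: "0 < t" "\<And>\<xi>. norm \<xi> < t \<or> 1 / t < norm \<xi> \<Longrightarrow> (\<Sum>j\<in>J. \<theta> j \<xi>) = 0"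
    unfolding annular_def by blast
  have "1 / r \<le> 1 / min r t" "1 / t \<le> 1 / min r t" using r(1) t(1) by (auto intro!: divide_left_mono)
  then have "\<theta> i \<xi> = 0" "(\<Sum>j\<in>J. \<theta> j \<xi>) = 0" if "norm \<xi> < min r t \<or> 1 / min r t < norm \<xi>" for \<xi>
    using r(2)[of \<xi>] t(2)[of \<xi>] that by linarith+
  then have "\<forall>\<xi>. norm \<xi> < min r t \<or> 1 / min r t < norm \<xi> \<longrightarrow> (\<Sum>j\<in>insert i J. \<theta> j \<xi>) = 0"
    using insert.hyps by simp
  moreover have "0 < min r t" using r t by simp
  moreover have "(\<lambda>\<xi>. \<Sum>j\<in>insert i J. \<theta> j \<xi>) \<in> schwartz"
    by (intro schwartz_sum annular_schwartz insert.prems)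
  ultimately show ?case unfolding annular_def by blast
qed

text \<open>The Fourier transform of \<open>T\<close> is the function \<open>v\<close> away from the origin; nothing is said about the
  origin, where the symbols below are singular.\<close>

definition fourier_rep :: "functional \<Rightarrow> (real^2 \<Rightarrow> complex) \<Rightarrow> bool"
  where "fourier_rep T v \<longleftrightarrow> (\<forall>\<theta>. annular \<theta> \<longrightarrow>
           integrable lborel (\<lambda>\<xi>. v \<xi> * \<theta> \<xi>) \<and> T (fourier \<theta>) = (LINT \<xi>|lborel. v \<xi> * \<theta> \<xi>))"

lemma fourier_repD:
  assumes "fourier_rep T v" "annular \<theta>"
  shows "integrable lborel (\<lambda>\<xi>. v \<xi> * \<theta> \<xi>)" "T (fourier \<theta>) = (LINT \<xi>|lborel. v \<xi> * \<theta> \<xi>)"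
  using assms unfolding fourier_rep_def by auto

text \<open>Annular functions vanish at 0, so the value of a symbol there, often a default of
  division by zero, does not matter.\<close>

lemma fourier_rep_cong:
  assumes "fourier_rep T v" "\<And>\<xi>. \<xi> \<noteq> 0 \<Longrightarrow> v \<xi> = w \<xi>" shows "fourier_rep T w"
proof -
  have eq: "(\<lambda>\<xi>. v \<xi> * \<theta> \<xi>) = (\<lambda>\<xi>. w \<xi> * \<theta> \<xi>)" if "annular \<theta>" for \<theta>
  proof
    show "v \<xi> * \<theta> \<xi> = w \<xi> * \<theta> \<xi>" for \<xi>
      using assms(2)[of \<xi>] annular_at_0[OF that] by (cases "\<xi> = 0") auto
  qed
  show ?thesis
    unfolding fourier_rep_def
  proof (intro allI impI)
    fix \<theta> assume "annular \<theta>"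
    then show "integrable lborel (\<lambda>\<xi>. w \<xi> * \<theta> \<xi>) \<and> T (fourier \<theta>) = (LINT \<xi>|lborel. w \<xi> * \<theta> \<xi>)"
      using fourier_repD[OF assms(1)] eq by metis
  qed
qed

lemma fourier_rep_add:
  assumes "fourier_rep S v" "fourier_rep T w" shows "fourier_rep (S + T) (\<lambda>\<xi>. v \<xi> + w \<xi>)"
  using assms unfolding fourier_rep_def by (simp add: distrib_right)

lemma fourier_rep_diff:
  assumes "fourier_rep S v" "fourier_rep T w" shows "fourier_rep (S - T) (\<lambda>\<xi>. v \<xi> - w \<xi>)"
  using assms unfolding fourier_rep_def by (simp add: left_diff_distrib)

lemma fourier_rep_partial:
  assumes "fourier_rep T v" shows "fourier_rep (partial_dist i T) (\<lambda>\<xi>. \<i> * coord i \<xi> * v \<xi>)"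
  unfolding fourier_rep_def
proof (intro allI impI)
  fix \<theta> assume \<theta>: "annular \<theta>"
  have a: "annular (\<lambda>\<xi>. - \<i> * (coord i \<xi> * \<theta> \<xi>))"
    by (intro annular_mult[OF multiplier_const] annular_mult[OF multiplier_coord] \<theta>)
  note R = fourier_repD[OF assms a]
  have eq: "\<i> * coord i \<xi> * v \<xi> * \<theta> \<xi> = - (v \<xi> * (- \<i> * (coord i \<xi> * \<theta> \<xi>)))" for \<xi>
    by (simp add: ac_simps)
  have "partial_dist i T (fourier \<theta>) = - T (fourier (\<lambda>\<xi>. - \<i> * (coord i \<xi> * \<theta> \<xi>)))"
    using annular_schwartz[OF \<theta>]
    by (simp add: partial_dist_def on_schwartz_def fourier_schwartz partial_fourier schwartz_decaying)
  then show "integrable lborel (\<lambda>\<xi>. \<i> * coord i \<xi> * v \<xi> * \<theta> \<xi>) \<and>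
      partial_dist i T (fourier \<theta>) = (LINT \<xi>|lborel. \<i> * coord i \<xi> * v \<xi> * \<theta> \<xi>)"
    using R unfolding eq by (simp only: Bochner_Integration.integrable_minus Bochner_Integration.integral_minus)
qed

lemma fourier_rep_div:
  assumes "\<And>i. fourier_rep (V $ i) (v i)"
  shows "fourier_rep (div_dist V) (\<lambda>\<xi>. \<i> * coord 1 \<xi> * v 1 \<xi> + \<i> * coord 2 \<xi> * v 2 \<xi>)"
  unfolding div_dist_def sum_2 by (intro fourier_rep_add fourier_rep_partial assms)

text \<open>Transposition. It serves the force as well as the entries of U \<otimes> U, which are
  integrable but otherwise rough.\<close>

lemma fourier_rep_represents:
  assumes T: "represents f T" and f: "integrable lborel f"
  shows "fourier_rep T (fourier f)"
  unfolding fourier_rep_def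
proof (intro allI impI conjI)
  fix \<theta> assume "annular \<theta>"
  then have \<theta>: "\<theta> \<in> schwartz" by (rule annular_schwartz)
  note [measurable] = schwartz_measurable[OF \<theta>] fourier_measurable[OF f]
  show "integrable lborel (\<lambda>\<xi>. fourier f \<xi> * \<theta> \<xi>)"
    by (rule Bochner_Integration.integrable_bound[OF integrable_mult_right[OF integrable_norm[OF schwartz_integrable[OF \<theta>]], of "LINT x|lborel. norm (f x)"]])
       (auto simp: norm_mult norm_fourier_le abs_mult intro!: mult_right_mono)
  have "T (fourier \<theta>) = (LINT x|lborel. f x * fourier \<theta> x)"
    using T fourier_schwartz[OF \<theta>] unfolding represents_def on_schwartz_def by simp
  then show "T (fourier \<theta>) = (LINT \<xi>|lborel. fourier f \<xi> * \<theta> \<xi>)"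
    using fourier_transpose[OF f schwartz_integrable[OF \<theta>]] by simp
qed

section \<open>Fourier multipliers on symbols\<close>

context littlewood_paley_family begin

lemma annular_m: "annular (m j)"
proof -
  define r where "r = min (2 powr (real_of_int j - 1)) (1 / 2 powr (real_of_int j + 1))"
  have r: "0 < r" by (simp add: r_def)
  have "1 / (1 / 2 powr (real_of_int j + 1)) \<le> 1 / r" unfolding r_def by (intro divide_left_mono) auto
  then have "m j \<xi> = 0" if "norm \<xi> < r \<or> 1 / r < norm \<xi>" for \<xi>
    using m_support[of j \<xi>] that unfolding r_def by (cases "m j \<xi> = 0") auto
  with r show ?thesis unfolding annular_def using m_schwartz by blast
qed

lemma annular_m_mult: "\<theta> \<in> multiplier \<Longrightarrow> annular (\<lambda>\<xi>. m j \<xi> * \<theta> \<xi>)"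
  using annular_mult[OF _ annular_m] by (simp add: mult.commute)

lemma annular_window: "finite J \<Longrightarrow> annular (window J)"
  unfolding window_def[abs_def] by (intro annular_sum annular_m)

lemma annular_finite:
  assumes "annular \<theta>"
  obtains J where "finite J" "\<And>k \<xi>. k \<notin> J \<Longrightarrow> m k \<xi> * \<theta> \<xi> = 0" "\<And>\<xi>. window J \<xi> * \<theta> \<xi> = \<theta> \<xi>"
proof -
  from assms obtain r where r: "0 < r" "\<And>\<xi>. norm \<xi> < r \<or> 1 / r < norm \<xi> \<Longrightarrow> \<theta> \<xi> = 0"
    unfolding annular_def by blast
  \<comment> \<open>By this choice the annuli with index above \<open>M\<close> lie beyond radius
    1/r and those with index below \<open>-M\<close> inside radius \<open>r\<close>.\<close>
  obtain M :: nat where M: "2 / r < 2 ^ M" using real_arch_pow[of 2 "2 / r"] by auto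
  let ?J = "{- int M..int M}"
  have 0: "m k \<xi> * \<theta> \<xi> = 0" if k: "k \<notin> ?J" for k \<xi>
  proof (rule ccontr)
    assume "m k \<xi> * \<theta> \<xi> \<noteq> 0"
    then have "m k \<xi> \<noteq> 0" and t: "\<not> (norm \<xi> < r \<or> 1 / r < norm \<xi>)" using r(2) by auto
    note S = m_support[OF this(1)]
    from k consider "int M + 1 \<le> k" | "k \<le> - int M - 1" by force
    then show False
    proof cases
      case 1
      then have "2 powr real M \<le> 2 powr (real_of_int k - 1)" by (intro powr_mono) auto
      then have "2 ^ M \<le> 1 / r" using S(1) t by (simp add: powr_realpow)
      moreover have "1 / r \<le> 2 / r" using r by (simp add: divide_right_mono)
      ultimately show False using M by linarith
    next
      case 2
      then have "2 powr (real_of_int k + 1) \<le> 2 powr (- real M)" by (intro powr_mono) auto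
      then have "r \<le> 1 / 2 ^ M" using S(2) t by (simp add: powr_minus powr_realpow divide_inverse)
      then have "2 ^ M \<le> 1 / r" using r by (simp add: field_simps)
      moreover have "1 / r \<le> 2 / r" using r by (simp add: divide_right_mono)
      ultimately show False using M by linarith
    qed
  qed
  show ?thesis
  proof (rule that[of ?J])
    show "window ?J \<xi> * \<theta> \<xi> = \<theta> \<xi>" for \<xi>
    proof (cases "\<theta> \<xi> = 0")
      case False
      then have "window ?J \<xi> = 1"
      proof (intro window_eq_1)
        show "\<xi> \<noteq> 0" using False annular_at_0[OF assms] by auto
        show "m k \<xi> = 0" if "k \<notin> ?J" for k using 0[OF that, of \<xi>] False by simp
      qed simp
      then show ?thesis by simp
    qed simp
  qed (use 0 in auto)
qed

text \<open>Against an annular function only finitely many blocks contribute, so the defining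
  infinite sum commutes with the integral, and the window over these blocks is 1 where the function
  is nonzero.\<close>

lemma fourier_rep_inv_neg_laplacian:
  assumes T: "fourier_rep T v"
  shows "fourier_rep (inv_neg_laplacian \<Phi> T) (\<lambda>\<xi>. v \<xi> / of_real ((norm \<xi>)\<^sup>2))"
  unfolding fourier_rep_def
proof (intro allI impI)
  fix \<theta> assume \<theta>: "annular \<theta>"
  obtain J where J: "finite J" "\<And>k \<xi>. k \<notin> J \<Longrightarrow> m k \<xi> * \<theta> \<xi> = 0" "\<And>\<xi>. window J \<xi> * \<theta> \<xi> = \<theta> \<xi>"
    using annular_finite[OF \<theta>] by blast
  let ?s = "\<lambda>\<xi>::real^2. complex_of_real ((norm \<xi>)\<^sup>2)"
  note S = schwartz_multiplier[OF annular_schwartz]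
  have a: "annular (\<lambda>\<xi>. m j \<xi> * (\<theta> \<xi> / ?s \<xi>))" for j
    by (intro annular_m_mult S annular_div \<theta>)
  have "annular (\<lambda>\<xi>. \<theta> \<xi> / ?s \<xi>)" by (rule annular_div[OF \<theta>])
  note R = fourier_repD[OF T this]
  have term_eq: "inv_fourier_dist (mult_dist (\<lambda>\<xi>. m j \<xi> / ?s \<xi>) (fourier_dist T)) (fourier \<theta>)
      = (LINT \<xi>|lborel. v \<xi> * (m j \<xi> * (\<theta> \<xi> / ?s \<xi>)))" for j
  proof -
    have "inv_fourier_dist (mult_dist (\<lambda>\<xi>. m j \<xi> / ?s \<xi>) (fourier_dist T)) (fourier \<theta>)
       = T (fourier (\<lambda>\<xi>. m j \<xi> * (\<theta> \<xi> / ?s \<xi>)))"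
      using annular_schwartz[OF \<theta>] annular_schwartz[OF a[of j]]
      by (simp add: inv_fourier_dist_def mult_dist_def fourier_dist_def on_schwartz_def
          fourier_schwartz inv_fourier_fourier)
    then show ?thesis using fourier_repD(2)[OF T a] by simp
  qed
  have "inv_neg_laplacian \<Phi> T (fourier \<theta>) = (\<Sum>\<^sub>\<infinity>j\<in>UNIV. LINT \<xi>|lborel. v \<xi> * (m j \<xi> * (\<theta> \<xi> / ?s \<xi>)))"
    unfolding inv_neg_laplacian_def term_eq ..
  also have "\<dots> = (\<Sum>\<^sub>\<infinity>j\<in>J. LINT \<xi>|lborel. v \<xi> * (m j \<xi> * (\<theta> \<xi> / ?s \<xi>)))"
  proof (rule infsum_cong_neutral)
    fix j assume "j \<in> UNIV - J"
    then have "m j \<xi> * (\<theta> \<xi> / ?s \<xi>) = 0" for \<xi> using J(2)[of j \<xi>] by simp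
    then show "(LINT \<xi>|lborel. v \<xi> * (m j \<xi> * (\<theta> \<xi> / ?s \<xi>))) = 0"
      by (simp only: mult_zero_right Bochner_Integration.integral_zero)
  qed auto
  also have "\<dots> = (\<Sum>j\<in>J. LINT \<xi>|lborel. v \<xi> * (m j \<xi> * (\<theta> \<xi> / ?s \<xi>)))"
    using J(1) by simp
  also have "\<dots> = (LINT \<xi>|lborel. (\<Sum>j\<in>J. v \<xi> * (m j \<xi> * (\<theta> \<xi> / ?s \<xi>))))"
    by (rule Bochner_Integration.integral_sum[symmetric]) (rule fourier_repD(1)[OF T a])
  also have "\<dots> = (LINT \<xi>|lborel. v \<xi> / ?s \<xi> * \<theta> \<xi>)"
  proof (intro Bochner_Integration.integral_cong refl)
    fix \<xi>
    have "(\<Sum>j\<in>J. v \<xi> * (m j \<xi> * (\<theta> \<xi> / ?s \<xi>))) = v \<xi> * ((window J \<xi> * \<theta> \<xi>) / ?s \<xi>)"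
      by (simp add: window_def sum_distrib_left sum_distrib_right sum_divide_distrib)
    then show "(\<Sum>j\<in>J. v \<xi> * (m j \<xi> * (\<theta> \<xi> / ?s \<xi>))) = v \<xi> / ?s \<xi> * \<theta> \<xi>"
      unfolding J(3) by simp
  qed
  finally show "integrable lborel (\<lambda>\<xi>. v \<xi> / ?s \<xi> * \<theta> \<xi>) \<and>
      inv_neg_laplacian \<Phi> T (fourier \<theta>) = (LINT \<xi>|lborel. v \<xi> / ?s \<xi> * \<theta> \<xi>)"
    using R(1) by simp
qed

text \<open>The symbol of \<open>(-\<Delta>)\<^sup>-\<^sup>1\<close> composed with the Helmholtz projection, meaningful for \<open>\<xi> \<noteq> 0\<close> only.\<close>

definition leray :: "(2 \<Rightarrow> real^2 \<Rightarrow> complex) \<Rightarrow> 2 \<Rightarrow> real^2 \<Rightarrow> complex"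
  where "leray v i \<xi> = (v i \<xi> - coord i \<xi> * (coord 1 \<xi> * v 1 \<xi> + coord 2 \<xi> * v 2 \<xi>) / of_real ((norm \<xi>)\<^sup>2)) / of_real ((norm \<xi>)\<^sup>2)"

lemma fourier_rep_inv_neg_laplacian_helmholtz:
  assumes V: "\<And>i. fourier_rep (V $ i) (v i)"
  shows "fourier_rep (inv_neg_laplacian_helmholtz \<Phi> V $ i) (leray v i)"
proof -
  let ?s = "\<lambda>\<xi>::real^2. complex_of_real ((norm \<xi>)\<^sup>2)"
  have "fourier_rep (inv_neg_laplacian \<Phi> (helmholtz \<Phi> V $ i)) (\<lambda>\<xi>. (v i \<xi> + \<i> * coord i \<xi> *
      (\<i> * coord 1 \<xi> * (v 1 \<xi> / ?s \<xi>) + \<i> * coord 2 \<xi> * (v 2 \<xi> / ?s \<xi>))) / ?s \<xi>)"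
    unfolding helmholtz_def vector_add_component grad_dist_def vec_lambda_beta
    by (intro fourier_rep_inv_neg_laplacian fourier_rep_add V fourier_rep_partial
        fourier_rep_div[where v="\<lambda>k \<xi>. v k \<xi> / ?s \<xi>"]) (unfold vec_lambda_beta, intro fourier_rep_inv_neg_laplacian V)
  moreover have "(v i \<xi> + \<i> * coord i \<xi> * (\<i> * coord 1 \<xi> * (v 1 \<xi> / ?s \<xi>) + \<i> * coord 2 \<xi> * (v 2 \<xi> / ?s \<xi>))) / ?s \<xi> = leray v i \<xi>" for \<xi>
  proof -
    \<comment> \<open>The two factors \<i>, from gradient and divergence, supply the minus sign of
      the projection.\<close>
    have "\<i> * coord i \<xi> * (\<i> * coord 1 \<xi> * (v 1 \<xi> / ?s \<xi>) + \<i> * coord 2 \<xi> * (v 2 \<xi> / ?s \<xi>))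
      = (\<i> * \<i>) * (coord i \<xi> * (coord 1 \<xi> * v 1 \<xi> + coord 2 \<xi> * v 2 \<xi>) / ?s \<xi>)"
      by (simp only: distrib_left add_divide_distrib times_divide_eq_right ac_simps)
    then show ?thesis by (simp add: leray_def)
  qed
  ultimately show ?thesis by (simp add: inv_neg_laplacian_helmholtz_def)
qed

text \<open>Elements of the space are the sums of their blocks, so a bound \<open>s\<close> uniform
  over the annuli lets the block estimates be added up.\<close>

lemma besov_test_sum:
  assumes p: "1 \<le> p" "p \<le> 2" and F: "F \<in> besov \<Phi> (ennreal p) 1 (2 / p - 1)"
    and \<theta>: "\<theta> \<in> schwartz" and s: "0 \<le> s" and \<theta>s: "\<And>j. (LINT \<xi>|lborel. (norm (fat j \<xi> * \<theta> \<xi>))\<^sup>2) \<le> s\<^sup>2"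
  shows "norm ((F $ i) (fourier \<theta>)) \<le> 64 * pi * s * enn2real (besov_norm \<Phi> (ennreal p) 1 (2 / p - 1) F)"
proof -
  let ?n = "enn2real (besov_norm \<Phi> (ennreal p) 1 (2 / p - 1) F)"
  obtain \<beta> :: "int \<Rightarrow> real" where "\<And>j. 0 \<le> \<beta> j" and \<beta>: "(\<beta> has_sum ?n) UNIV"
    and b: "\<And>i j \<theta> s. \<theta> \<in> schwartz \<Longrightarrow> 0 \<le> s \<Longrightarrow> (LINT \<xi>|lborel. (norm (fat j \<xi> * \<theta> \<xi>))\<^sup>2) \<le> s\<^sup>2 \<Longrightarrow>
        norm ((F $ i) (fourier (\<lambda>\<xi>. m j \<xi> * \<theta> \<xi>))) \<le> 64 * pi * s * \<beta> j"
    by (rule besov_test[OF p F], rule that)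
  have 1: "((\<lambda>j. lp_block \<Phi> j (F $ i) (fourier \<theta>)) has_sum (F $ i) (fourier \<theta>)) UNIV"
    using F unfolding besov_def by blast
  have 2: "norm (lp_block \<Phi> j (F $ i) (fourier \<theta>)) \<le> 64 * pi * s * \<beta> j" for j
    unfolding lp_block_fourier[OF \<theta>] by (rule b[OF \<theta> s \<theta>s])
  have 3: "((\<lambda>j. 64 * pi * s * \<beta> j) has_sum (64 * pi * s * ?n)) UNIV"
    by (rule has_sum_cmult_right[OF \<beta>])
  show ?thesis by (rule norm_infsum_le[OF 1 3 2])
qed

lemma fat_sq_le:
  assumes "\<theta> \<in> schwartz"
  shows "(LINT \<xi>|lborel. (norm (fat j \<xi> * \<theta> \<xi>))\<^sup>2) \<le> (LINT \<xi>|lborel. (norm (\<theta> \<xi>))\<^sup>2)"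
proof (rule integral_mono)
  show "(norm (fat j \<xi> * \<theta> \<xi>))\<^sup>2 \<le> (norm (\<theta> \<xi>))\<^sup>2" for \<xi>
    using norm_window[of "{j-2..j+2}" \<xi>] by (intro power_mono) (auto simp: norm_mult mult_left_le_one_le)
qed (intro schwartz_integrable_sq schwartz_mult schwartz_multiplier window_schwartz assms)+

text \<open>The embedding of the solution space into L^2, put as a duality bound. Of the constant 64
  pi, Plancherel absorbs 2 pi.\<close>

lemma besov_dual_L2:
  assumes p: "1 \<le> p" "p \<le> 2" and F: "F \<in> besov \<Phi> (ennreal p) 1 (2 / p - 1)" and \<phi>: "\<phi> \<in> schwartz"
  shows "norm ((F $ i) \<phi>) \<le> 32 * enn2real (besov_norm \<Phi> (ennreal p) 1 (2 / p - 1) F) * sqrt (LINT x|lborel. (norm (\<phi> x))\<^sup>2)"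
proof -
  let ?n = "enn2real (besov_norm \<Phi> (ennreal p) 1 (2 / p - 1) F)"
  define \<theta> where "\<theta> = inv_fourier \<phi>"
  have \<theta>: "\<theta> \<in> schwartz" "fourier \<theta> = \<phi>"
    by (auto simp: \<theta>_def inv_fourier_schwartz fourier_inv_fourier \<phi>)
  let ?I = "LINT x|lborel. (norm (\<theta> x))\<^sup>2"
  have I0: "0 \<le> ?I" by simp
  have "norm ((F $ i) (fourier \<theta>)) \<le> 64 * pi * sqrt ?I * ?n"
    by (rule besov_test_sum[OF p F \<theta>(1)]) (use fat_sq_le[OF \<theta>(1)] I0 in auto)
  moreover have "sqrt (LINT x|lborel. (norm (\<phi> x))\<^sup>2) = 2 * pi * sqrt ?I"
    using plancherel[OF \<theta>(1)] by (simp add: \<theta>(2) real_sqrt_mult)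
  ultimately show ?thesis by (simp add: \<theta>(2) ac_simps)
qed

end

section \<open>Estimates for the remainder and low frequencies\<close>

lemma Cauchy_Schwarz_integral:
  fixes f g :: "'a \<Rightarrow> complex"
  assumes f: "integrable M (\<lambda>x. (norm (f x))\<^sup>2)" and g: "integrable M (\<lambda>x. (norm (g x))\<^sup>2)"
    and fg: "integrable M (\<lambda>x. f x * g x)"
  shows "norm (LINT x|M. f x * g x) \<le> sqrt (LINT x|M. (norm (f x))\<^sup>2) * sqrt (LINT x|M. (norm (g x))\<^sup>2)"
proof -
  let ?A = "LINT x|M. (norm (f x))\<^sup>2" and ?B = "LINT x|M. (norm (g x))\<^sup>2" and ?X = "LINT x|M. norm (f x * g x)"
  have quad: "0 \<le> t\<^sup>2 * ?A - 2 * t * ?X + ?B" for t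
  proof -
    have "0 \<le> (LINT x|M. (t * norm (f x) - norm (g x))\<^sup>2)" by simp
    also have "\<dots> = (LINT x|M. t\<^sup>2 * (norm (f x))\<^sup>2 - 2 * t * norm (f x * g x) + (norm (g x))\<^sup>2)"
      by (intro Bochner_Integration.integral_cong refl) (simp add: power2_diff power_mult_distrib norm_mult)
    also have "\<dots> = t\<^sup>2 * ?A - 2 * t * ?X + ?B"
      using f g integrable_norm[OF fg] by simp
    finally show ?thesis .
  qed
  have A0: "0 \<le> ?A" and B0: "0 \<le> ?B" and X0: "0 \<le> ?X" by simp_all
  have "?X\<^sup>2 \<le> ?A * ?B"
  proof (cases "?A = 0")
    case True
    have "?X = 0"
    proof (rule ccontr)
      assume "?X \<noteq> 0"
      \<comment> \<open>With \<open>?A = 0\<close> the quadratic is linear in t, and this value of t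
        makes it equal to -1.\<close>
      with quad[of "(?B + 1) / (2 * ?X)"] True show False by simp
    qed
    then show ?thesis using A0 B0 by simp
  next
    case False
    then have A: "0 < ?A" using A0 by linarith
    have "0 \<le> (?X / ?A)\<^sup>2 * ?A - 2 * (?X / ?A) * ?X + ?B" by (rule quad)
    also have "\<dots> = ?B - ?X\<^sup>2 / ?A" using A by (simp add: field_simps power2_eq_square)
    finally show ?thesis using A by (simp add: field_simps)
  qed
  then have "?X \<le> sqrt (?A * ?B)" by (rule real_le_rsqrt)
  then show ?thesis unfolding real_sqrt_mult by (rule order_trans[OF integral_norm_bound])
qed

text \<open>The set where \<open>f\<close> is nonzero is open and null, hence empty.\<close>

lemma continuous_zero_integral:
  fixes f :: "real^2 \<Rightarrow> real"
  assumes c: "continuous_on UNIV f" and f0: "\<And>x. 0 \<le> f x" and i: "integrable lborel f" and z: "integral\<^sup>L lborel f = 0"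
  shows "f x = 0"
proof (rule ccontr)
  assume x: "f x \<noteq> 0"
  have "AE x in lborel. f x = 0" using z i f0 by (simp add: integral_nonneg_eq_0_iff_AE)
  then have "{x. f x \<noteq> 0} \<in> null_sets lborel"
    using borel_measurable_continuous_onI[OF c] by (simp add: AE_iff_null_sets[symmetric] AE_iff_null)
  then have "negligible {x. f x \<noteq> 0}" by (simp add: negligible_iff_null_sets null_sets_completionI)
  moreover have "open {x. f x \<noteq> 0}"
    using open_Collect_neq[OF c continuous_on_const[of UNIV 0]] by simp
  ultimately show False using x open_not_negligible by blast
qed

lemma fourier_tendsto:
  assumes f: "integrable lborel f" and x: "X \<longlonglongrightarrow> x"
  shows "(\<lambda>n. fourier f (X n)) \<longlonglongrightarrow> fourier f x"
  unfolding fourier_def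
proof (rule integral_dominated_convergence[where w="\<lambda>x. norm (f x)"])
  note [measurable] = borel_measurable_integrable[OF f]
  show "AE y in lborel. (\<lambda>n. cis (- (y \<bullet> X n)) * f y) \<longlonglongrightarrow> cis (- (y \<bullet> x)) * f y"
    unfolding cis_conv_exp by (intro AE_I2 tendsto_intros x)
qed (use f in \<open>auto simp: norm_mult\<close>)

section \<open>The projected nonlinearity and the dyadic weight\<close>

context littlewood_paley_family begin

text \<open>The projection subtracts a multiple of \<xi>, which the cross product with \<xi>
  annihilates; only the inverse Laplacian remains.\<close>

lemma leray_cross:
  assumes "\<xi> \<noteq> 0"
  shows "coord 1 \<xi> * leray d 2 \<xi> - coord 2 \<xi> * leray d 1 \<xi> = (coord 1 \<xi> * d 2 \<xi> - coord 2 \<xi> * d 1 \<xi>) / of_real ((norm \<xi>)\<^sup>2)"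
proof -
  let ?D = "coord 1 \<xi> * d 1 \<xi> + coord 2 \<xi> * d 2 \<xi>" and ?s = "complex_of_real ((norm \<xi>)\<^sup>2)"
  have "coord 1 \<xi> * leray d 2 \<xi> - coord 2 \<xi> * leray d 1 \<xi>
     = (coord 1 \<xi> * (d 2 \<xi> - coord 2 \<xi> * ?D / ?s) - coord 2 \<xi> * (d 1 \<xi> - coord 1 \<xi> * ?D / ?s)) / ?s"
  proof -
    have "p * (x / s) - q * (y / s) = (p * x - q * y) / s" for p q x y s :: complex
      by (simp add: diff_divide_distrib)
    then show ?thesis unfolding leray_def .
  qed
  also have "coord 1 \<xi> * (d 2 \<xi> - coord 2 \<xi> * ?D / ?s) - coord 2 \<xi> * (d 1 \<xi> - coord 1 \<xi> * ?D / ?s) = coord 1 \<xi> * d 2 \<xi> - coord 2 \<xi> * d 1 \<xi>"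
    by (simp add: right_diff_distrib ac_simps)
  finally show ?thesis .
qed

text \<open>\<open>d\<close> will be the divergence of U \<otimes> U, carrying one factor |\<xi>|
  times entries bounded by \<open>Q\<close>, and the inverse Laplacian removes two. Of the constant
  6, the projection term contributes 4.\<close>

lemma leray_bound:
  assumes x: "\<xi> \<noteq> 0" and d: "\<And>k. norm (d k \<xi>) \<le> 2 * norm \<xi> * Q"
  shows "norm (leray d i \<xi>) \<le> 6 * Q / norm \<xi>"
proof -
  let ?n = "norm \<xi>"
  have n: "0 < ?n" using x by simp
  have cd: "norm (coord k \<xi> * d k \<xi>) \<le> ?n * (2 * ?n * Q)" for k
    unfolding norm_mult by (intro mult_mono norm_coord_le d) auto
  have "norm (coord 1 \<xi> * d 1 \<xi> + coord 2 \<xi> * d 2 \<xi>) \<le> 4 * ?n\<^sup>2 * Q"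
    using norm_triangle_ineq[of "coord 1 \<xi> * d 1 \<xi>" "coord 2 \<xi> * d 2 \<xi>"] cd[of 1] cd[of 2]
    by (simp add: power2_eq_square)
  then have "norm (coord i \<xi>) * norm (coord 1 \<xi> * d 1 \<xi> + coord 2 \<xi> * d 2 \<xi>) \<le> ?n * (4 * ?n\<^sup>2 * Q)"
    by (intro mult_mono norm_coord_le) auto
  then have "norm (coord i \<xi> * (coord 1 \<xi> * d 1 \<xi> + coord 2 \<xi> * d 2 \<xi>) / of_real (?n\<^sup>2)) \<le> ?n * (4 * ?n\<^sup>2 * Q) / ?n\<^sup>2"
    unfolding norm_divide norm_mult[of "coord i \<xi>"] norm_of_real abs_of_nonneg[OF zero_le_power2] by (rule divide_right_mono) simp
  also have "\<dots> = 4 * ?n * Q" using n by simp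
  finally have "norm (d i \<xi> - coord i \<xi> * (coord 1 \<xi> * d 1 \<xi> + coord 2 \<xi> * d 2 \<xi>) / of_real (?n\<^sup>2)) \<le> 2 * ?n * Q + 4 * ?n * Q"
    using d[of i] norm_triangle_ineq4 order_trans add_mono by meson
  then have "norm (leray d i \<xi>) \<le> (2 * ?n * Q + 4 * ?n * Q) / ?n\<^sup>2"
    unfolding leray_def norm_divide norm_of_real abs_of_nonneg[OF zero_le_power2] by (rule divide_right_mono) simp
  also have "\<dots> = 6 * Q / ?n" using n by (simp add: field_simps power2_eq_square)
  finally show ?thesis .
qed

text \<open>A smooth annular substitute for 1/|\<xi>|, which is comparable to 2^(-j) on the j-th
  annulus. It lies below 2/|\<xi>| uniformly in \<open>J\<close>, and twice the weight dominates the
  window divided by |\<xi>|.\<close>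

definition weight :: "int set \<Rightarrow> real^2 \<Rightarrow> real" where "weight J \<xi> = (\<Sum>j\<in>J. 2 powr (- real_of_int j) * \<mu> j \<xi>)"

lemma weight_nonneg: "0 \<le> weight J \<xi>"
  unfolding weight_def by (intro sum_nonneg mult_nonneg_nonneg \<mu>_bounds) auto

lemma weight_le:
  assumes "finite J" "\<xi> \<noteq> 0" shows "weight J \<xi> \<le> 2 / norm \<xi>"
proof -
  have "weight J \<xi> \<le> (\<Sum>j\<in>J. 2 / norm \<xi> * \<mu> j \<xi>)"
    unfolding weight_def
  proof (rule sum_mono)
    fix j
    show "2 powr (- real_of_int j) * \<mu> j \<xi> \<le> 2 / norm \<xi> * \<mu> j \<xi>"
    proof (cases "m j \<xi> = 0")
      case False
      have "norm \<xi> \<le> 2 powr real_of_int j * 2" using m_support(2)[OF False] by (simp add: powr_add)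
      then have "2 powr (- real_of_int j) \<le> 2 / norm \<xi>"
        using assms(2) by (simp add: powr_minus field_simps)
      then show ?thesis by (intro mult_right_mono \<mu>_bounds)
    qed (simp add: \<mu>_def)
  qed
  also have "\<dots> = 2 / norm \<xi> * (\<Sum>j\<in>J. \<mu> j \<xi>)" by (simp add: sum_distrib_left)
  also have "\<dots> \<le> 2 / norm \<xi> * 1"
    using window_bounds[OF assms(1)] by (intro mult_left_mono) auto
  finally show ?thesis by simp
qed

lemma window_le_weight:
  assumes "\<xi> \<noteq> 0" shows "(\<Sum>j\<in>J. \<mu> j \<xi>) / norm \<xi> \<le> 2 * weight J \<xi>"
  unfolding weight_def sum_divide_distrib sum_distrib_left
proof (rule sum_mono)
  fix j
  show "\<mu> j \<xi> / norm \<xi> \<le> 2 * (2 powr (- real_of_int j) * \<mu> j \<xi>)"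
  proof (cases "m j \<xi> = 0")
    case False
    have "2 powr real_of_int j / 2 \<le> norm \<xi>" using m_support(1)[OF False] by (simp add: powr_diff)
    then have "1 / norm \<xi> \<le> 2 * 2 powr (- real_of_int j)"
      using assms by (simp add: powr_minus field_simps)
    from mult_right_mono[OF this \<mu>_bounds(1)[of j \<xi>]] show ?thesis by simp
  qed (simp add: \<mu>_def)
qed

lemma weight_annular: "finite J \<Longrightarrow> annular (\<lambda>\<xi>. of_real (weight J \<xi>))"
proof -
  assume "finite J"
  then have "annular (\<lambda>\<xi>. \<Sum>j\<in>J. of_real (2 powr (- real_of_int j)) * m j \<xi>)"
    by (intro annular_sum annular_mult[OF multiplier_const] annular_m)
  then show ?thesis by (simp add: weight_def m_eq)
qed

lemma integral_sq_localized:
  assumes g: "g \<in> schwartz" and r: "0 < r" and c: "0 \<le> c" and g0: "\<And>\<xi>. r < norm \<xi> \<Longrightarrow> g \<xi> = 0" and gc: "\<And>\<xi>. norm (g \<xi>) \<le> c"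
  shows "(LINT \<xi>|lborel. (norm (g \<xi>))\<^sup>2) \<le> (2 * r * c)\<^sup>2"
proof -
  let ?Q = "cbox (\<chi> i. - r) (\<chi> i. r) :: (real^2) set"
  note vol = measure_square[OF r]
  have iQ: "integrable lborel (indicator ?Q :: real^2 \<Rightarrow> real)"
    using emeasure_lborel_cbox_finite by (simp add: integrable_indicator_iff)
  have "(LINT \<xi>|lborel. (norm (g \<xi>))\<^sup>2) \<le> (LINT \<xi>|lborel. c\<^sup>2 * indicator ?Q \<xi>)"
  proof (rule integral_mono)
    fix \<xi>
    show "(norm (g \<xi>))\<^sup>2 \<le> c\<^sup>2 * indicator ?Q \<xi>"
    proof (cases "g \<xi> = 0")
      case False
      then have n: "norm \<xi> \<le> r" using g0 not_less by blast
      then have "\<xi> \<in> ?Q" by (rule mem_squareI)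
      then show ?thesis using gc[of \<xi>] by (simp add: power_mono)
    qed simp
  qed (use schwartz_integrable_sq[OF g] iQ in auto)
  also have "\<dots> = (2 * r * c)\<^sup>2" using vol by (simp add: power_mult_distrib)
  finally show ?thesis .
qed

text \<open>A function of size 2^(-j) on an annulus of area about 4^j has an L^2 norm independent of
  j, which is the uniform \<open>s\<close> that \<open>besov_test_sum\<close> asks for; crude radii
  and heights give 2 * 8 * 16 = 256. Duality with bounded multipliers then yields the L^1 norm,
  uniformly in \<open>J\<close>.\<close>

lemma weighted_bound:
  assumes p: "1 \<le> p" "p \<le> 2" and F: "F \<in> besov \<Phi> (ennreal p) 1 (2 / p - 1)"
    and H: "fourier_rep (F $ i) H" and J: "finite J"
  shows "(LINT \<xi>|lborel. norm (H \<xi> * of_real (weight J \<xi>))) \<le> 64 * pi * 256 * enn2real (besov_norm \<Phi> (ennreal p) 1 (2 / p - 1) F)"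
proof (rule L1_duality)
  show "integrable lborel (\<lambda>\<xi>. H \<xi> * of_real (weight J \<xi>))"
    by (rule fourier_repD(1)[OF H weight_annular[OF J]])
  fix \<phi> assume \<phi>: "\<phi> \<in> multiplier" "\<And>\<xi>. norm (\<phi> \<xi>) \<le> 1"
  let ?\<theta> = "\<lambda>\<xi>. \<phi> \<xi> * of_real (weight J \<xi>)"
  have a: "annular ?\<theta>" by (rule annular_mult[OF \<phi>(1) weight_annular[OF J]])
  have "norm ((F $ i) (fourier ?\<theta>)) \<le> 64 * pi * 256 * enn2real (besov_norm \<Phi> (ennreal p) 1 (2 / p - 1) F)"
  proof (rule besov_test_sum[OF p F annular_schwartz[OF a]])
    fix j
    let ?P = "2 powr real_of_int j"
    have "(LINT \<xi>|lborel. (norm (fat j \<xi> * ?\<theta> \<xi>))\<^sup>2) \<le> (2 * (8 * ?P) * (16 / ?P))\<^sup>2"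
    proof (rule integral_sq_localized)
      show "(\<lambda>\<xi>. fat j \<xi> * ?\<theta> \<xi>) \<in> schwartz"
        by (intro schwartz_mult schwartz_multiplier window_schwartz annular_schwartz[OF a])
      show "fat j \<xi> * ?\<theta> \<xi> = 0" if "8 * ?P < norm \<xi>" for \<xi>
        using fat_support(2)[of j \<xi>] that by (cases "fat j \<xi> = 0") (auto simp: powr_add)
      show "norm (fat j \<xi> * ?\<theta> \<xi>) \<le> 16 / ?P" for \<xi>
      proof (cases "fat j \<xi> = 0")
        case False
        have n: "?P / 8 \<le> norm \<xi>" using fat_support(1)[OF False] by (simp add: powr_diff)
        have "0 < ?P / 8" by simp
        with n have x: "0 < norm \<xi>" by linarith
        have "weight J \<xi> \<le> 2 / norm \<xi>" using weight_le[OF J] x by simp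
        also have "\<dots> \<le> 2 / (?P / 8)" using n x by (intro divide_left_mono) auto
        finally have w: "weight J \<xi> \<le> 16 / ?P" by simp
        have "norm (fat j \<xi> * ?\<theta> \<xi>) = norm (fat j \<xi>) * norm (\<phi> \<xi>) * weight J \<xi>"
          using weight_nonneg by (simp add: norm_mult)
        also have "\<dots> \<le> 1 * 1 * (16 / ?P)"
          using norm_window[of "{j-2..j+2}" \<xi>] \<phi>(2)[of \<xi>] w weight_nonneg by (intro mult_mono) auto
        finally show ?thesis by simp
      qed simp
    qed auto
    also have "2 * (8 * ?P) * (16 / ?P) = 256" by simp
    finally show "(LINT \<xi>|lborel. (norm (fat j \<xi> * ?\<theta> \<xi>))\<^sup>2) \<le> 256\<^sup>2" .
  qed simp
  then show "norm (LINT \<xi>|lborel. H \<xi> * of_real (weight J \<xi>) * \<phi> \<xi>) \<le> 64 * pi * 256 * enn2real (besov_norm \<Phi> (ennreal p) 1 (2 / p - 1) F)"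
    using fourier_repD(2)[OF H a] by (simp add: ac_simps)
qed

text \<open>Away from 0 the square of |\<rho>| is at most D/|\<xi>| times |\<rho>|, and
  |\<rho>|/|\<xi>| is controlled by \<open>weighted_bound\<close> after subtracting
  \<open>a\<close>. As \<rho> describes the transform only away from the origin, the bound reaches
  the function itself through partial sums of blocks, their limit, and
  \<open>L2_duality\<close>.\<close>

lemma remainder_bound:
  assumes p: "1 \<le> p" "p \<le> 2" and F: "F \<in> besov \<Phi> (ennreal p) 1 (2 / p - 1)"
    and H: "fourier_rep (F $ i) (\<lambda>\<xi>. a \<xi> + \<rho> \<xi>)" and a: "annular a" and u: "represents u (F $ i)"
    and \<rho>m [measurable]: "\<rho> \<in> borel_measurable borel" and D: "0 \<le> D" "\<And>\<xi>. \<xi> \<noteq> 0 \<Longrightarrow> norm (\<rho> \<xi>) \<le> D / norm \<xi>"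
    and A: "\<And>J. finite J \<Longrightarrow> (LINT \<xi>|lborel. norm (a \<xi> * of_real (weight J \<xi>))) \<le> A"
  shows "integrable lborel (\<lambda>x. (norm (u x - inv_fourier a x))\<^sup>2)"
    and "(LINT x|lborel. (norm (u x - inv_fourier a x))\<^sup>2) \<le>
      2 * D * (64 * pi * 256 * enn2real (besov_norm \<Phi> (ennreal p) 1 (2 / p - 1) F) + A)"
proof -
  let ?n = "enn2real (besov_norm \<Phi> (ennreal p) 1 (2 / p - 1) F)"
  let ?P = "2 * D * (64 * pi * 256 * ?n + A)"
  have aS: "a \<in> schwartz" by (rule annular_schwartz[OF a])
  note v = inv_fourier_schwartz[OF aS]
  note [measurable] = schwartz_measurable[OF v] schwartz_measurable[OF aS]
  have [measurable]: "u \<in> borel_measurable borel" using u by (simp add: represents_def)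
  have A0: "0 \<le> A" using A[of "{}"] by (simp add: weight_def)
  have P0: "0 \<le> ?P" using D A0 by simp
  have sq: "integrable lborel (\<lambda>\<xi>. (norm (\<rho> \<xi> * window J \<xi>))\<^sup>2) \<and> (LINT \<xi>|lborel. (norm (\<rho> \<xi> * window J \<xi>))\<^sup>2) \<le> ?P"
    if J: "finite J" for J
  proof -
    note w = weight_annular[OF J]
    note [measurable] = schwartz_measurable[OF annular_schwartz[OF w]] schwartz_measurable[OF window_schwartz[of J]]
    have ia: "integrable lborel (\<lambda>\<xi>. a \<xi> * of_real (weight J \<xi>))"
      by (intro schwartz_integrable_mult aS annular_schwartz w)
    have ih: "integrable lborel (\<lambda>\<xi>. (a \<xi> + \<rho> \<xi>) * of_real (weight J \<xi>))"
      by (rule fourier_repD(1)[OF H w])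
    have "integrable lborel (\<lambda>\<xi>. (a \<xi> + \<rho> \<xi>) * of_real (weight J \<xi>) - a \<xi> * of_real (weight J \<xi>))"
      by (rule Bochner_Integration.integrable_diff[OF ih ia])
    then have ir: "integrable lborel (\<lambda>\<xi>. \<rho> \<xi> * of_real (weight J \<xi>))" by (simp add: algebra_simps)
    \<comment> \<open>One factor of the window is bounded by 1; the other, divided by |\<xi>|, is at
      most twice the weight, which is the origin of the 2 in 2 D.\<close>
    have le: "(norm (\<rho> \<xi> * window J \<xi>))\<^sup>2 \<le> 2 * D * norm (\<rho> \<xi> * of_real (weight J \<xi>))" for \<xi>
    proof (cases "\<xi> = 0")
      case True then show ?thesis using D by (simp add: window_def m_at_0)
    next
      case False
      let ?w = "\<Sum>j\<in>J. \<mu> j \<xi>"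
      have w: "0 \<le> ?w" "?w \<le> 1" using window_bounds[OF J] by auto
      have "(norm (\<rho> \<xi> * window J \<xi>))\<^sup>2 = norm (\<rho> \<xi>) * norm (\<rho> \<xi>) * (?w * ?w)"
        unfolding window_eq norm_mult norm_of_real using w by (simp add: power2_eq_square)
      also have "\<dots> \<le> norm (\<rho> \<xi>) * (D / norm \<xi>) * (?w * 1)"
        using w D(1) by (intro mult_mono mult_left_mono D(2)[OF False]) auto
      also have "\<dots> = D * norm (\<rho> \<xi>) * (?w / norm \<xi>)" by simp
      also have "\<dots> \<le> D * norm (\<rho> \<xi>) * (2 * weight J \<xi>)"
        using D(1) by (intro mult_left_mono window_le_weight[OF False]) auto
      finally show ?thesis using weight_nonneg[of J \<xi>] by (simp add: norm_mult)
    qed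
    have i: "integrable lborel (\<lambda>\<xi>. (norm (\<rho> \<xi> * window J \<xi>))\<^sup>2)"
      by (rule Bochner_Integration.integrable_bound[OF integrable_mult_right[OF integrable_norm[OF ir], of "2 * D"]])
         (use le D in \<open>auto intro: order_trans\<close>)
    have "(LINT \<xi>|lborel. (norm (\<rho> \<xi> * window J \<xi>))\<^sup>2) \<le> (LINT \<xi>|lborel. 2 * D * norm (\<rho> \<xi> * of_real (weight J \<xi>)))"
      by (rule integral_mono[OF i _ le]) (intro integrable_mult_right integrable_norm ir)
    also have "\<dots> = 2 * D * (LINT \<xi>|lborel. norm (\<rho> \<xi> * of_real (weight J \<xi>)))" by simp
    also have "\<dots> \<le> ?P"
    proof (intro mult_left_mono)
      have "(LINT \<xi>|lborel. norm (\<rho> \<xi> * of_real (weight J \<xi>)))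
          \<le> (LINT \<xi>|lborel. norm ((a \<xi> + \<rho> \<xi>) * of_real (weight J \<xi>)) + norm (a \<xi> * of_real (weight J \<xi>)))"
      proof (rule integral_mono)
        fix \<xi>
        have "\<rho> \<xi> * of_real (weight J \<xi>) = (a \<xi> + \<rho> \<xi>) * of_real (weight J \<xi>) - a \<xi> * of_real (weight J \<xi>)"
          by (simp add: algebra_simps)
        then show "norm (\<rho> \<xi> * of_real (weight J \<xi>)) \<le> norm ((a \<xi> + \<rho> \<xi>) * of_real (weight J \<xi>)) + norm (a \<xi> * of_real (weight J \<xi>))"
          using norm_triangle_ineq4 by metis
      qed (intro Bochner_Integration.integrable_add integrable_norm ir ih ia)+
      also have "\<dots> = (LINT \<xi>|lborel. norm ((a \<xi> + \<rho> \<xi>) * of_real (weight J \<xi>))) + (LINT \<xi>|lborel. norm (a \<xi> * of_real (weight J \<xi>)))"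
        by (intro Bochner_Integration.integral_add integrable_norm ih ia)
      also have "\<dots> \<le> 64 * pi * 256 * ?n + A"
        by (intro add_mono weighted_bound[OF p F H J] A[OF J])
      finally show "(LINT \<xi>|lborel. norm (\<rho> \<xi> * of_real (weight J \<xi>))) \<le> 64 * pi * 256 * ?n + A" .
    qed (use D in simp)
    finally show ?thesis using i by simp
  qed
  \<comment> \<open>Once \<open>J\<close> contains \<open>J0\<close> the window leaves
    \<open>a\<close> untouched, so the partial sum of blocks minus \<open>a\<close> is just \<rho>
    cut off by the window.\<close>
  obtain J0 where J0: "finite J0" "\<And>k \<xi>. k \<notin> J0 \<Longrightarrow> m k \<xi> * a \<xi> = 0" "\<And>\<xi>. window J0 \<xi> * a \<xi> = a \<xi>"
    using annular_finite[OF a] by blast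
  have test: "norm (LINT x|lborel. (u x - inv_fourier a x) * \<phi> x) \<le> sqrt ?P * sqrt (LINT x|lborel. (norm (\<phi> x))\<^sup>2)"
    if \<phi>: "\<phi> \<in> schwartz" for \<phi>
  proof -
    define \<theta> where "\<theta> = inv_fourier \<phi>"
    have \<theta>: "\<theta> \<in> schwartz" "fourier \<theta> = \<phi>"
      by (auto simp: \<theta>_def inv_fourier_schwartz fourier_inv_fourier \<phi>)
    let ?T = "LINT x|lborel. (norm (\<theta> x))\<^sup>2"
    let ?X = "LINT x|lborel. inv_fourier a x * \<phi> x"
    have X: "?X = (LINT \<xi>|lborel. a \<xi> * \<theta> \<xi>)"
      using fourier_transpose[OF schwartz_integrable[OF v] schwartz_integrable[OF \<theta>(1)]]
      by (simp add: \<theta>(2) fourier_inv_fourier[OF aS])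
    have part: "norm ((\<Sum>j\<in>J. lp_block \<Phi> j (F $ i) \<phi>) - ?X) \<le> sqrt ?P * sqrt ?T" if J: "finite J" "J0 \<subseteq> J" for J
    proof -
      have m\<theta>: "annular (\<lambda>\<xi>. m j \<xi> * \<theta> \<xi>)" for j by (intro annular_m_mult schwartz_multiplier \<theta>)
      have "(\<Sum>j\<in>J. lp_block \<Phi> j (F $ i) \<phi>) = (\<Sum>j\<in>J. LINT \<xi>|lborel. (a \<xi> + \<rho> \<xi>) * (m j \<xi> * \<theta> \<xi>))"
        using lp_block_fourier[OF \<theta>(1)] fourier_repD(2)[OF H m\<theta>] by (simp add: \<theta>(2))
      also have "\<dots> = (LINT \<xi>|lborel. (\<Sum>j\<in>J. (a \<xi> + \<rho> \<xi>) * (m j \<xi> * \<theta> \<xi>)))"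
        by (rule Bochner_Integration.integral_sum[symmetric]) (rule fourier_repD(1)[OF H m\<theta>])
      also have "\<dots> = (LINT \<xi>|lborel. (a \<xi> + \<rho> \<xi>) * (window J \<xi> * \<theta> \<xi>))"
        by (simp add: window_def sum_distrib_left sum_distrib_right)
      finally have s: "(\<Sum>j\<in>J. lp_block \<Phi> j (F $ i) \<phi>) = (LINT \<xi>|lborel. (a \<xi> + \<rho> \<xi>) * (window J \<xi> * \<theta> \<xi>))" .
      have wJ: "window J \<xi> * a \<xi> = a \<xi>" for \<xi>
      proof (cases "a \<xi> = 0")
        case False
        have "window J \<xi> = 1"
        proof (rule window_eq_1[OF J(1)])
          show "\<xi> \<noteq> 0" using False annular_at_0[OF a] by auto
          show "m k \<xi> = 0" if "k \<notin> J" for k using J0(2)[of k \<xi>] J(2) that False by auto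
        qed
        then show ?thesis by simp
      qed simp
      have i1: "integrable lborel (\<lambda>\<xi>. (a \<xi> + \<rho> \<xi>) * (window J \<xi> * \<theta> \<xi>))"
      proof (rule fourier_repD(1)[OF H])
        show "annular (\<lambda>\<xi>. window J \<xi> * \<theta> \<xi>)"
          using annular_mult[OF schwartz_multiplier[OF \<theta>(1)] annular_window[OF J(1)]] by (simp add: mult.commute)
      qed
      have i2: "integrable lborel (\<lambda>\<xi>. a \<xi> * \<theta> \<xi>)" by (intro schwartz_integrable_mult aS \<theta>)
      have e: "(a \<xi> + \<rho> \<xi>) * (window J \<xi> * \<theta> \<xi>) - a \<xi> * \<theta> \<xi> = \<rho> \<xi> * window J \<xi> * \<theta> \<xi>" for \<xi>
      proof -
        have "a \<xi> * window J \<xi> * \<theta> \<xi> = a \<xi> * \<theta> \<xi>" using wJ[of \<xi>] by (simp add: mult.commute)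
        then show ?thesis by (simp add: algebra_simps)
      qed
      have "(\<Sum>j\<in>J. lp_block \<Phi> j (F $ i) \<phi>) - ?X = (LINT \<xi>|lborel. \<rho> \<xi> * window J \<xi> * \<theta> \<xi>)"
        unfolding s X Bochner_Integration.integral_diff[OF i1 i2, symmetric] e ..
      also have "norm \<dots> \<le> sqrt (LINT \<xi>|lborel. (norm (\<rho> \<xi> * window J \<xi>))\<^sup>2) * sqrt ?T"
        using Bochner_Integration.integrable_diff[OF i1 i2] sq[OF J(1)] schwartz_integrable_sq[OF \<theta>(1)]
        unfolding e by (intro Cauchy_Schwarz_integral) auto
      also have "\<dots> \<le> sqrt ?P * sqrt ?T"
        using sq[OF J(1)] by (intro mult_right_mono real_sqrt_le_mono) auto
      finally show ?thesis .
    qed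
    \<comment> \<open>Convergence of the blocks to the full distribution is what excludes a
      component supported at the origin.\<close>
    have "((\<lambda>j. lp_block \<Phi> j (F $ i) \<phi>) has_sum (F $ i) \<phi>) UNIV"
      using F unfolding besov_def by blast
    then have "((\<lambda>J. norm ((\<Sum>j\<in>J. lp_block \<Phi> j (F $ i) \<phi>) - ?X)) \<longlongrightarrow> norm ((F $ i) \<phi> - ?X)) (finite_subsets_at_top UNIV)"
      unfolding has_sum_def by (intro tendsto_intros)
    then have "norm ((F $ i) \<phi> - ?X) \<le> sqrt ?P * sqrt ?T"
    proof (rule tendsto_upperbound)
      show "\<forall>\<^sub>F J in finite_subsets_at_top UNIV. norm ((\<Sum>j\<in>J. lp_block \<Phi> j (F $ i) \<phi>) - ?X) \<le> sqrt ?P * sqrt ?T"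
        unfolding eventually_finite_subsets_at_top
        by (intro exI[of _ J0] conjI allI impI J0(1) subset_UNIV part) auto
    qed (rule finite_subsets_at_top_neq_bot)
    also have "sqrt ?P * sqrt ?T \<le> sqrt ?P * sqrt (LINT x|lborel. (norm (\<phi> x))\<^sup>2)"
    proof (intro mult_left_mono real_sqrt_le_mono)
      have "1 * ?T \<le> (2 * pi)\<^sup>2 * ?T"
      proof (rule mult_right_mono)
        have "1 \<le> 2 * pi" using pi_gt3 by simp
        then show "1 \<le> (2 * pi)\<^sup>2" by (rule one_le_power)
      qed simp
      then show "?T \<le> (LINT x|lborel. (norm (\<phi> x))\<^sup>2)" using plancherel[OF \<theta>(1)] by (simp add: \<theta>(2))
    qed (use P0 in simp)
    finally have "norm ((F $ i) \<phi> - ?X) \<le> sqrt ?P * sqrt (LINT x|lborel. (norm (\<phi> x))\<^sup>2)" .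
    moreover have "(F $ i) \<phi> = (LINT x|lborel. u x * \<phi> x)" "integrable lborel (\<lambda>x. u x * \<phi> x)"
      using u \<phi> unfolding represents_def on_schwartz_def by auto
    ultimately show ?thesis
      using schwartz_integrable_mult[OF v \<phi>] by (simp add: left_diff_distrib)
  qed
  have int: "integrable lborel (\<lambda>x. (u x - inv_fourier a x) * \<phi> x)" if \<phi>: "\<phi> \<in> schwartz" for \<phi>
    using u \<phi> schwartz_integrable_mult[OF v \<phi>] unfolding represents_def by (simp add: left_diff_distrib)
  note L = L2_duality[of "\<lambda>x. u x - inv_fourier a x" "sqrt ?P", OF _ _ int test]
  show "integrable lborel (\<lambda>x. (norm (u x - inv_fourier a x))\<^sup>2)"
    by (rule L(1)) (use P0 in simp_all)
  show "(LINT x|lborel. (norm (u x - inv_fourier a x))\<^sup>2) \<le> ?P"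
  proof -
    have "(LINT x|lborel. (norm (u x - inv_fourier a x))\<^sup>2) \<le> (sqrt ?P)\<^sup>2"
      by (rule L(2)) (use P0 in simp_all)
    then show ?thesis using P0 by simp
  qed
qed

text \<open>The test functions \<open>(- \<xi>\<^sub>2, \<xi>\<^sub>1) |\<xi>|\<^sup>2 c\<close> are orthogonal to \<open>\<xi>\<close>, so the projection drops out, and the
  quadratic form \<open>q\<close> of the mean of \<open>w\<close> remains. Rescaling the \<open>j\<close>-th annulus to the unit annulus shows
  that the pairing tends to the integral of \<open>\<mu>\<^sub>0 |q|\<^sup>2\<close>, while summability of \<open>\<beta>\<close> forces it to vanish.\<close>

lemma low_frequency:
  assumes p: "1 \<le> p" "p \<le> 2" and F: "F \<in> besov \<Phi> (ennreal p) 1 (2 / p - 1)"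
    and H: "\<And>i. fourier_rep (F $ i) (H i)" and r: "0 < r"
    and low: "\<And>i \<xi>. \<xi> \<noteq> 0 \<Longrightarrow> norm \<xi> < r \<Longrightarrow>
      H i \<xi> = - leray (\<lambda>k \<xi>. \<i> * coord 1 \<xi> * fourier (w k 1) \<xi> + \<i> * coord 2 \<xi> * fourier (w k 2) \<xi>) i \<xi>"
    and w: "\<And>k l. integrable lborel (w k l)" and sym: "w 2 1 = w (1::2) (2::2)"
  shows "(LINT x|lborel. w 1 2 x) = 0" and "(LINT x|lborel. w 1 1 x) = (LINT x|lborel. w 2 2 x)"
proof -
  \<comment> \<open>Up to \<i>, the cross product of \<xi> with the matrix of transforms applied to
    \<xi>. The frequency \<open>t\<close> of the matrix is a separate argument, so that it can tend
    to 0 while the vector stays in the unit annulus.\<close>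
  define q where "q t \<xi> = (fourier (w 2 2) t - fourier (w 1 1) t) * (coord 1 \<xi> * coord 2 \<xi>)
      + fourier (w 1 2) t * (coord 1 \<xi> * coord 1 \<xi> - coord 2 \<xi> * coord 2 \<xi>)" for t \<xi>
  define A where "A = fourier (w 2 2) 0 - fourier (w 1 1) 0"
  define B where "B = fourier (w 1 2) 0"
  \<comment> \<open>The conjugate of the limiting form, which makes the limit integrand nonnegative;
    written as a polynomial it is visibly a multiplier.\<close>
  define c where "c \<xi> = cnj A * (coord 1 \<xi> * coord 2 \<xi>) + cnj B * (coord 1 \<xi> * coord 1 \<xi> - coord 2 \<xi> * coord 2 \<xi>)" for \<xi>
  have c: "c \<xi> = cnj (q 0 \<xi>)" for \<xi> by (simp add: c_def q_def A_def B_def coord_def)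
  have cm: "c \<in> multiplier"
  proof -
    have "(\<lambda>\<xi>. cnj A * (coord 1 \<xi> * coord 2 \<xi>) + cnj B * (coord 1 \<xi> * coord 1 \<xi> + (-1) * (coord 2 \<xi> * coord 2 \<xi>))) \<in> multiplier"
      by (intro multiplier_add multiplier_mult multiplier_const multiplier_coord)
    then show ?thesis by (simp add: c_def[abs_def])
  qed
  define S where "S \<xi> = coord 1 \<xi> * coord 1 \<xi> + coord 2 \<xi> * coord 2 \<xi>" for \<xi>
  have S: "S \<xi> = of_real ((norm \<xi>)\<^sup>2)" for \<xi>
    unfolding S_def coord_def norm_sq_2 by (simp add: power2_eq_square)
  have Sm: "S \<in> multiplier" unfolding S_def[abs_def] by (intro multiplier_add multiplier_mult multiplier_coord)
  have quad: "norm (x * (coord 1 \<xi> * coord 2 \<xi>) + y * (coord 1 \<xi> * coord 1 \<xi> - coord 2 \<xi> * coord 2 \<xi>)) \<le> (norm x + 2 * norm y) * (norm \<xi>)\<^sup>2" for x y \<xi>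
  proof -
    have n: "norm (coord k \<xi> * coord l \<xi>) \<le> (norm \<xi>)\<^sup>2" for k l
      unfolding norm_mult power2_eq_square by (intro mult_mono norm_coord_le) auto
    have "norm (coord 1 \<xi> * coord 1 \<xi> - coord 2 \<xi> * coord 2 \<xi>) \<le> 2 * (norm \<xi>)\<^sup>2"
      using norm_triangle_ineq4[of "coord 1 \<xi> * coord 1 \<xi>" "coord 2 \<xi> * coord 2 \<xi>"] n[of 1 1] n[of 2 2] by linarith
    then have "norm (x * (coord 1 \<xi> * coord 2 \<xi>)) \<le> norm x * (norm \<xi>)\<^sup>2"
      "norm (y * (coord 1 \<xi> * coord 1 \<xi> - coord 2 \<xi> * coord 2 \<xi>)) \<le> norm y * (2 * (norm \<xi>)\<^sup>2)"
      using n[of 1 2] unfolding norm_mult[of x] norm_mult[of y] by (auto intro: mult_left_mono)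
    then show ?thesis by (intro norm_triangle_le) (simp add: algebra_simps)
  qed
  define C where "C = norm A + 2 * norm B"
  have C0: "0 \<le> C" by (simp add: C_def)
  have cC: "norm (c \<xi>) \<le> C * (norm \<xi>)\<^sup>2" for \<xi>
    unfolding c_def C_def using quad[of "cnj A" \<xi> "cnj B"] by simp
  obtain \<beta> :: "int \<Rightarrow> real" where \<beta>0: "\<And>j. 0 \<le> \<beta> j" and \<beta>: "(\<beta> has_sum enn2real (besov_norm \<Phi> (ennreal p) 1 (2 / p - 1) F)) UNIV"
    and b: "\<And>i j \<theta> s. \<theta> \<in> schwartz \<Longrightarrow> 0 \<le> s \<Longrightarrow> (LINT \<xi>|lborel. (norm (fat j \<xi> * \<theta> \<xi>))\<^sup>2) \<le> s\<^sup>2 \<Longrightarrow>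
        norm ((F $ i) (fourier (\<lambda>\<xi>. m j \<xi> * \<theta> \<xi>))) \<le> 64 * pi * s * \<beta> j"
    by (rule besov_test[OF p F], rule that)
  \<comment> \<open>64 pi comes from \<open>besov_test\<close>, the rest from the test functions
    below: a square of side 2 * 8 P and height 8 P * C (8 P)^4, with P^6 split off.\<close>
  define K where "K = 64 * pi * (2 * 8 * (8 * C * 8 ^ 4))"
  let ?G = "\<lambda>t \<eta>. m 0 \<eta> * (c \<eta> * q t \<eta>)"
  have main: "norm (LINT \<eta>|lborel. ?G (2 powr real_of_int j *\<^sub>R \<eta>) \<eta>) \<le> 2 * K * \<beta> j"
    if j: "2 powr (real_of_int j + 1) < r" for j
  proof -
    define P where "P = 2 powr real_of_int j"
    have P: "0 < P" by (simp add: P_def)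
    have S': "(\<lambda>\<xi>. S \<xi> * c \<xi>) \<in> multiplier" by (intro multiplier_mult Sm cm)
    \<comment> \<open>The cases \<open>\<theta>' 1 1\<close> and \<open>\<theta>' (-1) 2\<close> are
      tested against components 2 and 1 and assemble the cross product. The factor \<open>S\<close>
      cancels the denominator in \<open>leray_cross\<close>.\<close>
    define \<theta>' where "\<theta>' l k \<xi> = fat j \<xi> * ((l * coord k \<xi>) * (S \<xi> * c \<xi>))" for l k \<xi>
    have \<theta>: "\<theta>' l k \<in> schwartz" for l k
    proof -
      have "(\<lambda>\<xi>. ((l * coord k \<xi>) * (S \<xi> * c \<xi>)) * fat j \<xi>) \<in> schwartz"
        by (intro schwartz_mult multiplier_mult multiplier_const multiplier_coord S' window_schwartz)
      then show ?thesis by (simp add: \<theta>'_def[abs_def] mult.commute)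
    qed
    have test: "norm ((F $ i) (fourier (\<lambda>\<xi>. m j \<xi> * \<theta>' l k \<xi>))) \<le> K * P ^ 6 * \<beta> j" if l: "norm l = 1" for i k l
    proof -
      let ?c = "8 * P * (C * (8 * P) ^ 4)"
      have "(LINT \<xi>|lborel. (norm (fat j \<xi> * \<theta>' l k \<xi>))\<^sup>2) \<le> (2 * (8 * P) * ?c)\<^sup>2"
      proof (rule integral_sq_localized)
        show "(\<lambda>\<xi>. fat j \<xi> * \<theta>' l k \<xi>) \<in> schwartz"
          by (intro schwartz_mult schwartz_multiplier window_schwartz \<theta>)
        show "fat j \<xi> * \<theta>' l k \<xi> = 0" if "8 * P < norm \<xi>" for \<xi>
          using fat_support(2)[of j \<xi>] that by (cases "fat j \<xi> = 0") (auto simp: powr_add P_def)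
        show "norm (fat j \<xi> * \<theta>' l k \<xi>) \<le> ?c" for \<xi>
        proof (cases "fat j \<xi> = 0")
          case True then show ?thesis using P C0 by simp
        next
          case False
          have n: "norm \<xi> \<le> 8 * P" using fat_support(2)[OF False] by (simp add: powr_add P_def)
          have f1: "norm (fat j \<xi>) \<le> 1" by (rule norm_window) simp
          have "norm (S \<xi> * c \<xi>) \<le> (norm \<xi>)\<^sup>2 * (C * (norm \<xi>)\<^sup>2)"
            unfolding norm_mult S by (intro mult_mono cC) (auto simp: norm_power)
          also have "\<dots> = C * (norm \<xi>) ^ 4" by (simp add: power2_eq_square power4_eq_xxxx)
          also have "\<dots> \<le> C * (8 * P) ^ 4" using n C0 by (intro mult_left_mono power_mono) auto
          finally have "norm (coord k \<xi>) * norm (S \<xi> * c \<xi>) \<le> 8 * P * (C * (8 * P) ^ 4)"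
            using norm_coord_le[of k \<xi>] n P by (intro mult_mono) auto
          moreover have "norm (fat j \<xi>) * (norm (fat j \<xi>) * (norm (coord k \<xi>) * norm (S \<xi> * c \<xi>))) \<le> norm (fat j \<xi>) * (norm (coord k \<xi>) * norm (S \<xi> * c \<xi>))"
            by (rule mult_left_le_one_le[OF _ _ f1]) simp_all
          moreover have "\<dots> \<le> norm (coord k \<xi>) * norm (S \<xi> * c \<xi>)"
            by (rule mult_left_le_one_le[OF _ _ f1]) simp_all
          ultimately have "norm (fat j \<xi>) * (norm (fat j \<xi>) * (norm (coord k \<xi>) * norm (S \<xi> * c \<xi>))) \<le> ?c"
            by linarith
          then show ?thesis using l by (simp add: \<theta>'_def norm_mult mult.assoc)
        qed
      qed (use P C0 in auto)
      then have "norm ((F $ i) (fourier (\<lambda>\<xi>. m j \<xi> * \<theta>' l k \<xi>))) \<le> 64 * pi * (2 * (8 * P) * ?c) * \<beta> j"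
        using P C0 by (intro b \<theta>) auto
      also have "\<dots> = K * P ^ 6 * \<beta> j" 
      proof -
        have "P ^ 6 = P * P * P ^ 4" by (simp add: eval_nat_numeral)
        then show ?thesis unfolding K_def power_mult_distrib by (simp add: ac_simps)
      qed
      finally show ?thesis .
    qed
    have an: "annular (\<lambda>\<xi>. m j \<xi> * \<theta>' l k \<xi>)" for l k by (intro annular_m_mult schwartz_multiplier \<theta>)
    note R1 = fourier_repD[OF H[of 2] an[of 1 1]] and R2 = fourier_repD[OF H[of 1] an[of "-1" 2]]
    have pt: "H 2 \<xi> * (m j \<xi> * \<theta>' 1 1 \<xi>) + H 1 \<xi> * (m j \<xi> * \<theta>' (-1) 2 \<xi>) = - \<i> * (m j \<xi> * (c \<xi> * q \<xi> \<xi>))" for \<xi>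
    proof (cases "m j \<xi> = 0")
      case False
      then have x: "\<xi> \<noteq> 0" using m_at_0 by auto
      have n: "norm \<xi> < r" using m_support(2)[OF False] j by linarith
      let ?d = "\<lambda>k \<xi>. \<i> * coord 1 \<xi> * fourier (w k 1) \<xi> + \<i> * coord 2 \<xi> * fourier (w k 2) \<xi>"
      have "H 2 \<xi> * (m j \<xi> * \<theta>' 1 1 \<xi>) + H 1 \<xi> * (m j \<xi> * \<theta>' (-1) 2 \<xi>)
          = (m j \<xi> * fat j \<xi>) * (S \<xi> * c \<xi>) * (coord 1 \<xi> * H 2 \<xi> - coord 2 \<xi> * H 1 \<xi>)"
        by (simp add: \<theta>'_def algebra_simps)
      also have "coord 1 \<xi> * H 2 \<xi> - coord 2 \<xi> * H 1 \<xi> = - (coord 1 \<xi> * leray ?d 2 \<xi> - coord 2 \<xi> * leray ?d 1 \<xi>)"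
        unfolding low[OF x n] by simp
      also have "\<dots> = - ((coord 1 \<xi> * ?d 2 \<xi> - coord 2 \<xi> * ?d 1 \<xi>) / S \<xi>)"
        unfolding leray_cross[OF x] S ..
      also have "coord 1 \<xi> * ?d 2 \<xi> - coord 2 \<xi> * ?d 1 \<xi> = \<i> * q \<xi> \<xi>"
        unfolding q_def sym by (simp add: algebra_simps)
      also have "m j \<xi> * fat j \<xi> = m j \<xi>" by (rule fat_m)
      finally show ?thesis using x by (simp add: S)
    qed simp
    let ?g = "\<lambda>\<xi>. m j \<xi> * (c \<xi> * q \<xi> \<xi>)"
    have "(F $ 2) (fourier (\<lambda>\<xi>. m j \<xi> * \<theta>' 1 1 \<xi>)) + (F $ 1) (fourier (\<lambda>\<xi>. m j \<xi> * \<theta>' (-1) 2 \<xi>)) = - \<i> * (LINT \<xi>|lborel. ?g \<xi>)"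
      unfolding R1(2) R2(2) Bochner_Integration.integral_add[OF R1(1) R2(1), symmetric] pt by simp
    then have "norm (LINT \<xi>|lborel. ?g \<xi>) = norm ((F $ 2) (fourier (\<lambda>\<xi>. m j \<xi> * \<theta>' 1 1 \<xi>)) + (F $ 1) (fourier (\<lambda>\<xi>. m j \<xi> * \<theta>' (-1) 2 \<xi>)))"
      by (simp add: norm_mult)
    also have "\<dots> \<le> K * P ^ 6 * \<beta> j + K * P ^ 6 * \<beta> j"
      by (intro norm_triangle_le add_mono test) auto
    \<comment> \<open>The area element gives P^2 and the quadratic forms give P^4. Their product
      cancels the P^6 of the upper bound, so only \<open>\<beta> j\<close> is left to make the right
      side small.\<close>
    also have "(LINT \<xi>|lborel. ?g \<xi>) = P\<^sup>2 *\<^sub>R (LINT \<eta>|lborel. ?g (0 + P *\<^sub>R \<eta>))"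
      using P by (intro integral_plane_affine) simp
    also have "(\<lambda>\<eta>. ?g (0 + P *\<^sub>R \<eta>)) = (\<lambda>\<eta>. of_real (P ^ 4) * ?G (P *\<^sub>R \<eta>) \<eta>)"
    proof
      fix \<eta>
      have co: "coord k (P *\<^sub>R \<eta>) = of_real P * coord k \<eta>" for k by (simp add: coord_def)
      have "m j (P *\<^sub>R \<eta>) = m 0 \<eta>"
        unfolding m_scale[of j] P_def by (simp flip: powr_add)
      moreover have "c (P *\<^sub>R \<eta>) = of_real (P\<^sup>2) * c \<eta>"
        unfolding c_def co by (simp add: algebra_simps power2_eq_square)
      moreover have "q t (P *\<^sub>R \<eta>) = of_real (P\<^sup>2) * q t \<eta>" for t
        unfolding q_def co by (simp add: algebra_simps power2_eq_square)
      ultimately show "?g (0 + P *\<^sub>R \<eta>) = of_real (P ^ 4) * ?G (P *\<^sub>R \<eta>) \<eta>"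
        by (simp add: power2_eq_square power4_eq_xxxx)
    qed
    also have "norm (P\<^sup>2 *\<^sub>R (LINT \<eta>|lborel. of_real (P ^ 4) * ?G (P *\<^sub>R \<eta>) \<eta>)) = P ^ 6 * norm (LINT \<eta>|lborel. ?G (P *\<^sub>R \<eta>) \<eta>)"
    proof -
      have "P\<^sup>2 * P ^ 4 = P ^ 6" by (simp flip: power_add)
      then show ?thesis
        unfolding integral_mult_right_zero norm_scaleR norm_mult norm_of_real using P
        by (simp flip: mult.assoc)
    qed
    finally have "P ^ 6 * norm (LINT \<eta>|lborel. ?G (P *\<^sub>R \<eta>) \<eta>) \<le> P ^ 6 * (2 * K * \<beta> j)"
      by (simp add: algebra_simps)
    then show ?thesis unfolding P_def[symmetric] by (rule mult_left_le_imp_le) (use P in simp)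
  qed
  have lim1: "(\<lambda>n. LINT \<eta>|lborel. ?G (2 powr real_of_int (- int n) *\<^sub>R \<eta>) \<eta>) \<longlonglongrightarrow> (LINT \<eta>|lborel. ?G 0 \<eta>)"
  proof -
    define C' where "C' = (LINT x|lborel. norm (w 2 2 x)) + (LINT x|lborel. norm (w 1 1 x)) + 2 * (LINT x|lborel. norm (w 1 2 x))"
    have qC: "norm (q t \<eta>) \<le> C' * (norm \<eta>)\<^sup>2" for t \<eta>
    proof -
      have "norm (fourier (w 2 2) t - fourier (w 1 1) t) + 2 * norm (fourier (w 1 2) t) \<le> C'"
        using norm_triangle_ineq4[of "fourier (w 2 2) t" "fourier (w 1 1) t"]
          norm_fourier_le[of "w 2 2" t] norm_fourier_le[of "w 1 1" t] norm_fourier_le[of "w 1 2" t]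
        unfolding C'_def by linarith
      from mult_right_mono[OF this, of "(norm \<eta>)\<^sup>2"] quad[of "fourier (w 2 2) t - fourier (w 1 1) t" \<eta> "fourier (w 1 2) t"]
      show ?thesis unfolding q_def by simp
    qed
    have mS: "(\<lambda>\<eta>. (S \<eta> * S \<eta>) * m 0 \<eta>) \<in> schwartz" by (intro schwartz_mult multiplier_mult Sm m_schwartz)
    note [measurable] = schwartz_measurable[OF m_schwartz[of 0]] fourier_measurable[OF w]
    have [measurable]: "c \<in> borel_measurable borel" unfolding c_def[abs_def] by measurable
    show ?thesis
    proof (rule integral_dominated_convergence[where w="\<lambda>\<eta>. C * C' * norm ((S \<eta> * S \<eta>) * m 0 \<eta>)"])
      show "integrable lborel (\<lambda>\<eta>. C * C' * norm ((S \<eta> * S \<eta>) * m 0 \<eta>))"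
        by (intro integrable_mult_right integrable_norm schwartz_integrable mS)
      show "AE \<eta> in lborel. (\<lambda>n. ?G (2 powr real_of_int (- int n) *\<^sub>R \<eta>) \<eta>) \<longlonglongrightarrow> ?G 0 \<eta>"
      proof (rule AE_I2)
        fix \<eta> :: "real^2"
        have "(\<lambda>n. (1 / 2) ^ n) \<longlonglongrightarrow> (0::real)" by (intro LIMSEQ_realpow_zero) auto
        then have "(\<lambda>n. ((1 / 2) ^ n) *\<^sub>R \<eta>) \<longlonglongrightarrow> 0 *\<^sub>R \<eta>" by (rule tendsto_scaleR[OF _ tendsto_const])
        moreover have "2 powr real_of_int (- int n) = (1 / 2) ^ n" for n
          by (simp add: powr_minus powr_realpow power_one_over inverse_eq_divide)
        ultimately have "(\<lambda>n. 2 powr real_of_int (- int n) *\<^sub>R \<eta>) \<longlonglongrightarrow> 0" by simp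
        then show "(\<lambda>n. ?G (2 powr real_of_int (- int n) *\<^sub>R \<eta>) \<eta>) \<longlonglongrightarrow> ?G 0 \<eta>"
          unfolding q_def by (intro tendsto_intros fourier_tendsto w)
      qed
      show "AE \<eta> in lborel. norm (?G (2 powr real_of_int (- int n) *\<^sub>R \<eta>) \<eta>) \<le> C * C' * norm ((S \<eta> * S \<eta>) * m 0 \<eta>)" for n
      proof (rule AE_I2)
        fix \<eta> :: "real^2"
        have "norm (?G t \<eta>) \<le> C * C' * norm ((S \<eta> * S \<eta>) * m 0 \<eta>)" for t
        proof -
          have "norm (c \<eta>) * norm (q t \<eta>) \<le> (C * (norm \<eta>)\<^sup>2) * (C' * (norm \<eta>)\<^sup>2)"
            using cC[of \<eta>] qC[of t \<eta>] by (intro mult_mono order_trans[OF norm_ge_zero cC]) auto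
          then have "norm (m 0 \<eta>) * (norm (c \<eta>) * norm (q t \<eta>)) \<le> norm (m 0 \<eta>) * ((C * (norm \<eta>)\<^sup>2) * (C' * (norm \<eta>)\<^sup>2))"
            by (rule mult_left_mono) simp
          also have "\<dots> = C * C' * norm ((S \<eta> * S \<eta>) * m 0 \<eta>)"
            by (simp add: norm_mult S norm_power)
          finally show ?thesis by (simp only: norm_mult)
        qed
        then show "norm (?G (2 powr real_of_int (- int n) *\<^sub>R \<eta>) \<eta>) \<le> C * C' * norm ((S \<eta> * S \<eta>) * m 0 \<eta>)" .
      qed
      show "(\<lambda>\<eta>. ?G 0 \<eta>) \<in> borel_measurable lborel" unfolding q_def by measurable
      show "(\<lambda>\<eta>. ?G (2 powr real_of_int (- int n) *\<^sub>R \<eta>) \<eta>) \<in> borel_measurable lborel" for n unfolding q_def by measurable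
    qed
  qed
  \<comment> \<open>Here summability over the blocks enters: the terms tend to 0 as the index goes
    to minus infinity.\<close>
  have \<beta>lim: "(\<lambda>n. \<beta> (- int n)) \<longlonglongrightarrow> 0"
  proof -
    have "\<beta> summable_on range (\<lambda>n. - int n)"
      by (rule summable_on_subset_banach[OF has_sum_imp_summable[OF \<beta>]]) simp
    then have "(\<beta> \<circ> (\<lambda>n. - int n)) summable_on UNIV"
      by (subst (asm) summable_on_reindex) (auto simp: inj_on_def)
    then have "(\<lambda>n. \<beta> (- int n)) summable_on UNIV" by (simp only: o_def)
    then have "summable (\<lambda>n. \<beta> (- int n))"
      by (rule summable_on_imp_summable)
    then show ?thesis by (rule summable_LIMSEQ_zero)
  qed
  have G0: "(LINT \<eta>|lborel. ?G 0 \<eta>) = 0"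
  proof -
    have l: "(\<lambda>n. norm (LINT \<eta>|lborel. ?G (2 powr real_of_int (- int n) *\<^sub>R \<eta>) \<eta>)) \<longlonglongrightarrow> norm (LINT \<eta>|lborel. ?G 0 \<eta>)"
      by (rule tendsto_norm[OF lim1])
    have r': "(\<lambda>n. 2 * K * \<beta> (- int n)) \<longlonglongrightarrow> 2 * K * 0" by (intro tendsto_intros \<beta>lim)
    obtain N :: nat where N: "2 / r < 2 ^ N" using real_arch_pow[of 2 "2 / r"] by auto
    have "norm (LINT \<eta>|lborel. ?G 0 \<eta>) \<le> 2 * K * 0"
    proof (rule LIMSEQ_le[OF l r'], intro exI[of _ N] allI impI main)
      fix n assume "N \<le> n"
      then have "(2::real) ^ N \<le> 2 ^ n" by (intro power_increasing) auto
      with N have "2 / r < 2 ^ n" by linarith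
      then have "2 / 2 ^ n < r" using r by (simp add: field_simps)
      then show "2 powr (real_of_int (- int n) + 1) < r"
        by (simp add: powr_diff powr_realpow)
    qed
    then show ?thesis by simp
  qed
  define f where "f \<eta> = \<mu> 0 \<eta> * (norm (q 0 \<eta>))\<^sup>2" for \<eta>
  have Gf: "?G 0 \<eta> = of_real (f \<eta>)" for \<eta>
    by (simp only: c m_eq f_def of_real_mult complex_norm_square) (simp add: ac_simps)
  have f0: "f \<eta> = 0" for \<eta>
  proof (rule continuous_zero_integral)
    show "continuous_on UNIV f"
      unfolding f_def \<mu>_def q_def coord_def
      by (intro continuous_intros schwartz_continuous m_schwartz)
    show "0 \<le> f x" for x using \<mu>_bounds by (simp add: f_def)
    have q0: "(\<lambda>\<eta>. q 0 \<eta>) \<in> multiplier"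
    proof -
      have "(\<lambda>\<xi>. A * (coord 1 \<xi> * coord 2 \<xi>) + B * (coord 1 \<xi> * coord 1 \<xi> + (-1) * (coord 2 \<xi> * coord 2 \<xi>))) \<in> multiplier"
        by (intro multiplier_add multiplier_mult multiplier_const multiplier_coord)
      then show ?thesis by (simp add: q_def A_def B_def)
    qed
    have "(\<lambda>\<eta>. (c \<eta> * q 0 \<eta>) * m 0 \<eta>) \<in> schwartz"
      by (intro schwartz_mult multiplier_mult cm q0 m_schwartz)
    from schwartz_integrable[OF this] have "integrable lborel (\<lambda>\<eta>. complex_of_real (f \<eta>))"
      unfolding Gf[symmetric] by (simp add: mult.commute)
    from integrable_Re[OF this] show "integrable lborel f" by simp
    show "integral\<^sup>L lborel f = 0" using G0 unfolding Gf by simp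
  qed
  \<comment> \<open>\<open>\<mu> 0\<close> may vanish at \<xi> itself. By homogeneity of
    \<open>q 0\<close> it would then vanish at every dyadic dilate of a point where the form is
    nonzero, and the partition of unity would sum to 0 there.\<close>
  have q0: "q 0 \<xi> = 0" if x: "\<xi> \<noteq> 0" for \<xi>
  proof (rule ccontr)
    assume q: "q 0 \<xi> \<noteq> 0"
    have "\<mu> j \<xi> = 0" for j
    proof -
      let ?s = "2 powr (- real_of_int j)"
      have co: "coord k (?s *\<^sub>R \<xi>) = of_real ?s * coord k \<xi>" for k by (simp add: coord_def)
      have "q 0 (?s *\<^sub>R \<xi>) = of_real (?s\<^sup>2) * q 0 \<xi>"
        unfolding q_def co by (simp add: algebra_simps power2_eq_square)
      moreover have "\<mu> j \<xi> = \<mu> 0 (?s *\<^sub>R \<xi>)" unfolding \<mu>_def using m_scale[of j \<xi>] by simp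
      ultimately show ?thesis using f0[of "?s *\<^sub>R \<xi>"] q by (auto simp: f_def)
    qed
    then have "((\<lambda>j. 0) has_sum (1::real)) (UNIV :: int set)" using \<mu>_sum[OF x] by simp
    moreover have "((\<lambda>j. 0) has_sum (0::real)) (UNIV :: int set)" by simp
    ultimately have "(1::real) = 0" by (rule has_sum_unique)
    then show False by simp
  qed
  \<comment> \<open>The limiting form takes the value \<open>B\<close> at (1, 0) and
    \<open>A\<close> at (1, 1).\<close>
  define e1 :: "real^2" where "e1 = (\<chi> i. if i = 1 then 1 else 0)"
  define e2 :: "real^2" where "e2 = (\<chi> i. 1)"
  have "e1 $ 1 \<noteq> 0 $ 1" "e2 $ 1 \<noteq> 0 $ 1" by (simp_all add: e1_def e2_def)
  then have e: "e1 \<noteq> 0" "e2 \<noteq> 0" by metis+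
  have B0: "B = 0" using q0[OF e(1)] by (simp add: q_def B_def coord_def e1_def)
  moreover have "A = 0" using q0[OF e(2)] B0 by (simp add: q_def A_def B_def coord_def e2_def)
  ultimately show "(LINT x|lborel. w 1 2 x) = 0" and "(LINT x|lborel. w 1 1 x) = (LINT x|lborel. w 2 2 x)"
    by (auto simp: A_def B_def fourier_def)
qed

end

section \<open>The forcing term and anisotropy\<close>

lemma integrable_sq_mult:
  fixes f g :: "'a \<Rightarrow> complex"
  assumes [measurable]: "f \<in> borel_measurable M" "g \<in> borel_measurable M"
    and f: "integrable M (\<lambda>x. (norm (f x))\<^sup>2)" and g: "integrable M (\<lambda>x. (norm (g x))\<^sup>2)"
  shows "integrable M (\<lambda>x. f x * g x)"
proof (rule Bochner_Integration.integrable_bound[OF Bochner_Integration.integrable_add[OF f g]])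
  have "norm (f x * g x) \<le> norm ((norm (f x))\<^sup>2 + (norm (g x))\<^sup>2)" for x
  proof -
    have "norm (f x * g x) = norm (f x) * norm (g x)" by (rule norm_mult)
    moreover have "0 \<le> norm (f x) * norm (g x)" by simp
    moreover have "norm ((norm (f x))\<^sup>2 + (norm (g x))\<^sup>2) = (norm (f x))\<^sup>2 + (norm (g x))\<^sup>2" by simp
    ultimately show ?thesis using sum_squares_bound[of "norm (f x)" "norm (g x)"] by linarith
  qed
  then show "AE x in M. norm (f x * g x) \<le> norm ((norm (f x))\<^sup>2 + (norm (g x))\<^sup>2)" by simp
qed measurable

lemma norm_add_sq_le: "(norm (a + b))\<^sup>2 \<le> 2 * (norm a)\<^sup>2 + 2 * (norm (b :: complex))\<^sup>2"
proof -
  have "(norm (a + b))\<^sup>2 \<le> (norm a + norm b)\<^sup>2" by (intro power_mono norm_triangle_ineq) simp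
  also have "\<dots> \<le> 2 * (norm a)\<^sup>2 + 2 * (norm b)\<^sup>2"
    using sum_squares_bound[of "norm a" "norm b"] by (simp add: power2_sum)
  finally show ?thesis .
qed

lemma integrable_sq_add:
  fixes f g :: "'a \<Rightarrow> complex"
  assumes [measurable]: "f \<in> borel_measurable M" "g \<in> borel_measurable M"
    and f: "integrable M (\<lambda>x. (norm (f x))\<^sup>2)" and g: "integrable M (\<lambda>x. (norm (g x))\<^sup>2)"
  shows "integrable M (\<lambda>x. (norm (f x + g x))\<^sup>2)"
    and "(LINT x|M. (norm (f x + g x))\<^sup>2) \<le> 2 * (LINT x|M. (norm (f x))\<^sup>2) + 2 * (LINT x|M. (norm (g x))\<^sup>2)"
proof -
  have s: "integrable M (\<lambda>x. 2 * (norm (f x))\<^sup>2 + 2 * (norm (g x))\<^sup>2)"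
    using f g by simp
  show i: "integrable M (\<lambda>x. (norm (f x + g x))\<^sup>2)"
    by (rule Bochner_Integration.integrable_bound[OF s]) (auto intro!: order_trans[OF norm_add_sq_le])
  have "(LINT x|M. (norm (f x + g x))\<^sup>2) \<le> (LINT x|M. 2 * (norm (f x))\<^sup>2 + 2 * (norm (g x))\<^sup>2)"
    by (rule integral_mono[OF i s norm_add_sq_le])
  then show "(LINT x|M. (norm (f x + g x))\<^sup>2) \<le> 2 * (LINT x|M. (norm (f x))\<^sup>2) + 2 * (LINT x|M. (norm (g x))\<^sup>2)"
    using f g by simp
qed

text \<open>The square of v1 + \<i> v2 integrates to the difference of the diagonal entries plus 2
  \<i> times the off-diagonal one, so a nonzero value rules out a multiple of the identity. Being
  quadratic, this functional is stable under small L^2 perturbations; smallness is relative to the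
  perturbed field, the form in which the remainder estimate arrives.\<close>

lemma anisotropy_persists:
  fixes v1 v2 :: "'a::euclidean_space \<Rightarrow> complex"
  assumes vm [measurable]: "v1 \<in> borel_measurable M" "v2 \<in> borel_measurable M"
    and v1: "integrable M (\<lambda>x. (norm (v1 x))\<^sup>2)" and v2: "integrable M (\<lambda>x. (norm (v2 x))\<^sup>2)"
    and Z: "(LINT x|M. (v1 x + \<i> * v2 x)\<^sup>2) \<noteq> 0"
  obtains \<kappa> :: real where "0 < \<kappa>"
    and "\<And>\<epsilon> r1 r2. 0 < \<epsilon> \<Longrightarrow> r1 \<in> borel_measurable M \<Longrightarrow> r2 \<in> borel_measurable M \<Longrightarrow>
      integrable M (\<lambda>x. (norm (r1 x))\<^sup>2) \<Longrightarrow> integrable M (\<lambda>x. (norm (r2 x))\<^sup>2) \<Longrightarrow>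
      (LINT x|M. (norm (r1 x))\<^sup>2) + (LINT x|M. (norm (r2 x))\<^sup>2) \<le>
        \<kappa> * ((LINT x|M. (norm (of_real \<epsilon> * v1 x + r1 x))\<^sup>2) + (LINT x|M. (norm (of_real \<epsilon> * v2 x + r2 x))\<^sup>2)) \<Longrightarrow>
      (LINT x|M. ((of_real \<epsilon> * v1 x + r1 x) + \<i> * (of_real \<epsilon> * v2 x + r2 x))\<^sup>2) \<noteq> 0"
proof -
  let ?E1 = "LINT x|M. (norm (v1 x))\<^sup>2" and ?E2 = "LINT x|M. (norm (v2 x))\<^sup>2"
  define E where "E = ?E1 + ?E2"
  define z where "z = norm (LINT x|M. (v1 x + \<i> * v2 x)\<^sup>2)"
  \<comment> \<open>\<open>\<tau>\<close> weights the mixed term. Both constants are chosen so that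
    each of the two error terms is at most z/4, against a main term z; the bound 1/4 on
    \<open>\<kappa>\<close> serves to absorb \<open>R\<close> first.\<close>
  define \<tau> where "\<tau> = z / (8 * (E + 1))"
  define \<kappa> where "\<kappa> = min (1 / 4) (z / (32 * (1 + 1 / \<tau>) * (E + 1)))"
  have E0: "0 \<le> E" by (simp add: E_def)
  have z0: "0 < z" using Z by (simp add: z_def)
  have \<tau>0: "0 < \<tau>" using z0 E0 by (simp add: \<tau>_def)
  have "0 < 1 + 1 / \<tau>" "0 < E + 1" using E0 \<tau>0 by (auto simp: add_pos_pos)
  then have \<kappa>0: "0 < \<kappa>" using z0 unfolding \<kappa>_def min_less_iff_conj by (intro conjI divide_pos_pos mult_pos_pos) auto
  show ?thesis
  proof (rule that[OF \<kappa>0])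
    fix \<epsilon> :: real and r1 r2 :: "'a \<Rightarrow> complex"
    assume \<epsilon>: "0 < \<epsilon>" and [measurable]: "r1 \<in> borel_measurable M" "r2 \<in> borel_measurable M"
      and r1: "integrable M (\<lambda>x. (norm (r1 x))\<^sup>2)" and r2: "integrable M (\<lambda>x. (norm (r2 x))\<^sup>2)"
      and r: "(LINT x|M. (norm (r1 x))\<^sup>2) + (LINT x|M. (norm (r2 x))\<^sup>2) \<le>
        \<kappa> * ((LINT x|M. (norm (of_real \<epsilon> * v1 x + r1 x))\<^sup>2) + (LINT x|M. (norm (of_real \<epsilon> * v2 x + r2 x))\<^sup>2))"
    define R where "R = (LINT x|M. (norm (r1 x))\<^sup>2) + (LINT x|M. (norm (r2 x))\<^sup>2)"
    have R0: "0 \<le> R" by (simp add: R_def)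
    have ev: "integrable M (\<lambda>x. (norm (of_real \<epsilon> * v x))\<^sup>2)" "(LINT x|M. (norm (of_real \<epsilon> * v x))\<^sup>2) = \<epsilon>\<^sup>2 * (LINT x|M. (norm (v x))\<^sup>2)"
      if "integrable M (\<lambda>x. (norm (v x))\<^sup>2)" for v :: "'a \<Rightarrow> complex"
      using that by (simp_all add: norm_mult power_mult_distrib)
    have "R \<le> \<kappa> * (2 * \<epsilon>\<^sup>2 * E + 2 * R)"
    proof -
      have "(LINT x|M. (norm (of_real \<epsilon> * v1 x + r1 x))\<^sup>2) + (LINT x|M. (norm (of_real \<epsilon> * v2 x + r2 x))\<^sup>2) \<le> 2 * \<epsilon>\<^sup>2 * E + 2 * R"
        using integrable_sq_add(2)[OF _ _ ev(1)[OF v1] r1] integrable_sq_add(2)[OF _ _ ev(1)[OF v2] r2]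
        by (simp add: ev(2)[OF v1] ev(2)[OF v2] E_def R_def algebra_simps)
      with r \<kappa>0 show ?thesis unfolding R_def[symmetric] by (meson mult_left_mono less_imp_le order_trans)
    qed
    also have "\<dots> = 2 * \<kappa> * \<epsilon>\<^sup>2 * E + (2 * \<kappa>) * R" by (simp add: algebra_simps)
    also have "(2 * \<kappa>) * R \<le> (1 / 2) * R" using R0 by (intro mult_right_mono) (auto simp: \<kappa>_def)
    finally have RE: "R \<le> 4 * \<kappa> * \<epsilon>\<^sup>2 * E" by simp
    define b where "b x = v1 x + \<i> * v2 x" for x
    define h where "h x = r1 x + \<i> * r2 x" for x
    have [measurable]: "b \<in> borel_measurable M" "h \<in> borel_measurable M" unfolding b_def h_def by measurable
    have i_sq: "integrable M (\<lambda>x. (norm (\<i> * f x))\<^sup>2) = integrable M (\<lambda>x. (norm (f x))\<^sup>2)" for f :: "'a \<Rightarrow> complex"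
      by (simp add: norm_mult)
    have b: "integrable M (\<lambda>x. (norm (b x))\<^sup>2)" "(LINT x|M. (norm (b x))\<^sup>2) \<le> 2 * E"
      using integrable_sq_add[of v1 M "\<lambda>x. \<i> * v2 x"] v1 v2 unfolding b_def by (simp_all add: norm_mult E_def)
    have h: "integrable M (\<lambda>x. (norm (h x))\<^sup>2)" "(LINT x|M. (norm (h x))\<^sup>2) \<le> 2 * R"
      using integrable_sq_add[of r1 M "\<lambda>x. \<i> * r2 x"] r1 r2 unfolding h_def by (simp_all add: norm_mult R_def)
    have bb: "integrable M (\<lambda>x. (b x)\<^sup>2)" and bh: "integrable M (\<lambda>x. b x * h x)" and hh: "integrable M (\<lambda>x. (h x)\<^sup>2)"
      unfolding power2_eq_square by (intro integrable_sq_mult b h; measurable)+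
    let ?g = "\<lambda>x. 2 * of_real \<epsilon> * (b x * h x) + (h x)\<^sup>2"
    have ig: "integrable M ?g" using bh hh by (intro Bochner_Integration.integrable_add integrable_mult_right)
    have sq: "((of_real \<epsilon> * v1 x + r1 x) + \<i> * (of_real \<epsilon> * v2 x + r2 x))\<^sup>2 = of_real (\<epsilon>\<^sup>2) * (b x)\<^sup>2 + ?g x" for x
      by (simp add: b_def h_def power2_eq_square algebra_simps)
    show "(LINT x|M. ((of_real \<epsilon> * v1 x + r1 x) + \<i> * (of_real \<epsilon> * v2 x + r2 x))\<^sup>2) \<noteq> 0"
    proof
      assume "(LINT x|M. ((of_real \<epsilon> * v1 x + r1 x) + \<i> * (of_real \<epsilon> * v2 x + r2 x))\<^sup>2) = 0"
      then have "(LINT x|M. of_real (\<epsilon>\<^sup>2) * (b x)\<^sup>2) + (LINT x|M. ?g x) = 0"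
        unfolding sq by (subst (asm) Bochner_Integration.integral_add[OF integrable_mult_right[OF bb] ig])
      then have "of_real (\<epsilon>\<^sup>2) * (LINT x|M. (b x)\<^sup>2) = - (LINT x|M. ?g x)"
        by (simp only: integral_mult_right_zero eq_neg_iff_add_eq_0)
      then have "norm (of_real (\<epsilon>\<^sup>2) * (LINT x|M. (b x)\<^sup>2)) = norm (LINT x|M. ?g x)" by (simp only: norm_minus_cancel)
      then have "\<epsilon>\<^sup>2 * z = norm (LINT x|M. ?g x)" by (simp add: norm_mult norm_power z_def b_def)
      also have "\<dots> \<le> (LINT x|M. \<tau> * \<epsilon>\<^sup>2 * (norm (b x))\<^sup>2 + (1 + 1 / \<tau>) * (norm (h x))\<^sup>2)"
      proof (rule Bochner_Integration.integral_norm_bound_integral[OF ig])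
        show "integrable M (\<lambda>x. \<tau> * \<epsilon>\<^sup>2 * (norm (b x))\<^sup>2 + (1 + 1 / \<tau>) * (norm (h x))\<^sup>2)"
          by (intro Bochner_Integration.integrable_add integrable_mult_right b h)
        fix x
        have "norm (?g x) \<le> 2 * \<epsilon> * norm (b x) * norm (h x) + (norm (h x))\<^sup>2"
          using \<epsilon> by (intro norm_triangle_le) (simp add: norm_mult norm_power)
        moreover have "0 \<le> (\<tau> * (\<epsilon> * norm (b x)) - norm (h x))\<^sup>2 / \<tau>" using \<tau>0 by simp
        then have "2 * \<epsilon> * norm (b x) * norm (h x) \<le> \<tau> * \<epsilon>\<^sup>2 * (norm (b x))\<^sup>2 + 1 / \<tau> * (norm (h x))\<^sup>2"
          using \<tau>0 by (simp add: power2_diff power_mult_distrib add_divide_distrib diff_divide_distrib) (simp add: power2_eq_square mult.assoc)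
        ultimately show "norm (?g x) \<le> \<tau> * \<epsilon>\<^sup>2 * (norm (b x))\<^sup>2 + (1 + 1 / \<tau>) * (norm (h x))\<^sup>2"
          by (simp add: distrib_right)
      qed
      also have "\<dots> = \<tau> * \<epsilon>\<^sup>2 * (LINT x|M. (norm (b x))\<^sup>2) + (1 + 1 / \<tau>) * (LINT x|M. (norm (h x))\<^sup>2)"
        by (subst Bochner_Integration.integral_add[OF integrable_mult_right[OF b(1)] integrable_mult_right[OF h(1)]]) simp
      also have "\<dots> \<le> \<tau> * \<epsilon>\<^sup>2 * (2 * E) + (1 + 1 / \<tau>) * (2 * (4 * \<kappa> * \<epsilon>\<^sup>2 * E))"
        using b(2) h(2) RE \<tau>0 by (intro add_mono mult_left_mono) auto
      also have "\<dots> = \<epsilon>\<^sup>2 * (2 * \<tau> * E + \<kappa> * (8 * (1 + 1 / \<tau>) * E))" by (simp add: algebra_simps)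
      finally have "z \<le> 2 * \<tau> * E + \<kappa> * (8 * (1 + 1 / \<tau>) * E)" using \<epsilon> by simp
      also have "2 * \<tau> * E \<le> z / 4"
      proof -
        have "2 * \<tau> * E \<le> 2 * \<tau> * (E + 1)" using \<tau>0 by (intro mult_left_mono) auto
        also have "\<dots> = z / 4"
        proof -
          have "2 * (z / (8 * w)) * w = z / 4" if "0 < w" for w :: real using that by (simp add: field_simps)
          from this[of "E + 1"] E0 show ?thesis by (simp only: \<tau>_def)
        qed
        finally show ?thesis .
      qed
      also have "\<kappa> * (8 * (1 + 1 / \<tau>) * E) \<le> z / 4"
      proof -
        have t: "0 < 1 + 1 / \<tau>" using \<tau>0 by (simp add: add_pos_pos)
        have "\<kappa> * (8 * (1 + 1 / \<tau>) * E) \<le> z / (32 * (1 + 1 / \<tau>) * (E + 1)) * (8 * (1 + 1 / \<tau>) * (E + 1))"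
          using t E0 z0 by (intro mult_mono) (auto simp: \<kappa>_def)
        also have "\<dots> = z / 4"
        proof -
          have "x / (32 * y * w) * (8 * y * w) = x / 4" if "0 < y" "0 < w" for x y w :: real
            using that by (simp add: field_simps)
          from this[OF t, of "E + 1" z] E0 show ?thesis by simp
        qed
        finally show ?thesis .
      qed
      finally show False using z0 by simp
    qed
  qed
qed

text \<open>Pairing with an integrable function is bounded by the supremum, which is the seminorm of
  order 0.\<close>

lemma schwartz_tempered:
  assumes f: "f \<in> schwartz" and T: "represents f T" shows "T \<in> tempered"
proof -
  have i: "integrable lborel (\<lambda>x. f x * \<phi> x)" if "\<phi> \<in> schwartz" for \<phi>
    using T that unfolding represents_def by blast
  have Te: "T \<phi> = (if \<phi> \<in> schwartz then LINT x|lborel. f x * \<phi> x else 0)" for \<phi>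
    using T unfolding represents_def on_schwartz_def by simp
  have "norm (T \<phi>) \<le> (LINT x|lborel. norm (f x)) * schwartz_seminorm 0 \<phi>" if \<phi>: "\<phi> \<in> schwartz" for \<phi>
  proof -
    obtain C where C: "\<And>x. (1 + norm x) ^ 0 * norm (\<phi> x) \<le> C" using schwartz_rapid[OF \<phi>] by metis
    have s: "schwartz_seminorm 0 \<phi> = (SUP x. norm (\<phi> x))"
      by (simp add: schwartz_seminorm_def)
    have le: "norm (\<phi> x) \<le> schwartz_seminorm 0 \<phi>" for x
      unfolding s using C by (intro cSUP_upper bdd_aboveI2[where M=C]) auto
    have "norm (LINT x|lborel. f x * \<phi> x) \<le> (LINT x|lborel. norm (f x) * schwartz_seminorm 0 \<phi>)"
      by (rule Bochner_Integration.integral_norm_bound_integral[OF i[OF \<phi>]])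
         (use le schwartz_integrable[OF f] in \<open>auto simp: norm_mult intro!: mult_left_mono\<close>)
    then show ?thesis using \<phi> by (simp add: Te)
  qed
  then have "\<exists>C k. \<forall>\<phi>\<in>schwartz. norm (T \<phi>) \<le> C * schwartz_seminorm k \<phi>" by blast
  moreover have "T (\<lambda>x. \<phi> x + \<psi> x) = T \<phi> + T \<psi>" if "\<phi> \<in> schwartz" "\<psi> \<in> schwartz" for \<phi> \<psi>
    using that i[OF that(1)] i[OF that(2)] schwartz_add[OF that] by (simp add: Te distrib_left)
  moreover have "T (\<lambda>x. c * \<phi> x) = c * T \<phi>" if "\<phi> \<in> schwartz" for c \<phi>
    using that schwartz_cmult[OF that] by (simp add: Te mult.left_commute)
  ultimately show ?thesis unfolding tempered_def using Te by auto
qed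

lemma represents_schwartz: "f \<in> schwartz \<Longrightarrow> represents f (on_schwartz (\<lambda>\<phi>. LINT x|lborel. f x * \<phi> x))"
  unfolding represents_def using schwartz_integrable_mult schwartz_measurable by auto

lemma represents_scaled:
  assumes "f \<in> schwartz"
  shows "represents (\<lambda>x. c * f x) (on_schwartz (\<lambda>\<phi>. LINT x|lborel. (c * f x) * \<phi> x))"
  using represents_schwartz[OF schwartz_cmult[OF assms, of c]] .

lemma Lp_norm_scaled:
  fixes n :: "'a \<Rightarrow> real"
  assumes p: "1 \<le> p" and \<epsilon>: "0 \<le> \<epsilon>" and n0: "\<And>x. 0 \<le> n x" and n: "integrable M (\<lambda>x. n x powr p)"
  shows "Lp_norm M (ennreal p) (\<lambda>x. ennreal (\<epsilon> * n x)) = ennreal (\<epsilon> * (LINT x|M. n x powr p) powr (1 / p))"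
proof -
  let ?J = "LINT x|M. n x powr p"
  have J0: "0 \<le> ?J" by simp
  have "ennreal_powr (ennreal (\<epsilon> * n x)) p = ennreal (\<epsilon> powr p * n x powr p)" for x
    using n0[of x] \<epsilon> by (simp add: ennreal_powr_def powr_mult)
  then have "Lp_norm M (ennreal p) (\<lambda>x. ennreal (\<epsilon> * n x)) = ennreal_powr (\<integral>\<^sup>+x. ennreal (\<epsilon> powr p * n x powr p) \<partial>M) (1 / p)"
    using p by (simp add: Lp_norm_def)
  also have "(\<integral>\<^sup>+x. ennreal (\<epsilon> powr p * n x powr p) \<partial>M) = ennreal (\<epsilon> powr p * ?J)"
    using n by (subst nn_integral_eq_integral) auto
  also have "ennreal_powr (ennreal (\<epsilon> powr p * ?J)) (1 / p) = ennreal ((\<epsilon> powr p * ?J) powr (1 / p))"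
    using J0 by (simp add: ennreal_powr_def)
  also have "(\<epsilon> powr p * ?J) powr (1 / p) = \<epsilon> * ?J powr (1 / p)"
    using p \<epsilon> J0 by (simp add: powr_mult powr_powr)
  finally show ?thesis .
qed

text \<open>The power p is dominated by the first power below 1 and by the square above 1.\<close>

lemma integrable_powr_between:
  fixes n :: "'a \<Rightarrow> real"
  assumes p: "1 \<le> p" "p \<le> 2" and n0: "\<And>x. 0 \<le> n x" and [measurable]: "n \<in> borel_measurable M"
    and n1: "integrable M n" and n2: "integrable M (\<lambda>x. (n x)\<^sup>2)"
  shows "integrable M (\<lambda>x. n x powr p)"
proof (rule Bochner_Integration.integrable_bound[OF Bochner_Integration.integrable_add[OF n1 n2]])
  have "n x powr p \<le> n x + (n x)\<^sup>2" for x
  proof (cases "n x = 0")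
    case False
    then have x: "0 < n x" using n0[of x] by linarith
    show ?thesis
    proof (cases "n x \<le> 1")
      case True
      then have "n x powr p \<le> n x powr 1" using x p by (intro powr_mono') auto
      then show ?thesis using x by (simp add: add_increasing2)
    next
      case False
      then have "n x powr p \<le> n x powr 2" using p by (intro powr_mono) auto
      then show ?thesis using x by (simp add: powr_numeral add_increasing)
    qed
  qed simp
  then show "AE x in M. norm (n x powr p) \<le> norm (n x + (n x)\<^sup>2)"
    using n0 by (simp add: abs_of_nonneg)
qed measurable

section \<open>The explicit force and its Besov norms\<close>

context littlewood_paley_family begin

definition sq :: "real^2 \<Rightarrow> complex" where "sq \<xi> = coord 1 \<xi> * coord 1 \<xi> + coord 2 \<xi> * coord 2 \<xi>"

lemma sq_eq: "sq \<xi> = of_real ((norm \<xi>)\<^sup>2)"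
  unfolding sq_def coord_def norm_sq_2 by (simp add: power2_eq_square)

lemma sq_multiplier: "sq \<in> multiplier"
  unfolding sq_def[abs_def] by (intro multiplier_add multiplier_mult multiplier_coord)

text \<open>The stream function carries the factor \<open>\<xi>\<^sub>1 - \<i> \<xi>\<^sub>2\<close>, so that the first component plus \<open>\<i>\<close> times the
  second is \<open>- \<i> |\<xi>|\<^sup>2\<close> times a nonnegative function. This makes the anisotropy of the flow visible
  without any symmetry assumption on \<open>\<Phi>\<close>; the force is complex valued.\<close>

definition amp :: "2 \<Rightarrow> real^2 \<Rightarrow> complex"
  where "amp i \<xi> = ((if i = 1 then coord 2 \<xi> else (-1) * coord 1 \<xi>) * (coord 1 \<xi> + (- \<i>) * coord 2 \<xi>)) * fat 0 \<xi>"

lemma amp_annular: "annular (amp i)"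
proof -
  have "(\<lambda>\<xi>. (if i = 1 then coord 2 \<xi> else (-1) * coord 1 \<xi>) * (coord 1 \<xi> + (- \<i>) * coord 2 \<xi>)) \<in> multiplier"
  proof -
    have "(\<lambda>\<xi>. (-1) * coord 1 \<xi>) \<in> multiplier"
      by (rule multiplier_mult[OF multiplier_const multiplier_coord])
    then have "(\<lambda>\<xi>. if i = 1 then coord 2 \<xi> else (-1) * coord 1 \<xi>) \<in> multiplier"
      using multiplier_coord[of 2] by (cases "i = 1") simp_all
    then show ?thesis
      by (intro multiplier_mult multiplier_add multiplier_const multiplier_coord)
  qed
  from annular_mult[OF this annular_window] show ?thesis unfolding amp_def[abs_def] by simp
qed

text \<open>\<open>amp\<close> is the rotated frequency vector times a scalar, so the projection
  leaves it unchanged.\<close>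

lemma amp_solenoidal: "coord 1 \<xi> * amp 1 \<xi> + coord 2 \<xi> * amp 2 \<xi> = 0"
  by (simp add: amp_def algebra_simps)

lemma amp_support:
  assumes "amp i \<xi> \<noteq> 0" shows "1 / 8 \<le> norm \<xi>"
proof -
  have "fat 0 \<xi> \<noteq> 0" using assms by (auto simp: amp_def)
  from fat_support(1)[OF this] show ?thesis by (simp add: powr_minus powr_realpow)
qed

text \<open>Transposition turns the integral of the square into that of B(-\<xi>) B(\<xi>), up to a
  constant and with no conjugate. As \<open>B\<close> is -\<i> |\<xi>|^2 times a nonnegative
  function, this product is nonpositive, and it is nonzero at unit vectors, where
  \<open>fat 0\<close> equals 1.\<close>

lemma amp_anisotropic: "(LINT x|lborel. (inv_fourier (amp 1) x + \<i> * inv_fourier (amp 2) x)\<^sup>2) \<noteq> 0"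
proof
  define B where "B \<xi> = amp 1 \<xi> + \<i> * amp 2 \<xi>" for \<xi>
  have S: "amp i \<in> schwartz" for i by (rule annular_schwartz[OF amp_annular])
  have BS: "B \<in> schwartz" unfolding B_def[abs_def] by (intro schwartz_add schwartz_cmult S)
  have B: "B \<xi> = - \<i> * (sq \<xi> * fat 0 \<xi>)" for \<xi>
    by (simp add: B_def amp_def sq_def algebra_simps)
  have inv: "inv_fourier (amp 1) x + \<i> * inv_fourier (amp 2) x = inv_fourier B x" for x
    unfolding inv_fourier_eq B_def
    by (subst fourier_add) (auto simp: fourier_cmult add_divide_distrib intro!: schwartz_integrable S integrable_mult_right)
  define f where "f \<xi> = (norm \<xi>) ^ 4 * (Re (fat 0 \<xi>) * Re (fat 0 (- \<xi>)))" for \<xi>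
  assume "(LINT x|lborel. (inv_fourier (amp 1) x + \<i> * inv_fourier (amp 2) x)\<^sup>2) = 0"
  then have "0 = (LINT x|lborel. inv_fourier B x * inv_fourier B x)" by (simp add: inv power2_eq_square)
  also have "\<dots> = (LINT x|lborel. fourier (\<lambda>\<xi>. (1 / (2 * pi)\<^sup>2) * B (- \<xi>)) x * inv_fourier B x)"
    unfolding fourier_cmult fourier_reflect by (simp add: inv_fourier_eq)
  also have "\<dots> = (LINT \<xi>|lborel. ((1 / (2 * pi)\<^sup>2) * B (- \<xi>)) * fourier (inv_fourier B) \<xi>)"
    by (intro fourier_transpose schwartz_integrable schwartz_cmult schwartz_reflect BS inv_fourier_schwartz)
  also have "\<dots> = (LINT \<xi>|lborel. (- 1 / (2 * pi)\<^sup>2) * complex_of_real (f \<xi>))"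
  proof (intro Bochner_Integration.integral_cong refl)
    fix \<xi>
    have r: "fat 0 \<xi> = of_real (Re (fat 0 \<xi>))" for \<xi> unfolding window_eq by simp
    have "B (- \<xi>) * B \<xi> = (- \<i> * - \<i>) * ((sq \<xi> * sq (- \<xi>)) * (fat 0 \<xi> * fat 0 (- \<xi>)))"
      unfolding B by (simp only: ac_simps)
    also have "\<dots> = - of_real (f \<xi>)"
      unfolding sq_eq f_def using r[of \<xi>] r[of "- \<xi>"]
      by (simp add: power4_eq_xxxx power2_eq_square)
    finally show "((1 / (2 * pi)\<^sup>2) * B (- \<xi>)) * fourier (inv_fourier B) \<xi> = (- 1 / (2 * pi)\<^sup>2) * complex_of_real (f \<xi>)"
      by (simp add: fourier_inv_fourier[OF BS])
  qed
  also have "\<dots> = (- 1 / (2 * pi)\<^sup>2) * complex_of_real (integral\<^sup>L lborel f)"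
    by (simp only: integral_mult_right_zero integral_complex_of_real)
  finally have z: "integral\<^sup>L lborel f = 0" by simp
  have rw: "fat 0 \<in> schwartz" "(\<lambda>\<xi>. fat 0 (- \<xi>)) \<in> schwartz"
    by (auto intro: window_schwartz schwartz_reflect)
  have "f (axis 1 1) = 0"
  proof (rule continuous_zero_integral[OF _ _ _ z])
    show "continuous_on UNIV f"
      unfolding f_def by (intro continuous_intros schwartz_continuous rw)
    show "0 \<le> f x" for x
      unfolding f_def window_eq using window_bounds by simp
    have "(\<lambda>\<xi>. (sq \<xi> * sq \<xi>) * (fat 0 \<xi> * fat 0 (- \<xi>))) \<in> schwartz"
      by (intro schwartz_mult[of _ "\<lambda>\<xi>. fat 0 \<xi> * fat 0 (- \<xi>)"] multiplier_mult sq_multiplier schwartz_mult schwartz_multiplier rw)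
    from integrable_Re[OF schwartz_integrable[OF this]] show "integrable lborel f"
      unfolding f_def sq_eq window_eq by (simp add: power4_eq_xxxx power2_eq_square mult.assoc)
  qed
  moreover have "fat 0 \<xi> = 1" if "norm \<xi> = 1" for \<xi>
  proof (rule window_eq_1)
    show "\<xi> \<noteq> 0" using that by auto
    show "m k \<xi> = 0" if "k \<notin> {0 - 2..0 + 2}" for k
    proof (rule ccontr)
      assume "m k \<xi> \<noteq> 0"
      from m_support[OF this] have le: "2 powr (real_of_int k - 1) \<le> 2 powr (0::real)" "2 powr (0::real) \<le> 2 powr (real_of_int k + 1)"
        using \<open>norm \<xi> = 1\<close> by auto
      have "real_of_int k - 1 \<le> 0" "0 \<le> real_of_int k + 1"
        by (rule iffD1[OF powr_le_cancel_iff le(1)], simp) (rule iffD1[OF powr_le_cancel_iff le(2)], simp)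
      then show False using \<open>k \<notin> {0 - 2..0 + 2}\<close> by auto
    qed
  qed simp
  ultimately show False by (simp add: f_def)
qed

text \<open>\<open>sq\<close> is the symbol of -\<Delta>, so the Stokes flow driven by this force
  has \<open>amp\<close> as its transform.\<close>

definition force_profile :: "2 \<Rightarrow> real^2 \<Rightarrow> complex" where "force_profile i = inv_fourier (\<lambda>\<xi>. sq \<xi> * amp i \<xi>)"

definition force :: "real \<Rightarrow> functional^2"
  where "force \<epsilon> = (\<chi> i. on_schwartz (\<lambda>\<phi>. LINT x|lborel. (of_real \<epsilon> * force_profile i x) * \<phi> x))"

lemma sq_amp_annular: "annular (\<lambda>\<xi>. sq \<xi> * amp i \<xi>)"
  by (intro annular_mult sq_multiplier amp_annular)

lemma force_profile_schwartz: "force_profile i \<in> schwartz"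
  unfolding force_profile_def by (intro inv_fourier_schwartz annular_schwartz sq_amp_annular)

lemma fourier_force_profile: "fourier (force_profile i) \<xi> = sq \<xi> * amp i \<xi>"
  unfolding force_profile_def by (simp add: fourier_inv_fourier annular_schwartz sq_amp_annular)

lemma represents_force: "represents (\<lambda>x. of_real \<epsilon> * force_profile i x) (force \<epsilon> $ i)"
  unfolding force_def vec_lambda_beta by (rule represents_scaled[OF force_profile_schwartz])

lemma fourier_rep_force: "fourier_rep (force \<epsilon> $ i) (\<lambda>\<xi>. of_real \<epsilon> * (sq \<xi> * amp i \<xi>))"
  using fourier_rep_represents[OF represents_force schwartz_integrable[OF schwartz_cmult[OF force_profile_schwartz]]]
  by (simp add: fourier_cmult[abs_def] fourier_force_profile)

definition block_profile :: "int \<Rightarrow> 2 \<Rightarrow> real^2 \<Rightarrow> complex"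
  where "block_profile j i = inv_fourier (\<lambda>\<xi>. m j \<xi> * (sq \<xi> * amp i \<xi>))"

lemma block_annular: "annular (\<lambda>\<xi>. m j \<xi> * (sq \<xi> * amp i \<xi>))"
  by (intro annular_mult[OF schwartz_multiplier[OF m_schwartz]] sq_amp_annular)

lemma block_profile_schwartz: "block_profile j i \<in> schwartz"
  unfolding block_profile_def by (intro inv_fourier_schwartz annular_schwartz block_annular)

lemma fourier_block_profile: "fourier (block_profile j i) \<xi> = m j \<xi> * (sq \<xi> * amp i \<xi>)"
  unfolding block_profile_def by (simp add: fourier_inv_fourier annular_schwartz block_annular)

lemma lp_block_force:
  "lp_block \<Phi> j (force \<epsilon> $ i) = on_schwartz (\<lambda>\<phi>. LINT x|lborel. (of_real \<epsilon> * block_profile j i x) * \<phi> x)"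
proof
  fix \<phi>
  show "lp_block \<Phi> j (force \<epsilon> $ i) \<phi> = on_schwartz (\<lambda>\<phi>. LINT x|lborel. (of_real \<epsilon> * block_profile j i x) * \<phi> x) \<phi>"
  proof (cases "\<phi> \<in> schwartz")
    case False then show ?thesis by (simp add: lp_block_def inv_fourier_dist_def on_schwartz_def)
  next
    case True
    define \<theta> where "\<theta> = inv_fourier \<phi>"
    have \<theta>: "\<theta> \<in> schwartz" "fourier \<theta> = \<phi>"
      by (auto simp: \<theta>_def inv_fourier_schwartz fourier_inv_fourier True)
    have "lp_block \<Phi> j (force \<epsilon> $ i) \<phi> = (force \<epsilon> $ i) (fourier (\<lambda>\<xi>. m j \<xi> * \<theta> \<xi>))"
      using lp_block_fourier[OF \<theta>(1)] by (simp add: \<theta>(2))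
    also have "\<dots> = (LINT \<xi>|lborel. of_real \<epsilon> * (sq \<xi> * amp i \<xi>) * (m j \<xi> * \<theta> \<xi>))"
      by (rule fourier_repD(2)[OF fourier_rep_force]) (intro annular_m_mult schwartz_multiplier \<theta>)
    also have "\<dots> = of_real \<epsilon> * (LINT \<xi>|lborel. fourier (block_profile j i) \<xi> * \<theta> \<xi>)"
      unfolding fourier_block_profile by (simp add: ac_simps flip: integral_mult_right_zero)
    also have "\<dots> = of_real \<epsilon> * (LINT x|lborel. block_profile j i x * \<phi> x)"
      using fourier_transpose[OF schwartz_integrable[OF block_profile_schwartz] schwartz_integrable[OF \<theta>(1)]] by (simp add: \<theta>(2))
    also have "\<dots> = (LINT x|lborel. (of_real \<epsilon> * block_profile j i x) * \<phi> x)"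
      by (simp add: mult.assoc)
    finally show ?thesis using True by (simp add: on_schwartz_def)
  qed
qed

text \<open>A transform living on an annulus meets finitely many blocks, which puts the force into
  the spaces of every regularity.\<close>

lemma force_blocks:
  obtains J where "finite J" "\<And>j i. j \<notin> J \<Longrightarrow> block_profile j i = (\<lambda>x. 0)"
    "\<And>i \<xi>. window J \<xi> * (sq \<xi> * amp i \<xi>) = sq \<xi> * amp i \<xi>"
proof -
  obtain J1 where J1: "finite J1" "\<And>k \<xi>. k \<notin> J1 \<Longrightarrow> m k \<xi> * (sq \<xi> * amp 1 \<xi>) = 0" "\<And>\<xi>. window J1 \<xi> * (sq \<xi> * amp 1 \<xi>) = sq \<xi> * amp 1 \<xi>"
    using annular_finite[OF sq_amp_annular[of 1]] by blast
  obtain J2 where J2: "finite J2" "\<And>k \<xi>. k \<notin> J2 \<Longrightarrow> m k \<xi> * (sq \<xi> * amp 2 \<xi>) = 0" "\<And>\<xi>. window J2 \<xi> * (sq \<xi> * amp 2 \<xi>) = sq \<xi> * amp 2 \<xi>"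
    using annular_finite[OF sq_amp_annular[of 2]] by blast
  have 0: "m k \<xi> * (sq \<xi> * amp i \<xi>) = 0" if "k \<notin> J1 \<union> J2" for k \<xi> i
    using J1(2)[of k \<xi>] J2(2)[of k \<xi>] that exhaust_2[of i] by auto
  show ?thesis
  proof (rule that[of "J1 \<union> J2"])
    show "finite (J1 \<union> J2)" using J1 J2 by simp
    show "block_profile j i = (\<lambda>x. 0)" if "j \<notin> J1 \<union> J2" for j i
      unfolding block_profile_def 0[OF that] by (simp add: inv_fourier_eq fourier_zero fun_eq_iff)
    show "window (J1 \<union> J2) \<xi> * (sq \<xi> * amp i \<xi>) = sq \<xi> * amp i \<xi>" for i \<xi>
    proof (cases "sq \<xi> * amp i \<xi> = 0")
      case False
      have "window (J1 \<union> J2) \<xi> = 1"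
      proof (rule window_eq_1)
        show "finite (J1 \<union> J2)" using J1 J2 by simp
        show "\<xi> \<noteq> 0" using False by (auto simp: sq_eq)
        show "m k \<xi> = 0" if "k \<notin> J1 \<union> J2" for k using 0[OF that, of \<xi> i] False by simp
      qed
      then show ?thesis by simp
    qed simp
  qed
qed

text \<open>Block norms are homogeneous in \<epsilon> and finitely many are nonzero. The constant
  also serves \<epsilon> = 0, from which the facts about the zero field are read off.\<close>

lemma besov_norm_force:
  assumes p: "1 \<le> p" "p \<le> 2"
  obtains C where "0 \<le> C" "\<And>\<epsilon>. 0 \<le> \<epsilon> \<Longrightarrow> besov_norm \<Phi> (ennreal p) 1 s (force \<epsilon>) \<le> ennreal (\<epsilon> * C)"
proof -
  obtain J where J: "finite J" "\<And>j i. j \<notin> J \<Longrightarrow> block_profile j i = (\<lambda>x. 0)"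
    by (rule force_blocks, rule that)
  define n where "n j x = norm (\<chi> i. block_profile j i x)" for j and x :: "real^2"
  define L where "L j = (LINT x|lborel. n j x powr p) powr (1 / p)" for j
  have [measurable]: "block_profile j i \<in> borel_measurable borel" for j i
    by (rule schwartz_measurable[OF block_profile_schwartz])
  have nm [measurable]: "n j \<in> borel_measurable borel" for j
    unfolding n_def norm_vec_def L2_set_def by simp
  have n2: "(n j x)\<^sup>2 = (norm (block_profile j 1 x))\<^sup>2 + (norm (block_profile j 2 x))\<^sup>2" for j x
    by (simp add: n_def norm_vec_def L2_set_def sum_2)
  have n1: "n j x \<le> norm (block_profile j 1 x) + norm (block_profile j 2 x)" for j x
    using L2_set_le_sum[of UNIV "\<lambda>i. norm (block_profile j i x)"] by (simp add: n_def norm_vec_def sum_2)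
  have np: "integrable lborel (\<lambda>x. n j x powr p)" for j
  proof (rule integrable_powr_between[OF p])
    show "0 \<le> n j x" for x by (simp add: n_def)
    show "integrable lborel (\<lambda>x. (n j x)\<^sup>2)"
      unfolding n2 by (intro Bochner_Integration.integrable_add schwartz_integrable_sq block_profile_schwartz)
    show "integrable lborel (n j)"
    proof (rule Bochner_Integration.integrable_bound)
      show "integrable lborel (\<lambda>x. norm (block_profile j 1 x) + norm (block_profile j 2 x))"
        by (intro Bochner_Integration.integrable_add integrable_norm schwartz_integrable block_profile_schwartz)
      show "AE x in lborel. norm (n j x) \<le> norm (norm (block_profile j 1 x) + norm (block_profile j 2 x))"
        using n1 by (simp add: n_def)
    qed measurable
  qed measurable
  have block: "Lp_norm_dist (ennreal p) (\<chi> i. lp_block \<Phi> j (force \<epsilon> $ i)) \<le> ennreal (\<epsilon> * L j)" if \<epsilon>: "0 \<le> \<epsilon>" for \<epsilon> j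
  proof -
    let ?f = "\<lambda>x. \<chi> i. of_real \<epsilon> * block_profile j i x"
    have "Lp_norm_dist (ennreal p) (\<chi> i. lp_block \<Phi> j (force \<epsilon> $ i)) \<le> Lp_norm lborel (ennreal p) (\<lambda>x. ennreal (norm (?f x)))"
      unfolding Lp_norm_dist_def
      by (rule INF_lower) (simp add: lp_block_force represents_scaled[OF block_profile_schwartz])
    also have "(\<lambda>x. ennreal (norm (?f x))) = (\<lambda>x. ennreal (\<epsilon> * n j x))"
    proof
      fix x
      have "?f x = \<epsilon> *\<^sub>R (\<chi> i. block_profile j i x)" 
        unfolding vec_eq_iff vector_scaleR_component vec_lambda_beta by (simp add: scaleR_conv_of_real)
      then show "ennreal (norm (?f x)) = ennreal (\<epsilon> * n j x)" using \<epsilon> by (simp add: n_def)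
    qed
    also have "Lp_norm lborel (ennreal p) (\<lambda>x. ennreal (\<epsilon> * n j x)) = ennreal (\<epsilon> * L j)"
      unfolding L_def by (rule Lp_norm_scaled[OF p(1) \<epsilon> _ np]) (simp add: n_def)
    finally show ?thesis .
  qed
  have L0: "L j = 0" if "j \<notin> J" for j
  proof -
    have "n j = (\<lambda>x. 0)" using J(2)[OF that] by (simp add: n_def fun_eq_iff norm_vec_def L2_set_def)
    then show ?thesis by (simp add: L_def)
  qed
  define C where "C = (\<Sum>j\<in>J. 2 powr (s * real_of_int j) * L j)"
  have C0: "0 \<le> C" unfolding C_def by (intro sum_nonneg) (simp add: L_def)
  show ?thesis
  proof (rule that[OF C0])
    fix \<epsilon> :: real assume \<epsilon>: "0 \<le> \<epsilon>"
    have "besov_norm \<Phi> (ennreal p) 1 s (force \<epsilon>) \<le> (\<integral>\<^sup>+j. ennreal (2 powr (s * real_of_int j)) * ennreal (\<epsilon> * L j) \<partial>count_space UNIV)"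
      unfolding besov_norm_eq by (intro nn_integral_mono mult_left_mono block \<epsilon>) simp
    also have "\<dots> = (\<Sum>j\<in>J. ennreal (2 powr (s * real_of_int j)) * ennreal (\<epsilon> * L j))"
      by (rule nn_integral_count_space'[OF J(1)]) (auto simp: L0)
    also have "\<dots> = (\<Sum>j\<in>J. ennreal (\<epsilon> * (2 powr (s * real_of_int j) * L j)))"
      using \<epsilon> by (intro sum.cong refl) (simp add: L_def ac_simps flip: ennreal_mult)
    also have "\<dots> = ennreal (\<epsilon> * C)"
      using \<epsilon> unfolding C_def sum_distrib_left by (intro sum_ennreal) (simp add: L_def)
    finally show "besov_norm \<Phi> (ennreal p) 1 s (force \<epsilon>) \<le> ennreal (\<epsilon> * C)" .
  qed
qed

lemma force_besov:
  assumes p: "1 \<le> p" "p \<le> 2" and \<epsilon>: "0 \<le> \<epsilon>"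
  shows "force \<epsilon> \<in> besov \<Phi> (ennreal p) 1 s"
  unfolding besov_def
proof (intro CollectI conjI allI)
  show "force \<epsilon> $ i \<in> tempered" for i
    by (rule schwartz_tempered[OF schwartz_cmult[OF force_profile_schwartz] represents_force])
  obtain C where "besov_norm \<Phi> (ennreal p) 1 s (force \<epsilon>) \<le> ennreal (\<epsilon> * C)"
    using besov_norm_force[OF p] \<epsilon> by metis
  then show "besov_norm \<Phi> (ennreal p) 1 s (force \<epsilon>) < \<infinity>" by (simp add: le_less_trans)
  fix i \<phi>
  obtain J where J: "finite J" "\<And>j i. j \<notin> J \<Longrightarrow> block_profile j i = (\<lambda>x. 0)"
    "\<And>i \<xi>. window J \<xi> * (sq \<xi> * amp i \<xi>) = sq \<xi> * amp i \<xi>"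
    by (rule force_blocks, rule that)
  show "((\<lambda>j. lp_block \<Phi> j (force \<epsilon> $ i) \<phi>) has_sum (force \<epsilon> $ i) \<phi>) UNIV"
  proof (rule has_sum_finite_neutralI[OF J(1)])
    show "lp_block \<Phi> j (force \<epsilon> $ i) \<phi> = 0" if "j \<in> UNIV - J" for j
      using that J(2)[of j i] by (simp add: lp_block_force on_schwartz_def)
    show "(force \<epsilon> $ i) \<phi> = (\<Sum>j\<in>J. lp_block \<Phi> j (force \<epsilon> $ i) \<phi>)"
    proof (cases "\<phi> \<in> schwartz")
      case False
      then have "(force \<epsilon> $ i) \<phi> = 0" by (simp add: force_def on_schwartz_def)
      moreover have "lp_block \<Phi> j (force \<epsilon> $ i) \<phi> = 0" for j using False by (simp add: lp_block_force on_schwartz_def)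
      ultimately show ?thesis by simp
    next
      case True
      have bp: "force_profile i x = (\<Sum>j\<in>J. block_profile j i x)" for x
      proof -
        have sum: "fourier (\<lambda>\<xi>. \<Sum>j\<in>K. m j \<xi> * (sq \<xi> * amp i \<xi>)) y = (\<Sum>j\<in>K. fourier (\<lambda>\<xi>. m j \<xi> * (sq \<xi> * amp i \<xi>)) y)" if "finite K" for K y
          using that
        proof (induction K)
          case (insert k K)
          then show ?case
            using fourier_add[of "\<lambda>\<xi>. m k \<xi> * (sq \<xi> * amp i \<xi>)" "\<lambda>\<xi>. \<Sum>j\<in>K. m j \<xi> * (sq \<xi> * amp i \<xi>)" y]
            by (simp add: schwartz_integrable schwartz_sum annular_schwartz[OF block_annular])
        qed (simp add: fourier_zero)
        have "(\<Sum>j\<in>J. m j \<xi> * (sq \<xi> * amp i \<xi>)) = sq \<xi> * amp i \<xi>" for \<xi>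
          using J(3)[of \<xi> i] by (simp add: window_def sum_distrib_right)
        then show ?thesis
          using sum[OF J(1), of "- x"]
          by (simp only: force_profile_def block_profile_def inv_fourier_eq flip: sum_divide_distrib)
      qed
      have "(force \<epsilon> $ i) \<phi> = (LINT x|lborel. (\<Sum>j\<in>J. (of_real \<epsilon> * block_profile j i x) * \<phi> x))"
        using True by (simp add: force_def on_schwartz_def bp sum_distrib_left sum_distrib_right)
      also have "\<dots> = (\<Sum>j\<in>J. LINT x|lborel. (of_real \<epsilon> * block_profile j i x) * \<phi> x)"
        by (intro Bochner_Integration.integral_sum schwartz_integrable_mult schwartz_cmult block_profile_schwartz True)
      finally show ?thesis using True by (simp add: lp_block_force on_schwartz_def)
    qed
  qed simp_all
qed

end

section \<open>Ill-posedness\<close>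

lemma represents_zero: "represents (\<lambda>x. 0) 0"
  by (auto simp: represents_def on_schwartz_def)

context littlewood_paley_family begin

text \<open>\<open>amp\<close> lives where |\<xi>| is at least 1/8, so the weight there is at most
  16, whatever \<open>J\<close> is.\<close>

lemma amp_weight_bound:
  assumes "finite J"
  shows "(LINT \<xi>|lborel. norm (amp i \<xi> * of_real (weight J \<xi>))) \<le> 16 * (LINT \<xi>|lborel. norm (amp i \<xi>))"
proof -
  have S: "amp i \<in> schwartz" by (rule annular_schwartz[OF amp_annular])
  have le: "norm (amp i \<xi> * of_real (weight J \<xi>)) \<le> 16 * norm (amp i \<xi>)" for \<xi>
  proof (cases "amp i \<xi> = 0")
    case False
    have n: "1 / 8 \<le> norm \<xi>" by (rule amp_support[OF False])
    then have "weight J \<xi> \<le> 2 / norm \<xi>" by (intro weight_le assms) auto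
    also have "\<dots> \<le> 2 / (1 / 8)" using n by (intro divide_left_mono) auto
    finally have "weight J \<xi> \<le> 16" by simp
    then show ?thesis
      using mult_left_mono[of "weight J \<xi>" 16 "norm (amp i \<xi>)"] weight_nonneg[of J \<xi>] by (simp add: norm_mult mult.commute)
  qed simp
  have "(LINT \<xi>|lborel. norm (amp i \<xi> * of_real (weight J \<xi>))) \<le> (LINT \<xi>|lborel. 16 * norm (amp i \<xi>))"
    by (rule integral_mono[OF _ _ le])
       (intro integrable_norm integrable_mult_right schwartz_integrable schwartz_integrable_mult S annular_schwartz weight_annular assms)+
  then show ?thesis by simp
qed

text \<open>The threshold \<delta> does not depend on \<epsilon>: below it the remainder is small
  relative to the total energy \<open>Q\<close> of the solution, so the anisotropy survives and
  contradicts the low-frequency behaviour.\<close>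

lemma solution_lower_bound:
  assumes p: "1 \<le> p" "p \<le> 2"
  obtains \<delta> \<epsilon>0 where "0 < \<delta>" "0 < \<epsilon>0"
    "\<And>\<epsilon> U. 0 < \<epsilon> \<Longrightarrow> \<epsilon> < \<epsilon>0 \<Longrightarrow> is_solution \<Phi> (besov \<Phi> (ennreal p) 1 (2 / p - 1)) (force \<epsilon>) U \<Longrightarrow>
      ennreal \<delta> \<le> besov_norm \<Phi> (ennreal p) 1 (2 / p - 1) U"
proof -
  let ?S = "besov \<Phi> (ennreal p) 1 (2 / p - 1)" and ?N = "besov_norm \<Phi> (ennreal p) 1 (2 / p - 1)"
  define v where "v i = inv_fourier (amp i)" for i
  have aS: "amp i \<in> schwartz" for i by (rule annular_schwartz[OF amp_annular])
  have vS: "v i \<in> schwartz" for i unfolding v_def by (intro inv_fourier_schwartz aS)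
  have vm [measurable]: "v i \<in> borel_measurable lborel" for i using schwartz_measurable[OF vS] by simp
  obtain \<kappa> :: real where \<kappa>: "0 < \<kappa>"
    and persist: "\<And>\<epsilon> r1 r2. 0 < \<epsilon> \<Longrightarrow> r1 \<in> borel_measurable lborel \<Longrightarrow> r2 \<in> borel_measurable lborel \<Longrightarrow>
      integrable lborel (\<lambda>x. (norm (r1 x))\<^sup>2) \<Longrightarrow> integrable lborel (\<lambda>x. (norm (r2 x))\<^sup>2) \<Longrightarrow>
      (LINT x|lborel. (norm (r1 x))\<^sup>2) + (LINT x|lborel. (norm (r2 x))\<^sup>2) \<le>
        \<kappa> * ((LINT x|lborel. (norm (of_real \<epsilon> * v 1 x + r1 x))\<^sup>2) + (LINT x|lborel. (norm (of_real \<epsilon> * v 2 x + r2 x))\<^sup>2)) \<Longrightarrow>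
      (LINT x|lborel. ((of_real \<epsilon> * v 1 x + r1 x) + \<i> * (of_real \<epsilon> * v 2 x + r2 x))\<^sup>2) \<noteq> 0"
    by (rule anisotropy_persists[OF vm vm schwartz_integrable_sq[OF vS] schwartz_integrable_sq[OF vS] amp_anisotropic[folded v_def]], rule that)
  define K where "K = 64 * pi * 256"
  define A where "A = 16 * (LINT \<xi>|lborel. norm (amp 1 \<xi>)) + 16 * (LINT \<xi>|lborel. norm (amp 2 \<xi>))"
  have K0: "0 < K" by (simp add: K_def)
  have A0: "0 \<le> A" by (simp add: A_def)
  \<comment> \<open>For both components together the remainder is at most 24 Q (K n + \<epsilon> A).
    The two thresholds make each summand at most \<kappa>/48, hence the total at most \<kappa> Q;
    \<open>A + 1\<close> avoids a zero denominator.\<close>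
  define \<delta> where "\<delta> = \<kappa> / (48 * K)"
  define \<epsilon>0 where "\<epsilon>0 = \<kappa> / (48 * (A + 1))"
  have \<delta>0: "0 < \<delta>" and \<epsilon>00: "0 < \<epsilon>0" using \<kappa> K0 A0 by (auto simp: \<delta>_def \<epsilon>0_def)
  show ?thesis
  proof (rule that[OF \<delta>0 \<epsilon>00], rule ccontr)
    fix \<epsilon> U
    assume \<epsilon>: "0 < \<epsilon>" "\<epsilon> < \<epsilon>0" and sol: "is_solution \<Phi> ?S (force \<epsilon>) U" and "\<not> ennreal \<delta> \<le> ?N U"
    then have lt: "?N U < ennreal \<delta>" by simp
    define n where "n = enn2real (?N U)"
    have n\<delta>: "n \<le> \<delta>" unfolding n_def using lt \<delta>0 by (intro enn2real_leI) auto
    have US: "U \<in> ?S" using sol by (simp add: is_solution_def)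
    from sol obtain W u where UW: "U = inv_neg_laplacian_helmholtz \<Phi> (force \<epsilon>) - inv_neg_laplacian_helmholtz \<Phi> (div_matrix_dist W)"
      and ru: "\<And>i. represents (\<lambda>x. (u :: real^2 \<Rightarrow> complex^2) x $ i) (U $ i)"
      and rW: "\<And>i j. represents (\<lambda>x. u x $ i * u x $ j) (W $ i $ j)"
      unfolding is_solution_def is_tensor_square_def by blast
    have um [measurable]: "(\<lambda>x. u x $ i) \<in> borel_measurable borel" for i
      using ru[of i] by (simp add: represents_def)
    \<comment> \<open>Square integrability is not part of the notion of solution. It follows from
      the Besov norm by duality and makes U \<otimes> U integrable.\<close>
    have usq: "integrable lborel (\<lambda>x. (norm (u x $ i))\<^sup>2)" for i
    proof (rule L2_duality(1)[OF um])
      show "0 \<le> 32 * n" by (simp add: n_def)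
      fix \<phi> assume \<phi>: "\<phi> \<in> schwartz"
      show "integrable lborel (\<lambda>x. u x $ i * \<phi> x)" using ru[of i] \<phi> by (simp add: represents_def)
      have "(U $ i) \<phi> = (LINT x|lborel. u x $ i * \<phi> x)" using ru[of i] \<phi> by (simp add: represents_def on_schwartz_def)
      then show "norm (LINT x|lborel. u x $ i * \<phi> x) \<le> 32 * n * sqrt (LINT x|lborel. (norm (\<phi> x))\<^sup>2)"
        using besov_dual_L2[OF p US \<phi>, of i] by (simp add: n_def)
    qed
    define w where "w i j x = u x $ i * u x $ j" for i j x
    have w: "integrable lborel (w i j)" for i j
      unfolding w_def[abs_def] using usq by (intro integrable_sq_mult) auto
    define Q where "Q = (LINT x|lborel. (norm (u x $ 1))\<^sup>2) + (LINT x|lborel. (norm (u x $ 2))\<^sup>2)"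
    have Q0: "0 \<le> Q" by (simp add: Q_def)
    have wQ: "norm (fourier (w i j) \<xi>) \<le> Q" for i j \<xi>
    proof -
      have pt: "norm (w i j x) \<le> (norm (u x $ 1))\<^sup>2 + (norm (u x $ 2))\<^sup>2" for x
      proof -
        have "norm (u x $ i) \<le> norm (u x)" "norm (u x $ j) \<le> norm (u x)"
          by (rule Finite_Cartesian_Product.norm_nth_le)+
        then have "norm (w i j x) \<le> norm (u x) * norm (u x)"
          unfolding w_def norm_mult by (intro mult_mono) auto
        also have "\<dots> = (norm (u x $ 1))\<^sup>2 + (norm (u x $ 2))\<^sup>2"
          by (simp add: norm_vec_def L2_set_def sum_2)
        finally show ?thesis .
      qed
      have "(LINT x|lborel. norm (w i j x)) \<le> (LINT x|lborel. (norm (u x $ 1))\<^sup>2 + (norm (u x $ 2))\<^sup>2)"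
        by (intro integral_mono integrable_norm w Bochner_Integration.integrable_add usq pt)
      also have "\<dots> = Q" unfolding Q_def by (intro Bochner_Integration.integral_add usq)
      finally show ?thesis using norm_fourier_le[of "w i j" \<xi>] by linarith
    qed
    define d where "d k \<xi> = \<i> * coord 1 \<xi> * fourier (w k 1) \<xi> + \<i> * coord 2 \<xi> * fourier (w k 2) \<xi>" for k \<xi>
    have dQ: "norm (d k \<xi>) \<le> 2 * norm \<xi> * Q" for k \<xi>
    proof -
      have "norm (\<i> * coord l \<xi> * fourier (w k l) \<xi>) \<le> norm \<xi> * Q" for l
        unfolding norm_mult norm_ii mult_1 by (intro mult_mono norm_coord_le wQ) auto
      from add_mono[OF this[of 1] this[of 2]] show ?thesis unfolding d_def by (intro norm_triangle_le) (simp add: ac_simps)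
    qed
    have rd: "fourier_rep (div_matrix_dist W $ k) (d k)" for k
    proof -
      have "fourier_rep (W $ k $ l) (fourier (w k l))" for l
        unfolding w_def[abs_def] by (rule fourier_rep_represents[OF rW w[unfolded w_def[abs_def]]])
      from fourier_rep_div[of "W $ k" "\<lambda>l. fourier (w k l)", OF this]
      show ?thesis by (simp add: div_matrix_dist_def d_def[abs_def])
    qed
    define \<rho> where "\<rho> i \<xi> = - leray d i \<xi>" for i \<xi>
    have rU: "fourier_rep (U $ i) (\<lambda>\<xi>. of_real \<epsilon> * amp i \<xi> + \<rho> i \<xi>)" for i
    proof (rule fourier_rep_cong)
      show "fourier_rep (U $ i) (\<lambda>\<xi>. leray (\<lambda>k \<xi>. of_real \<epsilon> * (sq \<xi> * amp k \<xi>)) i \<xi> - leray d i \<xi>)"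
        unfolding UW vector_minus_component
        by (intro fourier_rep_diff fourier_rep_inv_neg_laplacian_helmholtz fourier_rep_force rd)
      fix \<xi> :: "real^2" assume x: "\<xi> \<noteq> 0"
      then have s: "complex_of_real ((norm \<xi>)\<^sup>2) \<noteq> 0" by simp
      have "coord 1 \<xi> * (of_real \<epsilon> * (sq \<xi> * amp 1 \<xi>)) + coord 2 \<xi> * (of_real \<epsilon> * (sq \<xi> * amp 2 \<xi>))
          = of_real \<epsilon> * sq \<xi> * (coord 1 \<xi> * amp 1 \<xi> + coord 2 \<xi> * amp 2 \<xi>)" by (simp add: algebra_simps)
      then have "leray (\<lambda>k \<xi>. of_real \<epsilon> * (sq \<xi> * amp k \<xi>)) i \<xi> = of_real \<epsilon> * amp i \<xi>"
        unfolding leray_def amp_solenoidal sq_eq using s by simp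
      then show "leray (\<lambda>k \<xi>. of_real \<epsilon> * (sq \<xi> * amp k \<xi>)) i \<xi> - leray d i \<xi> = of_real \<epsilon> * amp i \<xi> + \<rho> i \<xi>"
        by (simp add: \<rho>_def)
    qed
    have ea: "annular (\<lambda>\<xi>. of_real \<epsilon> * amp i \<xi>)" for i by (rule annular_mult[OF multiplier_const amp_annular])
    have ie: "inv_fourier (\<lambda>\<xi>. of_real \<epsilon> * amp i \<xi>) x = of_real \<epsilon> * v i x" for i x
      by (simp add: v_def inv_fourier_eq fourier_cmult)
    have [measurable]: "fourier (w k l) \<in> borel_measurable borel" for k l by (rule fourier_measurable[OF w])
    have \<rho>m: "\<rho> i \<in> borel_measurable borel" for i
      unfolding \<rho>_def[abs_def] leray_def d_def by measurable
    have \<rho>b: "norm (\<rho> i \<xi>) \<le> (6 * Q) / norm \<xi>" if "\<xi> \<noteq> 0" for i \<xi>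
      unfolding \<rho>_def norm_minus_cancel by (rule leray_bound[of \<xi> d Q, OF that dQ])
    have wt: "(LINT \<xi>|lborel. norm (of_real \<epsilon> * amp i \<xi> * of_real (weight J \<xi>))) \<le> \<epsilon> * A" if J: "finite J" for i J
    proof -
      have "(LINT \<xi>|lborel. norm (of_real \<epsilon> * amp i \<xi> * of_real (weight J \<xi>))) = \<epsilon> * (LINT \<xi>|lborel. norm (amp i \<xi> * of_real (weight J \<xi>)))"
        using \<epsilon> by (simp add: norm_mult mult.assoc)
      also have "\<dots> \<le> \<epsilon> * (16 * (LINT \<xi>|lborel. norm (amp i \<xi>)))"
        using \<epsilon> by (intro mult_left_mono amp_weight_bound J) auto
      also have "\<dots> \<le> \<epsilon> * A"
      proof (intro mult_left_mono)
        have "0 \<le> (LINT \<xi>|lborel. norm (amp k \<xi>))" for k by simp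
        then show "16 * (LINT \<xi>|lborel. norm (amp i \<xi>)) \<le> A" using exhaust_2[of i] by (auto simp: A_def)
      qed (use \<epsilon> in simp)
      finally show ?thesis .
    qed
    note R = remainder_bound[OF p US rU ea ru \<rho>m _ \<rho>b wt, unfolded ie]
    define r where "r i x = u x $ i - of_real \<epsilon> * v i x" for i x
    have rm: "r i \<in> borel_measurable lborel" for i unfolding r_def[abs_def] by measurable
    have ri: "integrable lborel (\<lambda>x. (norm (r i x))\<^sup>2)" for i
      unfolding r_def using Q0 by (intro R(1)) auto
    have rb: "(LINT x|lborel. (norm (r i x))\<^sup>2) \<le> 12 * Q * (K * n + \<epsilon> * A)" for i
      unfolding r_def K_def n_def using R(2)[of i] Q0 by simp
    have e: "of_real \<epsilon> * v i x + r i x = u x $ i" for i x by (simp add: r_def)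
    have "(LINT x|lborel. (norm (r 1 x))\<^sup>2) + (LINT x|lborel. (norm (r 2 x))\<^sup>2) \<le> 24 * Q * (K * n + \<epsilon> * A)"
      using rb[of 1] rb[of 2] by simp
    also have "\<dots> \<le> 24 * Q * (\<kappa> / 24)"
    proof (intro mult_left_mono)
      have "K * n \<le> K * \<delta>" using n\<delta> K0 by (intro mult_left_mono) auto
      also have "\<dots> = \<kappa> / 48" using K0 by (simp add: \<delta>_def)
      finally have 1: "K * n \<le> \<kappa> / 48" .
      have "\<epsilon> * A \<le> \<epsilon>0 * (A + 1)" using \<epsilon> A0 by (intro mult_mono) auto
      also have "\<dots> = \<kappa> / 48"
      proof -
        have "\<kappa> / (48 * y) * y = \<kappa> / 48" if "0 < y" for y :: real using that by (simp add: field_simps)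
        from this[of "A + 1"] A0 show ?thesis by (simp only: \<epsilon>0_def)
      qed
      finally show "K * n + \<epsilon> * A \<le> \<kappa> / 24" using 1 by linarith
    qed (use Q0 in simp)
    also have "\<dots> = \<kappa> * Q" by simp
    finally have "(LINT x|lborel. ((of_real \<epsilon> * v 1 x + r 1 x) + \<i> * (of_real \<epsilon> * v 2 x + r 2 x))\<^sup>2) \<noteq> 0"
      by (intro persist \<epsilon> rm ri) (simp only: e Q_def)
    then have ne: "(LINT x|lborel. (u x $ 1 + \<i> * u x $ 2)\<^sup>2) \<noteq> 0" unfolding e .
    have "w 2 1 = w 1 2" by (simp add: w_def fun_eq_iff)
    \<comment> \<open>Below radius 1/8 the amplitude vanishes, and the solution is the projected
      nonlinearity alone.\<close>
    have low: "of_real \<epsilon> * amp i \<xi> + \<rho> i \<xi> = - leray (\<lambda>k \<xi>. \<i> * coord 1 \<xi> * fourier (w k 1) \<xi> + \<i> * coord 2 \<xi> * fourier (w k 2) \<xi>) i \<xi>"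
      if "\<xi> \<noteq> 0" "norm \<xi> < 1 / 8" for i \<xi>
      using amp_support[of i \<xi>] that(2) unfolding \<rho>_def d_def[abs_def] by (cases "amp i \<xi> = 0") auto
    note Z = low_frequency[where r="1/8", OF p US rU _ _ w \<open>w 2 1 = w 1 2\<close>]
    have Z1: "(LINT x|lborel. w 1 2 x) = 0" by (rule Z(1)) (simp, rule low)
    have Z2: "(LINT x|lborel. w 1 1 x) = (LINT x|lborel. w 2 2 x)" by (rule Z(2)) (simp, rule low)
    \<comment> \<open>Equal diagonal entries and a vanishing off-diagonal entry force the quadratic
      functional to be 0, against \<open>ne\<close>.\<close>
    have "(LINT x|lborel. (u x $ 1 + \<i> * u x $ 2)\<^sup>2) = (LINT x|lborel. w 1 1 x - w 2 2 x + 2 * \<i> * w 1 2 x)"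
      by (intro Bochner_Integration.integral_cong refl) (simp add: w_def power2_eq_square algebra_simps)
    also have "\<dots> = (LINT x|lborel. w 1 1 x) - (LINT x|lborel. w 2 2 x) + 2 * \<i> * (LINT x|lborel. w 1 2 x)"
      using w by simp
    also have "\<dots> = 0" using Z1 Z2 by simp
    finally show False using ne by simp
  qed
qed

section \<open>The zero solution\<close>

lemma fourier_multiplier_dist_zero: "inv_fourier_dist (mult_dist g (fourier_dist 0)) = 0"
  by (auto simp: inv_fourier_dist_def mult_dist_def fourier_dist_def on_schwartz_def fun_eq_iff)

lemma inv_neg_laplacian_zero: "inv_neg_laplacian \<Phi> 0 = 0"
  by (simp add: inv_neg_laplacian_def fourier_multiplier_dist_zero fun_eq_iff)

lemma partial_dist_zero: "partial_dist i 0 = 0"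
  by (auto simp: partial_dist_def on_schwartz_def fun_eq_iff)

lemma div_dist_zero: "(\<And>i. V $ i = 0) \<Longrightarrow> div_dist V = 0"
  by (simp add: div_dist_def partial_dist_zero)

lemma inv_neg_laplacian_helmholtz_zero: "inv_neg_laplacian_helmholtz \<Phi> 0 = 0"
  by (simp add: inv_neg_laplacian_helmholtz_def helmholtz_def grad_dist_def vec_eq_iff
      inv_neg_laplacian_zero partial_dist_zero div_dist_zero)

lemma force_zero: "force 0 = 0"
  by (auto simp: force_def on_schwartz_def vec_eq_iff fun_eq_iff)

text \<open>Zero is the force of strength 0, and the norm bound is linear in the strength.\<close>

lemma besov_norm_zero:
  assumes "1 \<le> p" "p \<le> 2" shows "besov_norm \<Phi> (ennreal p) 1 s 0 = 0"
proof -
  obtain C where "\<And>\<epsilon>. 0 \<le> \<epsilon> \<Longrightarrow> besov_norm \<Phi> (ennreal p) 1 s (force \<epsilon>) \<le> ennreal (\<epsilon> * C)"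
    using besov_norm_force[OF assms] by metis
  from this[of 0] show ?thesis by (simp add: force_zero)
qed

lemma zero_besov: "1 \<le> p \<Longrightarrow> p \<le> 2 \<Longrightarrow> 0 \<in> besov \<Phi> (ennreal p) 1 s"
  using force_besov[of p 0] by (simp add: force_zero)

lemma zero_solution: "0 \<in> S \<Longrightarrow> is_solution \<Phi> S 0 0"
  unfolding is_solution_def
proof (intro conjI exI)
  have "represents (\<lambda>x. (0::complex^2) $ i * (0::complex^2) $ j) ((0::functional^2^2) $ i $ j)" for i j :: 2
    using represents_zero by simp
  then show "is_tensor_square 0 0"
    unfolding is_tensor_square_def using represents_zero by (intro exI[of _ "\<lambda>x. 0"]) simp
  have "div_matrix_dist 0 = 0"
    by (simp add: div_matrix_dist_def vec_eq_iff div_dist_zero)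
  then show "0 = inv_neg_laplacian_helmholtz \<Phi> 0 - inv_neg_laplacian_helmholtz \<Phi> (div_matrix_dist 0)"
    by (simp add: inv_neg_laplacian_helmholtz_zero)
qed

end

theorem theorem1p2:
  fixes \<Phi> :: "int \<Rightarrow> real^2 \<Rightarrow> complex" and p :: real
  assumes "littlewood_paley \<Phi>" and "1 \<le> p" and "p \<le> 2"
  shows "ill_posed \<Phi>
           (besov \<Phi> (ennreal p) 1 (2 / p - 3)) (besov_norm \<Phi> (ennreal p) 1 (2 / p - 3))
           (besov \<Phi> (ennreal p) 1 (2 / p - 1)) (besov_norm \<Phi> (ennreal p) 1 (2 / p - 1))
       \<and> (\<exists>\<delta>\<^sub>0 :: real. \<exists>N\<^sub>0 :: nat. \<exists>F :: nat \<Rightarrow> functional^2.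
            \<delta>\<^sub>0 > 0 \<and> N\<^sub>0 > 0 \<and>
            (\<forall>N. F N \<in> besov \<Phi> (ennreal p) 1 (2 / p - 3)) \<and>
            (\<lambda>N. besov_norm \<Phi> (ennreal p) 1 (2 / p - 3) (F N)) \<longlonglongrightarrow> 0 \<and>
            (\<forall>U :: nat \<Rightarrow> functional^2.
               (\<forall>N\<ge>N\<^sub>0. is_solution \<Phi> (besov \<Phi> (ennreal p) 1 (2 / p - 1)) (F N) (U N)) \<longrightarrow>
               (INF N\<in>{N\<^sub>0..}. besov_norm \<Phi> (ennreal p) 1 (2 / p - 1) (U N)) \<ge> ennreal \<delta>\<^sub>0))"
proof -
  interpret littlewood_paley_family \<Phi> by standard fact
  note p = assms(2,3)
  let ?D = "besov \<Phi> (ennreal p) 1 (2 / p - 3)" and ?ND = "besov_norm \<Phi> (ennreal p) 1 (2 / p - 3)"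
  let ?S = "besov \<Phi> (ennreal p) 1 (2 / p - 1)" and ?NS = "besov_norm \<Phi> (ennreal p) 1 (2 / p - 1)"
  obtain \<delta> \<epsilon>0 where \<delta>: "0 < \<delta>" and \<epsilon>0: "0 < \<epsilon>0"
    and lower: "\<And>\<epsilon> U. 0 < \<epsilon> \<Longrightarrow> \<epsilon> < \<epsilon>0 \<Longrightarrow> is_solution \<Phi> ?S (force \<epsilon>) U \<Longrightarrow> ennreal \<delta> \<le> ?NS U"
    by (rule solution_lower_bound[OF p], rule that)
  \<comment> \<open>Strengths 1/(N + 1), so that index 0 makes sense; from an index exceeding
    1/\<open>\<epsilon>0\<close> on they are below the threshold.\<close>
  define F where "F N = force (1 / real (Suc N))" for N
  have FD: "F N \<in> ?D" for N unfolding F_def by (rule force_besov[OF p]) simp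
  have Flim: "(\<lambda>N. ?ND (F N)) \<longlonglongrightarrow> 0"
  proof -
    obtain C where C: "0 \<le> C" "\<And>\<epsilon>. 0 \<le> \<epsilon> \<Longrightarrow> ?ND (force \<epsilon>) \<le> ennreal (\<epsilon> * C)"
      by (rule besov_norm_force[OF p], rule that)
    have "(\<lambda>N. 1 / real (Suc N) * C) \<longlonglongrightarrow> 0 * C"
      using LIMSEQ_inverse_real_of_nat by (intro tendsto_intros) (simp add: inverse_eq_divide)
    then have "(\<lambda>N. ennreal (1 / real (Suc N) * C)) \<longlonglongrightarrow> ennreal (0 * C)" by (rule tendsto_ennrealI)
    then have lim: "(\<lambda>N. ennreal (1 / real (Suc N) * C)) \<longlonglongrightarrow> 0" by simp
    show ?thesis
    proof (rule tendsto_sandwich[OF _ _ tendsto_const lim])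
      show "\<forall>\<^sub>F N in sequentially. ?ND (F N) \<le> ennreal (1 / real (Suc N) * C)"
        unfolding F_def by (intro always_eventually allI C(2)) simp
    qed simp
  qed
  obtain N0 where N0: "1 / \<epsilon>0 < real N0" using reals_Archimedean2 by blast
  have N0pos: "0 < N0" using N0 \<epsilon>0 by (cases "N0 = 0") (auto simp: not_less[symmetric])
  have lowerN: "ennreal \<delta> \<le> ?NS U" if "N0 \<le> N" "is_solution \<Phi> ?S (F N) U" for N U
  proof (rule lower)
    show "is_solution \<Phi> ?S (force (1 / real (Suc N))) U" using that(2) by (simp add: F_def)
    have "1 / \<epsilon>0 < real (Suc N)" using N0 that(1) by linarith
    then show "1 / real (Suc N) < \<epsilon>0" using \<epsilon>0 by (simp add: field_simps)
  qed simp
  have "ill_posed \<Phi> ?D ?ND ?S ?NS"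
    unfolding ill_posed_def
  proof
    assume "well_posed \<Phi> ?D ?ND ?S ?NS"
    then obtain d e \<Psi> where d: "0 < d" and e: "0 < e"
      and uniq: "\<And>F U V. F \<in> norm_ball ?D ?ND d \<Longrightarrow> U \<in> norm_ball ?S ?NS e \<Longrightarrow> V \<in> norm_ball ?S ?NS e \<Longrightarrow>
        is_solution \<Phi> ?S F U \<Longrightarrow> is_solution \<Phi> ?S F V \<Longrightarrow> U = V"
      and \<Psi>: "\<And>F. F \<in> norm_ball ?D ?ND d \<Longrightarrow> \<Psi> F \<in> norm_ball ?S ?NS e \<and> is_solution \<Phi> ?S F (\<Psi> F)"
      and cont: "norm_continuous_on (norm_ball ?D ?ND d) ?ND ?NS \<Psi>"
      unfolding well_posed_def by blast
    have 0: "0 \<in> norm_ball ?D ?ND d" "0 \<in> norm_ball ?S ?NS e"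
      using d e by (auto simp: norm_ball_def zero_besov[OF p] besov_norm_zero[OF p])
    \<comment> \<open>The zero field solves the equation with zero force and lies in every ball, so
      uniqueness identifies it with the value of the solution map.\<close>
    have "\<Psi> 0 = 0"
      using uniq[OF 0(1) _ 0(2)] \<Psi>[OF 0(1)] zero_solution[OF zero_besov[OF p]] by blast
    obtain t where t: "0 < t" "\<And>y. y \<in> norm_ball ?D ?ND d \<Longrightarrow> ?ND (y - 0) < ennreal t \<Longrightarrow> ?NS (\<Psi> y - \<Psi> 0) < ennreal \<delta>"
      using cont 0(1) \<delta> unfolding norm_continuous_on_def by blast
    \<comment> \<open>Far along the sequence the force is admissible data and within the modulus of
      continuity for \<delta> at 0, yet each of its solutions has norm at least \<delta>.\<close>
    have "\<forall>\<^sub>F N in sequentially. ?ND (F N) < ennreal (min d t)"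
      using d t(1) by (intro order_tendstoD(2)[OF Flim]) auto
    then obtain N where N: "N0 \<le> N" "?ND (F N) < ennreal (min d t)"
      unfolding eventually_sequentially by (meson nle_le)
    have "ennreal (min d t) \<le> ennreal d" "ennreal (min d t) \<le> ennreal t" by (auto intro: ennreal_leI)
    then have "F N \<in> norm_ball ?D ?ND d" and "?ND (F N - 0) < ennreal t"
      using N(2) FD[of N] by (auto simp: norm_ball_def intro: less_le_trans)
    then have "?NS (\<Psi> (F N)) < ennreal \<delta>" "is_solution \<Phi> ?S (F N) (\<Psi> (F N))"
      using t(2) \<Psi> \<open>\<Psi> 0 = 0\<close> by auto
    with lowerN[OF N(1)] show False by (simp add: not_less[symmetric])
  qed
  moreover have "ennreal \<delta> \<le> (INF N\<in>{N0..}. ?NS (U N))"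
    if "\<forall>N\<ge>N0. is_solution \<Phi> ?S (F N) (U N)" for U
    using that lowerN by (intro INF_greatest) auto
  ultimately show ?thesis
    using \<delta> N0pos FD Flim by (intro conjI exI[of _ \<delta>] exI[of _ N0] exI[of _ F]) auto
qed

end
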